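(* Let $\tilde M$ be a Kenmotsu manifold with structure $(\phi,\xi,\eta,g)$, and let $M=N_\theta\times_f N_T$ be a warped product semi-slant submanifold of $\tilde M$ such that $\xi\in TN_\theta$, where $N_T$ is an invariant submanifold and $N_\theta$ is a proper slant submanifold of $\tilde M$, with slant angle $\theta$. Then $$g\big((\tilde\nabla_X N)Z,NZ\big)=\sec^2\theta\; g\big((\tilde\nabla_X N)TZ,NTZ\big)$$ for all $X\in TN_T$ and $Z\in TN_\theta$.
   Context: An almost contact metric structure on a $(2n+1)$-dimensional smooth manifold $\tilde M$ is $(\phi,\xi,\eta,g)$ with $\phi$ a $(1,1)$-tensor field, $\xi$ a vector field, $\eta$ a 1-form and $g$ a Riemannian metric such that $\phi^2=-I+\eta\otimes\xi$, $\eta(\xi)=1$, $\eta\circ\phi=0$, $\phi\xi=0$, $g(X,Y)=g(\phi X,\phi Y)+\eta(X)\eta(Y)$, $g(X,\phi Y)=-g(\phi X,Y)$, $g(X,\xi)=\eta(X)$. It is Kenmotsu if $(\tilde\nabla_X\phi)Y=g(\phi X,Y)\xi-\eta(Y)\phi X$ for all $X,Y\in T\tilde M$, where $\tilde\nabla$ is the Levi-Civita connection of $g$. For a submanifold $M$ of $\tilde M$ (with induced metric, also denoted $g$), $\nabla$ is the induced Levi-Civita connection, $T^\perp M$ the normal bundle and $\nabla^\perp$ the normal connection. For $X\in TM$ write $\phi X=TX+NX$ with $TX\in TM$ and $NX\in T^\perp M$. The covariant derivative of $N$ is $(\tilde\nabla_X N)Y=\nabla^\perp_X(NY)-N(\nabla_XY)$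 for $X,Y\in TM$. Throughout, $\xi$ is tangent to $M$. A submanifold $P$ of $\tilde M$ is invariant if $\phi(TP)\subseteq TP$. It is slant if the angle between $\phi X$ and the tangent space of $P$ is a constant $\theta$ (the slant angle) for all nonzero tangent vectors $X$ of $P$ not proportional to $\xi$; it is proper slant if $\theta\neq 0,\pi/2$. The warped product $N_1\times_f N_2$ of Riemannian manifolds $(N_1,g_1)$, $(N_2,g_2)$, with $f$ a positive differentiable function on $N_1$, is $N_1\times N_2$ with metric $g_1+f^2g_2$. A warped product submanifold of $\tilde M$ is a submanifold whose induced metric is such a warped product metric; $TN_1$ and $TN_2$ are regarded as subbundles of $TM$. A semi-slant submanifold is one with an orthogonal decomposition $TM=D_1\oplus D_2\oplus\{\xi\}$ where $\phi(D_1)=D_1$ and $D_2$ is slant with slant angle $\theta\neq0$ (the angle between $\phi X$ and $D_2$ is the constant $\theta$ for nonzero $X\in D_2$). Here $TN_T=D_1$ and $TN_\theta=D_2\oplus\{\xi\}$. *)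

theory Defs
  imports "HOL-Analysis.Analysis"
begin

section \<open>Smooth manifolds\<close>

text \<open>Smoothness is only meant for open sets \<^term>\<open>S\<close>.\<close>

primrec Ck_on :: "nat \<Rightarrow> 'e::euclidean_space set \<Rightarrow> ('e \<Rightarrow> 'f::euclidean_space) \<Rightarrow> bool" where
  "Ck_on 0 S f \<longleftrightarrow> continuous_on S f"
| "Ck_on (Suc k) S f \<longleftrightarrow>
     f differentiable_on S \<and> (\<forall>v. Ck_on k S (\<lambda>x. frechet_derivative f (at x) v))"

definition smooth_on :: "'e::euclidean_space set \<Rightarrow> ('e \<Rightarrow> 'f::euclidean_space) \<Rightarrow> bool" where
  "smooth_on S f \<longleftrightarrow> (\<forall>k. Ck_on k S f)"

record ('a, 'e) chart =
  chart_dom :: "'a set"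
  chart_map :: "'a \<Rightarrow> 'e"

definition chart_inv :: "('a, 'e) chart \<Rightarrow> 'e \<Rightarrow> 'a" where
  "chart_inv c = inv_into (chart_dom c) (chart_map c)"

text \<open>A manifold carries an atlas (not necessarily maximal) together with a preferred chart
  around each point.  The tangent space at \<open>p\<close> is represented by the model space \<open>'e\<close>: the
  vector \<open>v :: 'e\<close> stands for the tangent vector at \<open>p\<close> whose components in the preferred
  chart at \<open>p\<close> are \<open>v\<close>.  Accordingly a vector field has type \<open>'a \<Rightarrow> 'e\<close>, a
  1-form \<open>'a \<Rightarrow> 'e \<Rightarrow> real\<close>, a (1,1)-tensor field \<open>'a \<Rightarrow> 'e \<Rightarrow> 'e\<close> and a
  (0,2)-tensor field \<open>'a \<Rightarrow> 'e \<Rightarrow> 'e \<Rightarrow> real\<close>.  Smoothness of such fields is always tested on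
  components in the charts of the atlas, never on the raw function, because the preferred chart
  may jump from point to point.\<close>

record ('a, 'e) manifold =
  atlas :: "('a, 'e) chart set"
  chart_at :: "'a \<Rightarrow> ('a, 'e) chart"

definition smooth_manifold ::
  "('a::{t2_space,second_countable_topology}, 'e::euclidean_space) manifold \<Rightarrow> bool" where
  "smooth_manifold M \<longleftrightarrow>
     (\<forall>c\<in>atlas M. open (chart_dom c) \<and> open (chart_map c ` chart_dom c) \<and>
        homeomorphism (chart_dom c) (chart_map c ` chart_dom c) (chart_map c) (chart_inv c)) \<and>
     (\<forall>c\<in>atlas M. \<forall>d\<in>atlas M.
        smooth_on (chart_map c ` (chart_dom c \<inter> chart_dom d)) (chart_map d \<circ> chart_inv c)) \<and>
     (\<forall>p. chart_at M p \<in> atlas M \<and> p \<in> chart_dom (chart_at M p))"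

definition prod_chart :: "('a, 'e) chart \<Rightarrow> ('b, 'f) chart \<Rightarrow> ('a \<times> 'b, 'e \<times> 'f) chart" where
  "prod_chart c d =
     \<lparr>chart_dom = chart_dom c \<times> chart_dom d, chart_map = map_prod (chart_map c) (chart_map d)\<rparr>"

text \<open>With the product charts as preferred charts, the tangent space of the product at \<open>(p, q)\<close>
  is literally \<open>'e \<times> 'f\<close>.\<close>

definition prod_manifold ::
  "('a, 'e) manifold \<Rightarrow> ('b, 'f) manifold \<Rightarrow> ('a \<times> 'b, 'e \<times> 'f) manifold" where
  "prod_manifold A B =
     \<lparr>atlas = {prod_chart c d | c d. c \<in> atlas A \<and> d \<in> atlas B},
      chart_at = (\<lambda>(p, q). prod_chart (chart_at A p) (chart_at B q))\<rparr>"


section \<open>Smooth maps, vector fields and tensor fields\<close>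

definition coord_change ::
  "('a, 'e::euclidean_space) chart \<Rightarrow> ('a, 'e) chart \<Rightarrow> 'a \<Rightarrow> 'e \<Rightarrow> 'e" where
  "coord_change c d p = frechet_derivative (chart_map d \<circ> chart_inv c) (at (chart_map c p))"

definition components ::
  "('a, 'e::euclidean_space) manifold \<Rightarrow> ('a, 'e) chart \<Rightarrow> 'a \<Rightarrow> 'e \<Rightarrow> 'e" where
  "components M c p v = coord_change (chart_at M p) c p v"

text \<open>The vector field, meaningful on the domain of \<open>c\<close>, whose components in \<open>c\<close> are
  constantly \<open>v\<close>.\<close>

definition coord_field ::
  "('a, 'e::euclidean_space) manifold \<Rightarrow> ('a, 'e) chart \<Rightarrow> 'e \<Rightarrow> 'a \<Rightarrow> 'e" where
  "coord_field M c v p = coord_change c (chart_at M p) p v"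

definition smooth_fun_on ::
  "('a, 'e::euclidean_space) manifold \<Rightarrow> 'a set \<Rightarrow> ('a \<Rightarrow> real) \<Rightarrow> bool" where
  "smooth_fun_on M U h \<longleftrightarrow>
     (\<forall>c\<in>atlas M. smooth_on (chart_map c ` (chart_dom c \<inter> U)) (h \<circ> chart_inv c))"

definition smooth_field_on ::
  "('a, 'e::euclidean_space) manifold \<Rightarrow> 'a set \<Rightarrow> ('a \<Rightarrow> 'e) \<Rightarrow> bool" where
  "smooth_field_on M U X \<longleftrightarrow>
     (\<forall>c\<in>atlas M. smooth_on (chart_map c ` (chart_dom c \<inter> U))
        ((\<lambda>p. components M c p (X p)) \<circ> chart_inv c))"

definition smooth_one_form :: "('a, 'e::euclidean_space) manifold \<Rightarrow> ('a \<Rightarrow> 'e \<Rightarrow> real) \<Rightarrow> bool" where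
  "smooth_one_form M \<eta> \<longleftrightarrow>
     (\<forall>p. linear (\<eta> p)) \<and>
     (\<forall>c\<in>atlas M. \<forall>v. smooth_fun_on M (chart_dom c) (\<lambda>p. \<eta> p (coord_field M c v p)))"

definition smooth_endomorphism :: "('a, 'e::euclidean_space) manifold \<Rightarrow> ('a \<Rightarrow> 'e \<Rightarrow> 'e) \<Rightarrow> bool" where
  "smooth_endomorphism M \<phi> \<longleftrightarrow>
     (\<forall>p. linear (\<phi> p)) \<and>
     (\<forall>c\<in>atlas M. \<forall>v. smooth_field_on M (chart_dom c) (\<lambda>p. \<phi> p (coord_field M c v p)))"

definition riemannian_metric ::
  "('a, 'e::euclidean_space) manifold \<Rightarrow> ('a \<Rightarrow> 'e \<Rightarrow> 'e \<Rightarrow> real) \<Rightarrow> bool" where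
  "riemannian_metric M g \<longleftrightarrow>
     (\<forall>p. bilinear (g p) \<and> (\<forall>u v. g p u v = g p v u) \<and> (\<forall>u. u \<noteq> 0 \<longrightarrow> g p u u > 0)) \<and>
     (\<forall>c\<in>atlas M. \<forall>u v. smooth_fun_on M (chart_dom c)
        (\<lambda>p. g p (coord_field M c u p) (coord_field M c v p)))"

definition smooth_map ::
  "('a::topological_space, 'e::euclidean_space) manifold \<Rightarrow>
   ('b::topological_space, 'f::euclidean_space) manifold \<Rightarrow> ('a \<Rightarrow> 'b) \<Rightarrow> bool" where
  "smooth_map A B F \<longleftrightarrow>
     continuous_on UNIV F \<and>
     (\<forall>c\<in>atlas A. \<forall>d\<in>atlas B.
        smooth_on (chart_map c ` (chart_dom c \<inter> F -` chart_dom d)) (chart_map d \<circ> F \<circ> chart_inv c))"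

definition tangent_map ::
  "('a, 'e::euclidean_space) manifold \<Rightarrow> ('b, 'f::euclidean_space) manifold \<Rightarrow>
   ('a \<Rightarrow> 'b) \<Rightarrow> 'a \<Rightarrow> 'e \<Rightarrow> 'f" where
  "tangent_map A B F p =
     frechet_derivative (chart_map (chart_at B (F p)) \<circ> F \<circ> chart_inv (chart_at A p))
       (at (chart_map (chart_at A p) p))"

text \<open>\<open>dir_deriv M X h\<close> is the function \<open>X h\<close>.\<close>

definition dir_deriv ::
  "('a, 'e::euclidean_space) manifold \<Rightarrow> ('a \<Rightarrow> 'e) \<Rightarrow> ('a \<Rightarrow> real) \<Rightarrow> 'a \<Rightarrow> real" where
  "dir_deriv M X h p =
     frechet_derivative (h \<circ> chart_inv (chart_at M p)) (at (chart_map (chart_at M p) p)) (X p)"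

text \<open>The derivative at \<open>p\<close> of the components of \<open>Y\<close> in the preferred chart at \<open>p\<close>.\<close>

definition component_deriv ::
  "('a, 'e::euclidean_space) manifold \<Rightarrow> ('a \<Rightarrow> 'e) \<Rightarrow> ('a \<Rightarrow> 'e) \<Rightarrow> 'a \<Rightarrow> 'e" where
  "component_deriv M X Y p =
     frechet_derivative ((\<lambda>r. components M (chart_at M p) r (Y r)) \<circ> chart_inv (chart_at M p))
       (at (chart_map (chart_at M p) p)) (X p)"

definition lie_bracket ::
  "('a, 'e::euclidean_space) manifold \<Rightarrow> ('a \<Rightarrow> 'e) \<Rightarrow> ('a \<Rightarrow> 'e) \<Rightarrow> 'a \<Rightarrow> 'e" where
  "lie_bracket M X Y p = component_deriv M X Y p - component_deriv M Y X p"


section \<open>Levi-Civita connection\<close>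

text \<open>An affine connection acts on vector fields over arbitrary open sets and is compatible with
  restriction to smaller open sets.  On total functions, compatibility with restriction says that
  \<open>\<nabla> X Y\<close> on \<open>U\<close> depends only on the values of \<open>X\<close> and \<open>Y\<close> on \<open>U\<close>.\<close>

definition affine_connection ::
  "('a::topological_space, 'e::euclidean_space) manifold \<Rightarrow>
   (('a \<Rightarrow> 'e) \<Rightarrow> ('a \<Rightarrow> 'e) \<Rightarrow> 'a \<Rightarrow> 'e) \<Rightarrow> bool" where
  "affine_connection M nab \<longleftrightarrow>
     (\<forall>U X Y. open U \<and> smooth_field_on M U X \<and> smooth_field_on M U Y \<longrightarrow>
        smooth_field_on M U (nab X Y) \<and>
        (\<forall>X' Y'. (\<forall>p\<in>U. X' p = X p \<and> Y' p = Y p) \<longrightarrow> (\<forall>p\<in>U. nab X' Y' p = nab X Y p)) \<and>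
        (\<forall>Z. smooth_field_on M U Z \<longrightarrow> (\<forall>p\<in>U.
           nab (\<lambda>r. X r + Z r) Y p = nab X Y p + nab Z Y p \<and>
           nab X (\<lambda>r. Y r + Z r) p = nab X Y p + nab X Z p)) \<and>
        (\<forall>h. smooth_fun_on M U h \<longrightarrow> (\<forall>p\<in>U.
           nab (\<lambda>r. h r *\<^sub>R X r) Y p = h p *\<^sub>R nab X Y p \<and>
           nab X (\<lambda>r. h r *\<^sub>R Y r) p = dir_deriv M X h p *\<^sub>R Y p + h p *\<^sub>R nab X Y p)))"

definition levi_civita ::
  "('a::topological_space, 'e::euclidean_space) manifold \<Rightarrow> ('a \<Rightarrow> 'e \<Rightarrow> 'e \<Rightarrow> real) \<Rightarrow>
   (('a \<Rightarrow> 'e) \<Rightarrow> ('a \<Rightarrow> 'e) \<Rightarrow> 'a \<Rightarrow> 'e) \<Rightarrow> bool" where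
  "levi_civita M g nab \<longleftrightarrow>
     affine_connection M nab \<and>
     (\<forall>U X Y. open U \<and> smooth_field_on M U X \<and> smooth_field_on M U Y \<longrightarrow>
        (\<forall>p\<in>U. nab X Y p - nab Y X p = lie_bracket M X Y p)) \<and>
     (\<forall>U X Y Z. open U \<and> smooth_field_on M U X \<and> smooth_field_on M U Y \<and> smooth_field_on M U Z \<longrightarrow>
        (\<forall>p\<in>U. dir_deriv M X (\<lambda>r. g r (Y r) (Z r)) p =
                 g p (nab X Y p) (Z p) + g p (Y p) (nab X Z p)))"


section \<open>Almost contact metric and Kenmotsu structures\<close>

definition almost_contact_metric ::
  "('a::{t2_space,second_countable_topology}, 'e::euclidean_space) manifold \<Rightarrow> ('a \<Rightarrow> 'e \<Rightarrow> 'e) \<Rightarrow>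
   ('a \<Rightarrow> 'e) \<Rightarrow> ('a \<Rightarrow> 'e \<Rightarrow> real) \<Rightarrow> ('a \<Rightarrow> 'e \<Rightarrow> 'e \<Rightarrow> real) \<Rightarrow> bool" where
  "almost_contact_metric M \<phi> \<xi> \<eta> g \<longleftrightarrow>
     smooth_manifold M \<and> (\<exists>n. DIM('e) = 2 * n + 1) \<and>
     smooth_endomorphism M \<phi> \<and> smooth_field_on M UNIV \<xi> \<and> smooth_one_form M \<eta> \<and>
     riemannian_metric M g \<and>
     (\<forall>p. \<eta> p (\<xi> p) = 1 \<and> \<phi> p (\<xi> p) = 0) \<and>
     (\<forall>p u. \<phi> p (\<phi> p u) = - u + \<eta> p u *\<^sub>R \<xi> p \<and> \<eta> p (\<phi> p u) = 0 \<and> g p u (\<xi> p) = \<eta> p u) \<and>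
     (\<forall>p u v. g p u v = g p (\<phi> p u) (\<phi> p v) + \<eta> p u * \<eta> p v \<and> g p u (\<phi> p v) = - g p (\<phi> p u) v)"

definition kenmotsu ::
  "('a::{t2_space,second_countable_topology}, 'e::euclidean_space) manifold \<Rightarrow> ('a \<Rightarrow> 'e \<Rightarrow> 'e) \<Rightarrow>
   ('a \<Rightarrow> 'e) \<Rightarrow> ('a \<Rightarrow> 'e \<Rightarrow> real) \<Rightarrow> ('a \<Rightarrow> 'e \<Rightarrow> 'e \<Rightarrow> real) \<Rightarrow>
   (('a \<Rightarrow> 'e) \<Rightarrow> ('a \<Rightarrow> 'e) \<Rightarrow> 'a \<Rightarrow> 'e) \<Rightarrow> bool" where
  "kenmotsu M \<phi> \<xi> \<eta> g nab \<longleftrightarrow>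
     almost_contact_metric M \<phi> \<xi> \<eta> g \<and> levi_civita M g nab \<and>
     (\<forall>U X Y. open U \<and> smooth_field_on M U X \<and> smooth_field_on M U Y \<longrightarrow>
        (\<forall>p\<in>U. nab X (\<lambda>r. \<phi> r (Y r)) p - \<phi> p (nab X Y p) =
                 g p (\<phi> p (X p)) (Y p) *\<^sub>R \<xi> p - \<eta> p (Y p) *\<^sub>R \<phi> p (X p)))"


section \<open>Submanifolds\<close>

text \<open>A submanifold is given by an injective immersion \<open>\<iota>\<close>.  Its tangent space at \<open>x\<close>, as a
  subspace of the ambient tangent space at \<open>\<iota> x\<close>, is \<open>tangent_image S M \<iota> x\<close>.\<close>

definition submanifold ::
  "('b::{t2_space,second_countable_topology}, 'f::euclidean_space) manifold \<Rightarrow>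
   ('a::{t2_space,second_countable_topology}, 'e::euclidean_space) manifold \<Rightarrow> ('b \<Rightarrow> 'a) \<Rightarrow> bool" where
  "submanifold S M \<iota> \<longleftrightarrow>
     smooth_manifold S \<and> smooth_manifold M \<and> smooth_map S M \<iota> \<and> inj \<iota> \<and>
     (\<forall>x. inj (tangent_map S M \<iota> x))"

definition tangent_image ::
  "('b, 'f::euclidean_space) manifold \<Rightarrow> ('a, 'e::euclidean_space) manifold \<Rightarrow> ('b \<Rightarrow> 'a) \<Rightarrow>
   'b \<Rightarrow> 'e set" where
  "tangent_image S M \<iota> x = range (tangent_map S M \<iota> x)"

definition induced_metric ::
  "('b, 'f::euclidean_space) manifold \<Rightarrow> ('a, 'e::euclidean_space) manifold \<Rightarrow> ('b \<Rightarrow> 'a) \<Rightarrow>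
   ('a \<Rightarrow> 'e \<Rightarrow> 'e \<Rightarrow> real) \<Rightarrow> 'b \<Rightarrow> 'f \<Rightarrow> 'f \<Rightarrow> real" where
  "induced_metric S M \<iota> g x u v = g (\<iota> x) (tangent_map S M \<iota> x u) (tangent_map S M \<iota> x v)"

text \<open>\<open>b\<close> is an arbitrary inner product on \<open>'e\<close>, here always the value of a metric at a point.\<close>

definition orth_proj :: "('e::real_vector \<Rightarrow> 'e \<Rightarrow> real) \<Rightarrow> 'e set \<Rightarrow> 'e \<Rightarrow> 'e" where
  "orth_proj b S w = (THE s. s \<in> S \<and> (\<forall>u\<in>S. b (w - s) u = 0))"

text \<open>The angle, in \<open>[0, pi/2]\<close>, between a nonzero vector and a subspace, that is, between the
  vector and its orthogonal projection.\<close>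

definition subspace_angle :: "('e::real_vector \<Rightarrow> 'e \<Rightarrow> real) \<Rightarrow> 'e \<Rightarrow> 'e set \<Rightarrow> real" where
  "subspace_angle b w S = arccos (sqrt (b (orth_proj b S w) (orth_proj b S w)) / sqrt (b w w))"

text \<open>\<open>\<phi> X = T X + N X\<close>: \<open>T_part\<close> takes values in the tangent space of \<open>S\<close>,
  \<open>N_part\<close> in the normal space, a subspace of the ambient tangent space.\<close>

definition normal_part ::
  "('b, 'f::euclidean_space) manifold \<Rightarrow> ('a, 'e::euclidean_space) manifold \<Rightarrow> ('b \<Rightarrow> 'a) \<Rightarrow>
   ('a \<Rightarrow> 'e \<Rightarrow> 'e \<Rightarrow> real) \<Rightarrow> 'b \<Rightarrow> 'e \<Rightarrow> 'e" where
  "normal_part S M \<iota> g x w = w - orth_proj (g (\<iota> x)) (tangent_image S M \<iota> x) w"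

definition T_part ::
  "('b, 'f::euclidean_space) manifold \<Rightarrow> ('a, 'e::euclidean_space) manifold \<Rightarrow> ('b \<Rightarrow> 'a) \<Rightarrow>
   ('a \<Rightarrow> 'e \<Rightarrow> 'e \<Rightarrow> real) \<Rightarrow> ('a \<Rightarrow> 'e \<Rightarrow> 'e) \<Rightarrow> 'b \<Rightarrow> 'f \<Rightarrow> 'f" where
  "T_part S M \<iota> g \<phi> x v =
     (THE t. tangent_map S M \<iota> x t =
        orth_proj (g (\<iota> x)) (tangent_image S M \<iota> x) (\<phi> (\<iota> x) (tangent_map S M \<iota> x v)))"

definition N_part ::
  "('b, 'f::euclidean_space) manifold \<Rightarrow> ('a, 'e::euclidean_space) manifold \<Rightarrow> ('b \<Rightarrow> 'a) \<Rightarrow>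
   ('a \<Rightarrow> 'e \<Rightarrow> 'e \<Rightarrow> real) \<Rightarrow> ('a \<Rightarrow> 'e \<Rightarrow> 'e) \<Rightarrow> 'b \<Rightarrow> 'f \<Rightarrow> 'e" where
  "N_part S M \<iota> g \<phi> x v = normal_part S M \<iota> g x (\<phi> (\<iota> x) (tangent_map S M \<iota> x v))"

text \<open>The ambient connection applied to a field \<open>V\<close> along \<open>\<iota>\<close> (so \<open>V x\<close> is an ambient tangent
  vector at \<open>\<iota> x\<close>) in a direction \<open>X\<close> tangent to the submanifold, by the Leibniz rule in the
  coordinate frame \<open>E\<^sub>i\<close> of the preferred chart at \<open>\<iota> x\<close>: if \<open>V = V\<^sup>i E\<^sub>i\<close>, the result is
  \<open>X(V\<^sup>i) E\<^sub>i + V\<^sup>i \<nabla>\<^bsub>d\<iota> X\<^esub> E\<^sub>i\<close> at \<open>x\<close>.\<close>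

definition connection_along ::
  "('b, 'f::euclidean_space) manifold \<Rightarrow> ('a, 'e::euclidean_space) manifold \<Rightarrow> ('b \<Rightarrow> 'a) \<Rightarrow>
   (('a \<Rightarrow> 'e) \<Rightarrow> ('a \<Rightarrow> 'e) \<Rightarrow> 'a \<Rightarrow> 'e) \<Rightarrow> ('b \<Rightarrow> 'f) \<Rightarrow> ('b \<Rightarrow> 'e) \<Rightarrow> 'b \<Rightarrow> 'e" where
  "connection_along S M \<iota> nab X V x =
     (let c = chart_at M (\<iota> x); k = chart_at S x in
        frechet_derivative ((\<lambda>y. components M c (\<iota> y) (V y)) \<circ> chart_inv k)
          (at (chart_map k x)) (X x)
        + nab (coord_field M c (tangent_map S M \<iota> x (X x))) (coord_field M c (V x)) (\<iota> x))"

definition normal_connection ::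
  "('b, 'f::euclidean_space) manifold \<Rightarrow> ('a, 'e::euclidean_space) manifold \<Rightarrow> ('b \<Rightarrow> 'a) \<Rightarrow>
   ('a \<Rightarrow> 'e \<Rightarrow> 'e \<Rightarrow> real) \<Rightarrow> (('a \<Rightarrow> 'e) \<Rightarrow> ('a \<Rightarrow> 'e) \<Rightarrow> 'a \<Rightarrow> 'e) \<Rightarrow>
   ('b \<Rightarrow> 'f) \<Rightarrow> ('b \<Rightarrow> 'e) \<Rightarrow> 'b \<Rightarrow> 'e" where
  "normal_connection S M \<iota> g nab X V x = normal_part S M \<iota> g x (connection_along S M \<iota> nab X V x)"

text \<open>\<open>nab\<close> is the connection of the ambient manifold, \<open>nabS\<close> that of the submanifold.\<close>

definition cov_deriv_N ::
  "('b, 'f::euclidean_space) manifold \<Rightarrow> ('a, 'e::euclidean_space) manifold \<Rightarrow> ('b \<Rightarrow> 'a) \<Rightarrow>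
   ('a \<Rightarrow> 'e \<Rightarrow> 'e \<Rightarrow> real) \<Rightarrow> ('a \<Rightarrow> 'e \<Rightarrow> 'e) \<Rightarrow>
   (('a \<Rightarrow> 'e) \<Rightarrow> ('a \<Rightarrow> 'e) \<Rightarrow> 'a \<Rightarrow> 'e) \<Rightarrow> (('b \<Rightarrow> 'f) \<Rightarrow> ('b \<Rightarrow> 'f) \<Rightarrow> 'b \<Rightarrow> 'f) \<Rightarrow>
   ('b \<Rightarrow> 'f) \<Rightarrow> ('b \<Rightarrow> 'f) \<Rightarrow> 'b \<Rightarrow> 'e" where
  "cov_deriv_N S M \<iota> g \<phi> nab nabS X Y x =
     normal_connection S M \<iota> g nab X (\<lambda>y. N_part S M \<iota> g \<phi> y (Y y)) x
     - N_part S M \<iota> g \<phi> x (nabS X Y x)"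

definition invariant_submanifold ::
  "('b::{t2_space,second_countable_topology}, 'f::euclidean_space) manifold \<Rightarrow>
   ('a::{t2_space,second_countable_topology}, 'e::euclidean_space) manifold \<Rightarrow> ('b \<Rightarrow> 'a) \<Rightarrow>
   ('a \<Rightarrow> 'e \<Rightarrow> 'e) \<Rightarrow> bool" where
  "invariant_submanifold P M j \<phi> \<longleftrightarrow>
     submanifold P M j \<and> (\<forall>x. \<phi> (j x) ` tangent_image P M j x \<subseteq> tangent_image P M j x)"

definition slant_submanifold ::
  "('b::{t2_space,second_countable_topology}, 'f::euclidean_space) manifold \<Rightarrow>
   ('a::{t2_space,second_countable_topology}, 'e::euclidean_space) manifold \<Rightarrow> ('b \<Rightarrow> 'a) \<Rightarrow>
   ('a \<Rightarrow> 'e \<Rightarrow> 'e) \<Rightarrow> ('a \<Rightarrow> 'e) \<Rightarrow> ('a \<Rightarrow> 'e \<Rightarrow> 'e \<Rightarrow> real) \<Rightarrow> real \<Rightarrow> bool" where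
  "slant_submanifold P M j \<phi> \<xi> g \<theta> \<longleftrightarrow>
     submanifold P M j \<and> 0 \<le> \<theta> \<and> \<theta> \<le> pi / 2 \<and>
     (\<forall>x. \<forall>w\<in>tangent_image P M j x. w \<notin> span {\<xi> (j x)} \<longrightarrow>
        subspace_angle (g (j x)) (\<phi> (j x) w) (tangent_image P M j x) = \<theta>)"

definition proper_slant_submanifold ::
  "('b::{t2_space,second_countable_topology}, 'f::euclidean_space) manifold \<Rightarrow>
   ('a::{t2_space,second_countable_topology}, 'e::euclidean_space) manifold \<Rightarrow> ('b \<Rightarrow> 'a) \<Rightarrow>
   ('a \<Rightarrow> 'e \<Rightarrow> 'e) \<Rightarrow> ('a \<Rightarrow> 'e) \<Rightarrow> ('a \<Rightarrow> 'e \<Rightarrow> 'e \<Rightarrow> real) \<Rightarrow> real \<Rightarrow> bool" where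
  "proper_slant_submanifold P M j \<phi> \<xi> g \<theta> \<longleftrightarrow>
     slant_submanifold P M j \<phi> \<xi> g \<theta> \<and> \<theta> \<noteq> 0 \<and> \<theta> \<noteq> pi / 2"

text \<open>\<open>D1 x\<close> and \<open>D2 x\<close> are subspaces of the ambient tangent space at \<open>\<iota> x\<close>; pairwise
  orthogonality makes the span of their union with \<open>\<xi>\<close> an orthogonal direct sum.\<close>

definition semi_slant_submanifold ::
  "('b::{t2_space,second_countable_topology}, 'f::euclidean_space) manifold \<Rightarrow>
   ('a::{t2_space,second_countable_topology}, 'e::euclidean_space) manifold \<Rightarrow> ('b \<Rightarrow> 'a) \<Rightarrow>
   ('a \<Rightarrow> 'e \<Rightarrow> 'e) \<Rightarrow> ('a \<Rightarrow> 'e) \<Rightarrow> ('a \<Rightarrow> 'e \<Rightarrow> 'e \<Rightarrow> real) \<Rightarrow>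
   ('b \<Rightarrow> 'e set) \<Rightarrow> ('b \<Rightarrow> 'e set) \<Rightarrow> real \<Rightarrow> bool" where
  "semi_slant_submanifold S M \<iota> \<phi> \<xi> g D1 D2 \<theta> \<longleftrightarrow>
     submanifold S M \<iota> \<and> 0 < \<theta> \<and> \<theta> \<le> pi / 2 \<and>
     (\<forall>x. subspace (D1 x) \<and> subspace (D2 x) \<and>
        tangent_image S M \<iota> x = span (D1 x \<union> D2 x \<union> {\<xi> (\<iota> x)}) \<and>
        (\<forall>u\<in>D1 x. \<forall>v\<in>D2 x. g (\<iota> x) u v = 0) \<and>
        (\<forall>u\<in>D1 x \<union> D2 x. g (\<iota> x) u (\<xi> (\<iota> x)) = 0) \<and>
        \<phi> (\<iota> x) ` D1 x = D1 x \<and>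
        (\<forall>w\<in>D2 x. w \<noteq> 0 \<longrightarrow> subspace_angle (g (\<iota> x)) (\<phi> (\<iota> x) w) (D2 x) = \<theta>))"


section \<open>Warped products\<close>

definition warped_metric ::
  "('b \<Rightarrow> 'e \<Rightarrow> 'e \<Rightarrow> real) \<Rightarrow> ('b \<Rightarrow> real) \<Rightarrow> ('c \<Rightarrow> 'f \<Rightarrow> 'f \<Rightarrow> real) \<Rightarrow>
   'b \<times> 'c \<Rightarrow> 'e \<times> 'f \<Rightarrow> 'e \<times> 'f \<Rightarrow> real" where
  "warped_metric g1 f g2 x u v =
     g1 (fst x) (fst u) (fst v) + (f (fst x))\<^sup>2 * g2 (snd x) (snd u) (snd v)"

definition warped_product_submanifold ::
  "('b::{t2_space,second_countable_topology}, 'e::euclidean_space) manifold \<Rightarrow>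
   ('c::{t2_space,second_countable_topology}, 'f::euclidean_space) manifold \<Rightarrow>
   ('a::{t2_space,second_countable_topology}, 'h::euclidean_space) manifold \<Rightarrow> ('b \<times> 'c \<Rightarrow> 'a) \<Rightarrow>
   ('a \<Rightarrow> 'h \<Rightarrow> 'h \<Rightarrow> real) \<Rightarrow>
   ('b \<Rightarrow> 'e \<Rightarrow> 'e \<Rightarrow> real) \<Rightarrow> ('b \<Rightarrow> real) \<Rightarrow> ('c \<Rightarrow> 'f \<Rightarrow> 'f \<Rightarrow> real) \<Rightarrow> bool" where
  "warped_product_submanifold N1 N2 M \<iota> g g1 f g2 \<longleftrightarrow>
     smooth_manifold N1 \<and> smooth_manifold N2 \<and>
     riemannian_metric N1 g1 \<and> riemannian_metric N2 g2 \<and>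
     smooth_fun_on N1 UNIV f \<and> (\<forall>p. f p > 0) \<and>
     submanifold (prod_manifold N1 N2) M \<iota> \<and>
     induced_metric (prod_manifold N1 N2) M \<iota> g = warped_metric g1 f g2"

end

(*
Both sides of the identity vanish.

For Z tangent to the slant factor, the slant condition on D2 gives
|N Z|^2 = sin^2(theta) (|Z|^2 - eta(Z)^2). Differentiate this along X tangent to the invariant factor.
In product coordinates the metric on the slant factor does not depend on the invariant factor, and
neither does the pullback of eta there, because eta is closed on a Kenmotsu manifold
(nab_X xi = X - eta(X) xi) and kills the invariant directions. With V the coordinate derivative of Z
along X, the result is g(conn_X N Z, N Z) = sin^2(theta) (g(V, Z) - eta(V) eta(Z)) = g(N V, N Z).
Koszul's formula shows that nabS_X Z and V have the same component along the slant factor, and N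
annihilates the invariant factor, so N(nabS_X Z) = N V and g((nab_X N) Z, N Z) = 0. The right-hand
side is the same expression at T Z, which is again a smooth section tangent to the slant factor.
*)
theory Submission
  imports Defs
begin

section \<open>Calculus of smooth functions on open sets\<close>

text \<open>Pairing the covariant derivative with \<open>N Z\<close> itself keeps the computation
  short: metric compatibility turns the ambient term into half the derivative of the squared norm of
  \<open>N Z\<close>, which is known in closed form. Two obstacles shape the development. First,
  \<open>connection_along\<close> is built from \<open>frechet_derivative\<close>, which is
  informative only for differentiable functions, whereas tangential and normal parts are definite
  descriptions at single points. So \<open>T Z\<close> and \<open>N Z\<close> must be shown smooth:
  the orthogonal projection solves a Gram system, and solutions of invertible linear systems inherit
  smoothness from their data. Second, closedness of \<eta> comes from the ambient manifold but is
  needed for the pullback, whose coefficients contain the differential of the immersion;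
  differentiating them brings in second derivatives and hence Schwarz's theorem. Since preferred
  charts may jump from point to point, each derivative is taken in one chart held fixed near the
  point.\<close>

abbreviation deriv_at :: "('e::real_normed_vector \<Rightarrow> 'f::real_normed_vector) \<Rightarrow> 'e \<Rightarrow> 'e \<Rightarrow> 'f" where
  "deriv_at f x \<equiv> frechet_derivative f (at x)"

lemma has_derivative_deriv_at:
  "f differentiable at x \<Longrightarrow> (f has_derivative deriv_at f x) (at x)"
  by (simp add: frechet_derivative_works[symmetric])

lemma deriv_at_eqI: "(f has_derivative f') (at x) \<Longrightarrow> deriv_at f x = f'"
  using frechet_derivative_at by metis

lemma Ck_on_cong:
  assumes "open S" "\<And>x. x \<in> S \<Longrightarrow> f x = g x" "Ck_on k S f"
  shows "Ck_on k S g"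
  using assms(2,3)
proof (induction k arbitrary: f g)
  case 0
  then show ?case using continuous_on_cong[of S S f g] by simp
next
  case (Suc k)
  have d: "f differentiable at x" if "x \<in> S" for x
    using Suc.prems(2) assms(1) that by (auto simp: differentiable_on_eq_differentiable_at)
  have h: "(g has_derivative deriv_at f x) (at x)" if "x \<in> S" for x
    using has_derivative_transform_within_open[OF has_derivative_deriv_at[OF d[OF that]] assms(1) that]
      Suc.prems(1) by blast
  have "g differentiable_on S"
    using h assms(1) by (auto simp: differentiable_on_eq_differentiable_at differentiable_def)
  moreover have "Ck_on k S (\<lambda>x. deriv_at g x v)" for v
  proof (rule Suc.IH)
    show "deriv_at f x v = deriv_at g x v" if "x \<in> S" for x
      by (simp only: deriv_at_eqI[OF h[OF that]])
    show "Ck_on k S (\<lambda>x. deriv_at f x v)" using Suc.prems(2) by simp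
  qed
  ultimately show ?case by simp
qed

lemma Ck_on_subset: "Ck_on k S f \<Longrightarrow> T \<subseteq> S \<Longrightarrow> Ck_on k T f"
  by (induction k arbitrary: f) (auto intro: continuous_on_subset differentiable_on_subset)

lemma Ck_on_SucD: "Ck_on (Suc k) S f \<Longrightarrow> Ck_on k S f"
  by (induction k arbitrary: f) (auto intro: differentiable_imp_continuous_on)

lemma Ck_on_const: "Ck_on k S (\<lambda>x. c)"
  by (induction k arbitrary: c) (auto simp: continuous_on_const)

lemma Ck_on_Suc_differentiable:
  "open S \<Longrightarrow> Ck_on (Suc k) S f \<Longrightarrow> x \<in> S \<Longrightarrow> f differentiable at x"
  by (auto simp: differentiable_on_eq_differentiable_at)

text \<open>Inductive steps produce an explicit derivative \<open>f'\<close>; on an open set it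
  agrees with \<open>frechet_derivative\<close>, and \<open>Ck_on_cong\<close> transfers the
  regularity.\<close>

lemma Ck_on_SucI:
  assumes "open S" "\<And>x. x \<in> S \<Longrightarrow> (f has_derivative f' x) (at x)" "\<And>v. Ck_on k S (\<lambda>x. f' x v)"
  shows "Ck_on (Suc k) S f"
proof -
  have "f differentiable_on S"
    using assms(1,2) by (auto simp: differentiable_on_eq_differentiable_at differentiable_def)
  moreover have "Ck_on k S (\<lambda>x. deriv_at f x v)" for v
    by (rule Ck_on_cong[OF assms(1) _ assms(3)[of v]]) (simp add: deriv_at_eqI[OF assms(2)])
  ultimately show ?thesis by simp
qed

lemma Ck_on_linear_comp:
  fixes L :: "'f::euclidean_space \<Rightarrow> 'g::euclidean_space"
  assumes "open S" "linear L" "Ck_on k S f"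
  shows "Ck_on k S (\<lambda>x. L (f x))"
  using assms(3)
proof (induction k arbitrary: f)
  case 0
  have "continuous_on UNIV L" using assms(2) by (simp add: linear_continuous_on linear_conv_bounded_linear)
  then show ?case using 0 continuous_on_compose2[of UNIV L S f] by simp
next
  case (Suc k)
  have b: "bounded_linear L" using assms(2) by (simp add: linear_conv_bounded_linear)
  show ?case
  proof (rule Ck_on_SucI[OF assms(1)])
    show "((\<lambda>x. L (f x)) has_derivative (\<lambda>v. L (deriv_at f x v))) (at x)" if "x \<in> S" for x
      using bounded_linear.has_derivative[OF b has_derivative_deriv_at]
        Ck_on_Suc_differentiable[OF assms(1) Suc.prems that] by blast
    show "Ck_on k S (\<lambda>x. L (deriv_at f x v))" for v
      using Suc.prems by (intro Suc.IH) simp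
  qed
qed

lemma Ck_on_add:
  assumes "open S" "Ck_on k S f" "Ck_on k S g"
  shows "Ck_on k S (\<lambda>x. f x + g x)"
  using assms(2,3)
proof (induction k arbitrary: f g)
  case 0
  then show ?case by (simp add: continuous_on_add)
next
  case (Suc k)
  show ?case
  proof (rule Ck_on_SucI[OF assms(1)])
    show "((\<lambda>x. f x + g x) has_derivative (\<lambda>v. deriv_at f x v + deriv_at g x v)) (at x)"
      if "x \<in> S" for x
      by (rule has_derivative_add has_derivative_deriv_at
          Ck_on_Suc_differentiable[OF assms(1) _ that] Suc.prems)+
    show "Ck_on k S (\<lambda>x. deriv_at f x v + deriv_at g x v)" for v
      using Suc.prems by (intro Suc.IH) simp_all
  qed
qed

lemma Ck_on_bilinear:
  fixes f :: "'e::euclidean_space \<Rightarrow> 'f::euclidean_space" and g :: "'e \<Rightarrow> 'g::euclidean_space"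
    and B :: "'f \<Rightarrow> 'g \<Rightarrow> 'h::euclidean_space"
  assumes "open S" "bounded_bilinear B" "Ck_on k S f" "Ck_on k S g"
  shows "Ck_on k S (\<lambda>x. B (f x) (g x))"
  using assms(3,4)
proof (induction k arbitrary: f g)
  case 0
  then show ?case by (simp add: bounded_bilinear.continuous_on[OF assms(2)])
next
  case (Suc k)
  show ?case
  proof (rule Ck_on_SucI[OF assms(1)])
    show "((\<lambda>x. B (f x) (g x)) has_derivative (\<lambda>v. B (f x) (deriv_at g x v) + B (deriv_at f x v) (g x))) (at x)"
      if "x \<in> S" for x
      by (rule bounded_bilinear.FDERIV[OF assms(2)]
          has_derivative_deriv_at Ck_on_Suc_differentiable[OF assms(1) _ that] Suc.prems)+
    show "Ck_on k S (\<lambda>x. B (f x) (deriv_at g x v) + B (deriv_at f x v) (g x))" for v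
      using Suc.prems Ck_on_SucD[OF Suc.prems(1)] Ck_on_SucD[OF Suc.prems(2)]
      by (intro Ck_on_add assms(1) Suc.IH) simp_all
  qed
qed

lemmas Ck_on_scaleR = Ck_on_bilinear[OF _ bounded_bilinear_scaleR]

lemma Ck_on_sum:
  assumes "open S" "finite I" "\<And>i. i \<in> I \<Longrightarrow> Ck_on k S (f i)"
  shows "Ck_on k S (\<lambda>x. \<Sum>i\<in>I. f i x)"
  using assms(2,3)
proof (induction I rule: finite_induct)
  case empty
  then show ?case by (simp add: Ck_on_const)
next
  case (insert i I)
  then show ?case using Ck_on_add[OF assms(1), of k "f i" "\<lambda>x. \<Sum>i\<in>I. f i x"] by simp
qed

lemma linear_inner_left: "linear (\<lambda>x. x \<bullet> b)"
  by (simp add: bounded_linear.linear bounded_linear_inner_left)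

text \<open>Expanding the argument in \<open>Basis\<close> leaves a finite sum of products, so
  regularity of \<open>\<Lambda> x v\<close> in \<open>x\<close> for each fixed \<open>v\<close>
  suffices. Tensor fields are given in this form, tested on constant components.\<close>

lemma Ck_on_linear_apply:
  fixes \<Lambda> :: "'e::euclidean_space \<Rightarrow> 'f::euclidean_space \<Rightarrow> 'g::euclidean_space"
  assumes "open S" "\<And>x. x \<in> S \<Longrightarrow> linear (\<Lambda> x)" "\<And>v. Ck_on k S (\<lambda>x. \<Lambda> x v)" "Ck_on k S f"
  shows "Ck_on k S (\<lambda>x. \<Lambda> x (f x))"
proof (rule Ck_on_cong[OF assms(1)])
  show "Ck_on k S (\<lambda>x. \<Sum>b\<in>Basis. (f x \<bullet> b) *\<^sub>R \<Lambda> x b)"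
    by (intro Ck_on_sum Ck_on_scaleR assms finite_Basis Ck_on_linear_comp[where f = f] linear_inner_left)
  show "(\<Sum>b\<in>Basis. (f x \<bullet> b) *\<^sub>R \<Lambda> x b) = \<Lambda> x (f x)" if "x \<in> S" for x
    using linear_sum[OF assms(2)[OF that], of "\<lambda>b. (f x \<bullet> b) *\<^sub>R b" Basis]
    by (simp add: euclidean_representation linear_cmul[OF assms(2)[OF that]])
qed

text \<open>Product rule for evaluation, again by expansion in \<open>Basis\<close>: one term has
  the argument frozen at \<open>f x\<close>, the other the linear map frozen at
  \<open>x\<close>.\<close>

lemma has_derivative_linear_apply:
  fixes \<Lambda> :: "'e::real_normed_vector \<Rightarrow> 'f::euclidean_space \<Rightarrow> 'g::real_normed_vector"
  assumes "open S" "x \<in> S" "\<And>y. y \<in> S \<Longrightarrow> linear (\<Lambda> y)"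
    and "\<And>v. (\<lambda>y. \<Lambda> y v) differentiable at x" "(f has_derivative f') (at x)"
  shows "((\<lambda>y. \<Lambda> y (f y)) has_derivative
           (\<lambda>w. deriv_at (\<lambda>y. \<Lambda> y (f x)) x w + \<Lambda> x (f' w))) (at x)"
proof -
  have e: "\<Lambda> y v = (\<Sum>b\<in>Basis. (v \<bullet> b) *\<^sub>R \<Lambda> y b)" if "y \<in> S" for y v
    using linear_sum[OF assms(3)[OF that], of "\<lambda>b. (v \<bullet> b) *\<^sub>R b" Basis]
    by (simp add: euclidean_representation linear_cmul[OF assms(3)[OF that]])
  have 1: "((\<lambda>y. \<Sum>b\<in>Basis. (f y \<bullet> b) *\<^sub>R \<Lambda> y b) has_derivative
     (\<lambda>w. \<Sum>b\<in>Basis. (f x \<bullet> b) *\<^sub>R deriv_at (\<lambda>y. \<Lambda> y b) x w + (f' w \<bullet> b) *\<^sub>R \<Lambda> x b)) (at x)"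
    by (intro has_derivative_sum has_derivative_scaleR has_derivative_inner_left assms(5)
        has_derivative_deriv_at assms(4))
  have 2: "((\<lambda>y. \<Sum>b\<in>Basis. (f x \<bullet> b) *\<^sub>R \<Lambda> y b) has_derivative
     (\<lambda>w. \<Sum>b\<in>Basis. (f x \<bullet> b) *\<^sub>R deriv_at (\<lambda>y. \<Lambda> y b) x w)) (at x)"
    by (intro has_derivative_sum has_derivative_scaleR_right has_derivative_deriv_at assms(4))
  have 3: "deriv_at (\<lambda>y. \<Lambda> y (f x)) x = (\<lambda>w. \<Sum>b\<in>Basis. (f x \<bullet> b) *\<^sub>R deriv_at (\<lambda>y. \<Lambda> y b) x w)"
    by (rule deriv_at_eqI, rule has_derivative_transform_within_open[OF 2 assms(1,2)])
      (use e in simp)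
  have "((\<lambda>y. \<Lambda> y (f y)) has_derivative
     (\<lambda>w. \<Sum>b\<in>Basis. (f x \<bullet> b) *\<^sub>R deriv_at (\<lambda>y. \<Lambda> y b) x w + (f' w \<bullet> b) *\<^sub>R \<Lambda> x b)) (at x)"
    by (rule has_derivative_transform_within_open[OF 1 assms(1,2)]) (use e in simp)
  then show ?thesis
    by (simp add: 3 sum.distrib e[OF assms(2), of "f' _", symmetric])
qed

text \<open>By the chain rule the derivative of the composite is a linear family applied to a
  function, so \<open>Ck_on_linear_apply\<close> closes the induction. It runs over all
  \<open>g\<close>, because the derivatives of \<open>g\<close> take its place.\<close>

lemma Ck_on_compose:
  fixes f :: "'e::euclidean_space \<Rightarrow> 'f::euclidean_space" and g :: "'f \<Rightarrow> 'g::euclidean_space"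
  assumes "open S" "open T" "f ` S \<subseteq> T" "Ck_on k S f" "Ck_on k T g"
  shows "Ck_on k S (\<lambda>x. g (f x))"
  using assms(4,5)
proof (induction k arbitrary: g)
  case 0
  then show ?case using continuous_on_compose2[of T g S f] assms(3) by simp
next
  case (Suc k)
  have dg: "g differentiable at (f x)" if "x \<in> S" for x
    using Ck_on_Suc_differentiable[OF assms(2) Suc.prems(2)] assms(3) that by blast
  show ?case
  proof (rule Ck_on_SucI[OF assms(1)])
    show "((\<lambda>x. g (f x)) has_derivative (\<lambda>v. deriv_at g (f x) (deriv_at f x v))) (at x)"
      if "x \<in> S" for x
      using diff_chain_at[OF has_derivative_deriv_at[OF Ck_on_Suc_differentiable[OF assms(1) Suc.prems(1) that]]
          has_derivative_deriv_at[OF dg[OF that]]]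
      by (simp add: o_def)
    show "Ck_on k S (\<lambda>x. deriv_at g (f x) (deriv_at f x v))" for v
    proof (rule Ck_on_linear_apply[where \<Lambda> = "\<lambda>x. deriv_at g (f x)" and f = "\<lambda>x. deriv_at f x v", OF assms(1)])
      show "linear (deriv_at g (f x))" if "x \<in> S" for x
        using dg[OF that] by (rule linear_frechet_derivative)
      show "Ck_on k S (\<lambda>x. deriv_at g (f x) v)" for v
        using Suc.prems(2) by (intro Suc.IH Ck_on_SucD[OF Suc.prems(1)]) simp
      show "Ck_on k S (\<lambda>x. deriv_at f x v)" using Suc.prems(1) by simp
    qed
  qed
qed

section \<open>Closure properties of smooth functions\<close>

lemma smooth_on_cong: "open S \<Longrightarrow> (\<And>x. x \<in> S \<Longrightarrow> f x = g x) \<Longrightarrow> smooth_on S f \<Longrightarrow> smooth_on S g"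
  unfolding smooth_on_def using Ck_on_cong by blast

lemma smooth_on_subset: "smooth_on S f \<Longrightarrow> T \<subseteq> S \<Longrightarrow> smooth_on T f"
  unfolding smooth_on_def using Ck_on_subset by blast

lemma smooth_on_const: "smooth_on S (\<lambda>x. c)"
  unfolding smooth_on_def by (simp add: Ck_on_const)

lemma smooth_on_linear_comp:
  fixes L :: "'f::euclidean_space \<Rightarrow> 'g::euclidean_space"
  shows "open S \<Longrightarrow> linear L \<Longrightarrow> smooth_on S f \<Longrightarrow> smooth_on S (\<lambda>x. L (f x))"
  unfolding smooth_on_def by (simp add: Ck_on_linear_comp)

lemma smooth_on_linear_apply:
  fixes \<Lambda> :: "'e::euclidean_space \<Rightarrow> 'f::euclidean_space \<Rightarrow> 'g::euclidean_space"
  shows "open S \<Longrightarrow> (\<And>x. x \<in> S \<Longrightarrow> linear (\<Lambda> x)) \<Longrightarrow> (\<And>v. smooth_on S (\<lambda>x. \<Lambda> x v)) \<Longrightarrow>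
    smooth_on S f \<Longrightarrow> smooth_on S (\<lambda>x. \<Lambda> x (f x))"
  unfolding smooth_on_def by (simp add: Ck_on_linear_apply)

lemma smooth_on_compose:
  fixes f :: "'e::euclidean_space \<Rightarrow> 'f::euclidean_space" and g :: "'f \<Rightarrow> 'g::euclidean_space"
  assumes "open S" "open T" "f ` S \<subseteq> T" "smooth_on S f" "smooth_on T g"
  shows "smooth_on S (\<lambda>x. g (f x))"
  using assms(4,5) Ck_on_compose[OF assms(1-3)] unfolding smooth_on_def by blast

lemma smooth_on_scaleR:
  "open S \<Longrightarrow> smooth_on S f \<Longrightarrow> smooth_on S g \<Longrightarrow> smooth_on S (\<lambda>x. f x *\<^sub>R g x)"
  unfolding smooth_on_def by (simp add: Ck_on_scaleR)

lemma smooth_on_add: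
  "open S \<Longrightarrow> smooth_on S f \<Longrightarrow> smooth_on S g \<Longrightarrow> smooth_on S (\<lambda>x. f x + g x)"
  unfolding smooth_on_def by (simp add: Ck_on_add)

lemma smooth_on_sum:
  "open S \<Longrightarrow> finite I \<Longrightarrow> (\<And>i. i \<in> I \<Longrightarrow> smooth_on S (f i)) \<Longrightarrow> smooth_on S (\<lambda>x. \<Sum>i\<in>I. f i x)"
  unfolding smooth_on_def by (simp add: Ck_on_sum)

lemma smooth_on_deriv: "smooth_on S f \<Longrightarrow> smooth_on S (\<lambda>x. deriv_at f x v)"
  unfolding smooth_on_def by (metis Ck_on.simps(2))

lemma smooth_on_differentiable: "smooth_on S f \<Longrightarrow> open S \<Longrightarrow> x \<in> S \<Longrightarrow> f differentiable at x"
  unfolding smooth_on_def using Ck_on_Suc_differentiable by blast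

lemma smooth_on_has_derivative:
  "smooth_on S f \<Longrightarrow> open S \<Longrightarrow> x \<in> S \<Longrightarrow> (f has_derivative deriv_at f x) (at x)"
  by (intro has_derivative_deriv_at smooth_on_differentiable)

lemma smooth_on_linear_deriv: "smooth_on S f \<Longrightarrow> open S \<Longrightarrow> x \<in> S \<Longrightarrow> linear (deriv_at f x)"
  by (intro linear_frechet_derivative smooth_on_differentiable)

lemma smooth_on_bilinear_apply:
  fixes B :: "'e::euclidean_space \<Rightarrow> 'f::euclidean_space \<Rightarrow> 'f \<Rightarrow> 'g::euclidean_space"
  assumes "open S" "\<And>x. x \<in> S \<Longrightarrow> bilinear (B x)" "\<And>u v. smooth_on S (\<lambda>x. B x u v)"
    and "smooth_on S f" "smooth_on S h"
  shows "smooth_on S (\<lambda>x. B x (f x) (h x))"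
proof (rule smooth_on_linear_apply[OF assms(1) _ _ assms(5)])
  show "linear (B x (f x))" if "x \<in> S" for x using assms(2)[OF that] by (simp add: bilinear_def)
  show "smooth_on S (\<lambda>x. B x (f x) v)" for v
    using assms(2) by (intro smooth_on_linear_apply[OF assms(1) _ _ assms(4), of "\<lambda>x u. B x u v"] assms(3))
      (simp add: bilinear_def)
qed

text \<open>The rule for linear families, used once in each slot; the first use keeps the second
  argument constant.\<close>

lemma has_derivative_bilinear_apply:
  fixes B :: "'e::euclidean_space \<Rightarrow> 'f::euclidean_space \<Rightarrow> 'f \<Rightarrow> 'g::euclidean_space"
  assumes "open S" "x \<in> S" "\<And>y. y \<in> S \<Longrightarrow> bilinear (B y)"
    and "\<And>u v. (\<lambda>y. B y u v) differentiable at x"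
    and "(f has_derivative f') (at x)" "(h has_derivative h') (at x)"
  shows "((\<lambda>y. B y (f y) (h y)) has_derivative
    (\<lambda>w. deriv_at (\<lambda>y. B y (f x) (h x)) x w + B x (f' w) (h x) + B x (f x) (h' w))) (at x)"
proof -
  have 1: "((\<lambda>y. B y (f y) v) has_derivative
      (\<lambda>w. deriv_at (\<lambda>y. B y (f x) v) x w + B x (f' w) v)) (at x)" for v
    using assms by (intro has_derivative_linear_apply[of S x "\<lambda>y u. B y u v"]) (auto simp: bilinear_def)
  have "((\<lambda>y. B y (f y) (h y)) has_derivative
      (\<lambda>w. deriv_at (\<lambda>y. B y (f y) (h x)) x w + B x (f x) (h' w))) (at x)"
    using assms(3) by (intro has_derivative_linear_apply[of S x "\<lambda>y v. B y (f y) v"] assms(1,2,6)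
        Derivative.differentiableI[OF 1]) (auto simp: bilinear_def)
  then show ?thesis by (simp add: deriv_at_eqI[OF 1])
qed

section \<open>Symmetry of second derivatives\<close>

lemma has_real_derivative_along:
  fixes f :: "'e::real_normed_vector \<Rightarrow> real"
  assumes "(f has_derivative f') (at (\<gamma> t))" "(\<gamma> has_derivative (\<lambda>w. w *\<^sub>R u)) (at t)"
  shows "((\<lambda>t. f (\<gamma> t)) has_real_derivative f' u) (at t)"
proof -
  have "f' \<circ> (\<lambda>w. w *\<^sub>R u) = (*) (f' u)"
    using has_derivative_linear[OF assms(1)] by (auto simp: linear_cmul fun_eq_iff)
  then show ?thesis
    using diff_chain_at[OF assms(2,1)] by (simp add: has_field_derivative_def o_def)
qed

text \<open>The second difference of \<open>f\<close> over a small parallelogram, estimated by applying the mean value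
  theorem once in each direction; it is symmetric in the two directions.\<close>

lemma second_difference:
  fixes f :: "'e::euclidean_space \<Rightarrow> real"
  assumes S: "open S" "x \<in> S" and f: "Ck_on 2 S f" and \<epsilon>: "\<epsilon> > 0"
  shows "\<exists>\<delta>>0. \<forall>s. 0 < s \<and> s < \<delta> \<longrightarrow>
    \<bar>f (x + s *\<^sub>R u + s *\<^sub>R v) - f (x + s *\<^sub>R u) - f (x + s *\<^sub>R v) + f x - s\<^sup>2 * deriv_at (\<lambda>y. deriv_at f y u) x v\<bar>
      \<le> \<epsilon> * s\<^sup>2"
proof -
  define g where "g = (\<lambda>y. deriv_at f y u)"
  define q where "q = (\<lambda>y. deriv_at g y v)"
  have df: "(f has_derivative deriv_at f y) (at y)" if "y \<in> S" for y
    using f that S(1) by (intro has_derivative_deriv_at)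
      (auto simp: numeral_2_eq_2 differentiable_on_eq_differentiable_at)
  have dg: "(g has_derivative deriv_at g y) (at y)" if "y \<in> S" for y
    unfolding g_def using f that S(1) by (intro has_derivative_deriv_at)
      (auto simp: numeral_2_eq_2 differentiable_on_eq_differentiable_at)
  have cq: "continuous_on S q" using f by (simp add: numeral_2_eq_2 q_def g_def)
  obtain r where r: "r > 0" "ball x r \<subseteq> S" using S by (auto simp: open_contains_ball)
  obtain r' where r': "r' > 0" "\<And>y. y \<in> S \<Longrightarrow> dist y x < r' \<Longrightarrow> \<bar>q y - q x\<bar> < \<epsilon>"
    using cq S(2) \<epsilon> unfolding continuous_on_iff by (metis dist_real_def)
  \<comment> \<open>Points of the parallelogram with sides \<open>s *\<^sub>R u\<close> and
    \<open>s *\<^sub>R v\<close> lie within \<open>s * m\<close> of \<open>x\<close>; the summand 1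
    keeps \<open>m\<close> positive when \<open>u\<close> and \<open>v\<close> both vanish.\<close>
  define m where "m = norm u + norm v + 1"
  have m: "m > 0" unfolding m_def by (smt (verit) norm_ge_zero)
  define \<delta> where "\<delta> = min r r' / m"
  have near: "x + a *\<^sub>R u + b *\<^sub>R v \<in> S \<and> dist (x + a *\<^sub>R u + b *\<^sub>R v) x < r'"
    if "0 \<le> a" "a \<le> s" "0 \<le> b" "b \<le> s" "0 < s" "s < \<delta>" for a b s
  proof -
    have "norm (a *\<^sub>R u + b *\<^sub>R v) \<le> a * norm u + b * norm v"
      using norm_triangle_ineq[of "a *\<^sub>R u" "b *\<^sub>R v"] that by simp
    also have "\<dots> \<le> s * norm u + s * norm v"
      using that by (intro add_mono mult_right_mono) auto
    also have "\<dots> \<le> s * m" using that by (simp add: m_def distrib_left)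
    also have "s * m < min r r'" using that m by (simp add: \<delta>_def pos_less_divide_eq)
    finally show ?thesis using r(2) by (auto simp: dist_norm norm_minus_commute add.assoc subset_iff)
  qed
  have "\<bar>f (x + s *\<^sub>R u + s *\<^sub>R v) - f (x + s *\<^sub>R u) - f (x + s *\<^sub>R v) + f x - s\<^sup>2 * q x\<bar> \<le> \<epsilon> * s\<^sup>2"
    if s: "0 < s" "s < \<delta>" for s
  proof -
    have aff: "((\<lambda>t. x + t *\<^sub>R u + b *\<^sub>R v) has_derivative (\<lambda>w. w *\<^sub>R u)) (at t)" for t b
      by (auto intro!: derivative_eq_intros)
    have aff2: "((\<lambda>t. x + a *\<^sub>R u + t *\<^sub>R v) has_derivative (\<lambda>w. w *\<^sub>R v)) (at t)" for t a
      by (auto intro!: derivative_eq_intros)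
    have d1: "((\<lambda>t. f (x + t *\<^sub>R u + b *\<^sub>R v)) has_real_derivative g (x + t *\<^sub>R u + b *\<^sub>R v)) (at t)"
      if "0 \<le> t" "t \<le> s" "0 \<le> b" "b \<le> s" for t b
    proof -
      have i: "x + t *\<^sub>R u + b *\<^sub>R v \<in> S" using near that s by blast
      show ?thesis unfolding g_def by (rule has_real_derivative_along[OF df[OF i] aff])
    qed
    have d2: "((\<lambda>t. g (x + a *\<^sub>R u + t *\<^sub>R v)) has_real_derivative q (x + a *\<^sub>R u + t *\<^sub>R v)) (at t)"
      if "0 \<le> t" "t \<le> s" "0 \<le> a" "a \<le> s" for t a
    proof -
      have i: "x + a *\<^sub>R u + t *\<^sub>R v \<in> S" using near that s by blast
      show ?thesis unfolding q_def by (rule has_real_derivative_along[OF dg[OF i] aff2])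
    qed
    \<comment> \<open>The mean value theorem in direction \<open>u\<close> is applied to the
      difference of \<open>f\<close> along two opposite sides rather than to each side, so that one
      intermediate \<open>t\<close> serves both.\<close>
    have "\<exists>t. 0 < t \<and> t < s \<and>
       (f (x + s *\<^sub>R u + s *\<^sub>R v) - f (x + s *\<^sub>R u + 0 *\<^sub>R v))
        - (f (x + 0 *\<^sub>R u + s *\<^sub>R v) - f (x + 0 *\<^sub>R u + 0 *\<^sub>R v))
       = (s - 0) * (g (x + t *\<^sub>R u + s *\<^sub>R v) - g (x + t *\<^sub>R u + 0 *\<^sub>R v))"
      by (rule MVT2[OF s(1)]) (use s in \<open>intro DERIV_diff d1; simp\<close>)
    then obtain t where t: "0 < t" "t < s"
      "f (x + s *\<^sub>R u + s *\<^sub>R v) - f (x + s *\<^sub>R u) - f (x + s *\<^sub>R v) + f x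
        = s * (g (x + t *\<^sub>R u + s *\<^sub>R v) - g (x + t *\<^sub>R u + 0 *\<^sub>R v))"
      by auto
    have "\<exists>b. 0 < b \<and> b < s \<and>
       g (x + t *\<^sub>R u + s *\<^sub>R v) - g (x + t *\<^sub>R u + 0 *\<^sub>R v) = (s - 0) * q (x + t *\<^sub>R u + b *\<^sub>R v)"
      by (rule MVT2[OF s(1)]) (use s t in \<open>intro d2; simp\<close>)
    then obtain b where b: "0 < b" "b < s"
       "g (x + t *\<^sub>R u + s *\<^sub>R v) - g (x + t *\<^sub>R u + 0 *\<^sub>R v) = s * q (x + t *\<^sub>R u + b *\<^sub>R v)"
      by auto
    have "f (x + s *\<^sub>R u + s *\<^sub>R v) - f (x + s *\<^sub>R u) - f (x + s *\<^sub>R v) + f x - s\<^sup>2 * q x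
       = (q (x + t *\<^sub>R u + b *\<^sub>R v) - q x) * s\<^sup>2"
      using t(3) b(3) by (simp add: power2_eq_square algebra_simps)
    moreover have "\<bar>q (x + t *\<^sub>R u + b *\<^sub>R v) - q x\<bar> \<le> \<epsilon>"
      using near[of t s b] r'(2) s t b by (meson less_imp_le)
    ultimately show ?thesis by (simp add: abs_mult mult_right_mono)
  qed
  then show ?thesis using r(1) r'(1) m unfolding \<delta>_def q_def g_def
    by (intro exI[of _ "min r r' / m"]) auto
qed

text \<open>Schwarz's theorem: divided by the square of \<open>s\<close>, the same second difference
  tends to either mixed derivative.\<close>

lemma second_derivative_symmetric_real:
  fixes f :: "'e::euclidean_space \<Rightarrow> real"
  assumes "open S" "x \<in> S" "Ck_on 2 S f"
  shows "deriv_at (\<lambda>y. deriv_at f y u) x v = deriv_at (\<lambda>y. deriv_at f y v) x u" (is "?a = ?b")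
proof (rule ccontr)
  assume "?a \<noteq> ?b"
  \<comment> \<open>Each approximation may err by a third of the gap, so together they cannot
    account for all of it.\<close>
  then have e: "\<bar>?a - ?b\<bar> / 3 > 0" by simp
  define \<Delta> where "\<Delta> = (\<lambda>s. f (x + s *\<^sub>R u + s *\<^sub>R v) - f (x + s *\<^sub>R u) - f (x + s *\<^sub>R v) + f x)"
  obtain \<delta> where d: "\<delta> > 0" "\<And>s. 0 < s \<Longrightarrow> s < \<delta> \<Longrightarrow> \<bar>\<Delta> s - s\<^sup>2 * ?a\<bar> \<le> \<bar>?a - ?b\<bar> / 3 * s\<^sup>2"
    unfolding \<Delta>_def using second_difference[OF assms e, of u v] by auto
  obtain \<delta>' where d': "\<delta>' > 0" "\<And>s. 0 < s \<Longrightarrow> s < \<delta>' \<Longrightarrow> \<bar>\<Delta> s - s\<^sup>2 * ?b\<bar> \<le> \<bar>?a - ?b\<bar> / 3 * s\<^sup>2"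
    unfolding \<Delta>_def using second_difference[OF assms e, of v u] by (auto simp: algebra_simps)
  define s where "s = min \<delta> \<delta>' / 2"
  have s: "0 < s" "s < \<delta>" "s < \<delta>'" using d(1) d'(1) unfolding s_def by auto
  have "s\<^sup>2 * \<bar>?a - ?b\<bar> = \<bar>s\<^sup>2 * ?a - s\<^sup>2 * ?b\<bar>" by (simp add: right_diff_distrib[symmetric] abs_mult)
  also have "\<dots> \<le> \<bar>\<Delta> s - s\<^sup>2 * ?a\<bar> + \<bar>\<Delta> s - s\<^sup>2 * ?b\<bar>" by linarith
  also have "\<dots> \<le> 2 / 3 * (s\<^sup>2 * \<bar>?a - ?b\<bar>)"
    using d(2)[OF s(1,2)] d'(2)[OF s(1,3)] by (simp add: field_simps)
  finally have "s\<^sup>2 * \<bar>?a - ?b\<bar> \<le> 0" by simp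
  then show False using \<open>?a \<noteq> ?b\<close> s(1) by (simp add: mult_le_0_iff)
qed

lemma second_derivative_symmetric:
  fixes f :: "'e::euclidean_space \<Rightarrow> 'f::euclidean_space"
  assumes S: "open S" "x \<in> S" and f: "Ck_on 2 S f"
  shows "deriv_at (\<lambda>y. deriv_at f y u) x v = deriv_at (\<lambda>y. deriv_at f y v) x u"
proof (rule euclidean_eqI)
  fix b :: 'f
  assume "b \<in> Basis"
  have df: "f differentiable at y" if "y \<in> S" for y
    using f that S(1) by (auto simp: numeral_2_eq_2 differentiable_on_eq_differentiable_at)
  have dg: "(\<lambda>z. deriv_at f z u) differentiable at y" if "y \<in> S" for y u
    using f that S(1) by (auto simp: numeral_2_eq_2 differentiable_on_eq_differentiable_at)
  have 1: "deriv_at (\<lambda>z. f z \<bullet> b) y = (\<lambda>w. deriv_at f y w \<bullet> b)" if "y \<in> S" for y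
    by (intro deriv_at_eqI has_derivative_inner_left has_derivative_deriv_at df[OF that])
  have 2: "deriv_at (\<lambda>y. deriv_at (\<lambda>z. f z \<bullet> b) y u) x v = deriv_at (\<lambda>y. deriv_at f y u) x v \<bullet> b" for u v
  proof -
    have "((\<lambda>y. deriv_at f y u \<bullet> b) has_derivative (\<lambda>v. deriv_at (\<lambda>y. deriv_at f y u) x v \<bullet> b)) (at x)"
      by (intro has_derivative_inner_left has_derivative_deriv_at dg S)
    then have "((\<lambda>y. deriv_at (\<lambda>z. f z \<bullet> b) y u) has_derivative
        (\<lambda>v. deriv_at (\<lambda>y. deriv_at f y u) x v \<bullet> b)) (at x)"
      by (rule has_derivative_transform_within_open[OF _ S]) (simp add: 1)
    from deriv_at_eqI[OF this] show ?thesis by simp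
  qed
  have "Ck_on 2 S (\<lambda>z. f z \<bullet> b)"
    using Ck_on_linear_comp[OF S(1) _ f, of "\<lambda>z. z \<bullet> b"]
    by (simp add: linear_inner_left)
  from second_derivative_symmetric_real[OF S this, of u v]
  show "deriv_at (\<lambda>y. deriv_at f y u) x v \<bullet> b = deriv_at (\<lambda>y. deriv_at f y v) x u \<bullet> b"
    by (simp add: 2)
qed

section \<open>Linear systems depending smoothly on parameters\<close>

text \<open>Injectivity is an open condition, quantitatively: a lower bound \<open>c\<close> for
  \<open>A x\<close> survives as \<open>c / 2\<close> while \<open>A y\<close> differs from
  \<open>A x\<close> by at most \<open>c / 2\<close>. The constant is uniform in \<open>y\<close>,
  as the later estimates require.\<close>

lemma injective_family_bounded_below:
  fixes A :: "'e::euclidean_space \<Rightarrow> 'f::euclidean_space \<Rightarrow> 'f"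
  assumes S: "open S" "x \<in> S" and lin: "\<And>y. y \<in> S \<Longrightarrow> linear (A y)"
    and inj: "\<And>v. A x v = 0 \<Longrightarrow> v = 0" and cont: "\<And>v. continuous_on S (\<lambda>y. A y v)"
  shows "\<exists>d>0. \<exists>C>0. \<forall>y. norm (y - x) < d \<longrightarrow> y \<in> S \<and> (\<forall>v. norm v \<le> C * norm (A y v))"
proof -
  have "inj (A x)" using inj lin[OF S(2)] by (simp add: linear_injective_0)
  from linear_inj_bounded_below_pos[OF lin[OF S(2)] this]
  obtain c where c: "c > 0" "\<And>v. c * norm v \<le> norm (A x v)" by blast
  \<comment> \<open>This sum dominates the operator norm of the difference, and its continuity
    follows from continuity on single vectors.\<close>
  have "continuous_on S (\<lambda>y. \<Sum>b\<in>Basis. norm (A y b - A x b))"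
    by (intro continuous_intros cont)
  then obtain d1 where d1: "d1 > 0"
    "\<And>y. y \<in> S \<Longrightarrow> dist y x < d1 \<Longrightarrow> dist (\<Sum>b\<in>Basis. norm (A y b - A x b)) (\<Sum>b\<in>Basis. norm (A x b - A x b)) < c / 2"
    using S(2) half_gt_zero[OF c(1)] unfolding continuous_on_iff by meson
  obtain d2 where d2: "d2 > 0" "ball x d2 \<subseteq> S" using S by (auto simp: open_contains_ball)
  have "y \<in> S \<and> (\<forall>v. norm v \<le> 2 / c * norm (A y v))" if "norm (y - x) < min d1 d2" for y
  proof (intro conjI allI)
    have "y \<in> ball x d2" using that by (simp add: dist_norm norm_minus_commute)
    then show y: "y \<in> S" using d2 by blast
    fix v
    have "A y v - A x v = (\<Sum>b\<in>Basis. (v \<bullet> b) *\<^sub>R (A y b - A x b))"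
      using linear_sum[OF lin[OF y], of "\<lambda>b. (v \<bullet> b) *\<^sub>R b" Basis]
        linear_sum[OF lin[OF S(2)], of "\<lambda>b. (v \<bullet> b) *\<^sub>R b" Basis]
      by (simp add: euclidean_representation linear_cmul[OF lin[OF y]]
          linear_cmul[OF lin[OF S(2)]] scaleR_diff_right sum_subtractf)
    also have "norm \<dots> \<le> (\<Sum>b\<in>Basis. norm v * norm (A y b - A x b))"
      by (intro sum_norm_le) (auto intro: mult_right_mono Basis_le_norm)
    also have "\<dots> = norm v * (\<Sum>b\<in>Basis. norm (A y b - A x b))" by (simp add: sum_distrib_left)
    also have "\<dots> \<le> norm v * (c / 2)"
      using d1(2)[OF y] that by (intro mult_left_mono) (auto simp: dist_norm)
    finally have "norm (A x v) - norm v * (c / 2) \<le> norm (A y v)"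
      using norm_triangle_ineq2[of "A x v" "A y v"] by (simp add: norm_minus_commute)
    with c(2)[of v] have "c / 2 * norm v \<le> norm (A y v)" by (simp add: algebra_simps)
    then show "norm v \<le> 2 / c * norm (A y v)" using c(1) by (simp add: field_simps)
  qed
  then show ?thesis using d1(1) d2(1) c(1)
    by (intro exI[of _ "min d1 d2"] conjI exI[of _ "2 / c"]) auto
qed

text \<open>A function dominated by a first-order negligible one is negligible. This carries an
  error estimate from the residual of a linear system to its solution.\<close>

lemma has_derivative_zero_dominated:
  assumes "(r has_derivative (\<lambda>_. 0)) (at x)" "r x = 0" "d > 0" "C > 0"
    and "\<And>y. norm (y - x) < d \<Longrightarrow> norm (s y) \<le> C * norm (r y)"
  shows "(s has_derivative (\<lambda>_. 0)) (at x)"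
  unfolding has_derivative_at_alt
proof (intro conjI bounded_linear_zero allI impI)
  fix e :: real
  assume "e > 0"
  then have "e / C > 0" using assms(4) by simp
  then obtain d' where d': "d' > 0" "\<And>y. norm (y - x) < d' \<Longrightarrow> norm (r y) \<le> e / C * norm (y - x)"
    using assms(1,2) unfolding has_derivative_at_alt by auto
  have s0: "s x = 0" using assms(5)[of x] assms(2,3) by simp
  have "norm (s y - s x - 0) \<le> e * norm (y - x)" if "norm (y - x) < min d d'" for y
  proof -
    have "norm (s y) \<le> C * norm (r y)" using assms(5) that by simp
    also have "\<dots> \<le> C * (e / C * norm (y - x))" using d'(2)[of y] that assms(4) by (intro mult_left_mono) auto
    finally show ?thesis using assms(4) s0 by simp
  qed
  then show "\<exists>d>0. \<forall>y. norm (y - x) < d \<longrightarrow> norm (s y - s x - 0) \<le> e * norm (y - x)"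
    using assms(3) d'(1) by (intro exI[of _ "min d d'"]) auto
qed

text \<open>Formal differentiation of \<open>A t = b\<close> yields a linear equation for the
  derivative, solvable because the injective endomorphism \<open>A x\<close> is invertible. To see
  that this candidate really is the derivative, \<open>A y\<close> is applied to the first-order
  error of \<open>t\<close>: the result \<open>r\<close> involves only differentiable data, and the
  lower bound on \<open>A y\<close> brings the estimate back to \<open>t\<close>.\<close>

lemma linear_solution_has_derivative:
  fixes A :: "'e::euclidean_space \<Rightarrow> 'f::euclidean_space \<Rightarrow> 'f"
  assumes S: "open S" "x \<in> S" and lin: "\<And>y. y \<in> S \<Longrightarrow> linear (A y)"
    and inj: "\<And>v. A x v = 0 \<Longrightarrow> v = 0" and A: "\<And>v. smooth_on S (\<lambda>y. A y v)"
    and b: "(b has_derivative b') (at x)" and t: "\<And>y. y \<in> S \<Longrightarrow> A y (t y) = b y"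
  shows "\<exists>t'. (t has_derivative t') (at x) \<and>
    (\<forall>w. A x (t' w) = b' w - deriv_at (\<lambda>y. A y (t x)) x w)"
proof -
  have cA: "continuous_on S (\<lambda>y. A y v)" for v
    using A[of v] unfolding smooth_on_def by (metis Ck_on.simps(1))
  obtain d C where dC: "d > 0" "C > 0"
    "\<And>y. norm (y - x) < d \<Longrightarrow> y \<in> S \<and> (\<forall>v. norm v \<le> C * norm (A y v))"
    using injective_family_bounded_below[OF S lin inj cA] by blast
  have "inj (A x)" using inj lin[OF S(2)] by (simp add: linear_injective_0)
  then obtain B where B: "linear B" "\<And>v. A x (B v) = v"
    using linear_injective_isomorphism[OF lin[OF S(2)]] by blast
  have dA: "((\<lambda>y. A y v) has_derivative deriv_at (\<lambda>y. A y v) x) (at x)" for v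
    using smooth_on_has_derivative[OF A S] .
  define t' where "t' = (\<lambda>w. B (b' w - deriv_at (\<lambda>y. A y (t x)) x w))"
  have lt': "linear t'" unfolding t'_def
    using has_derivative_linear[OF has_derivative_diff[OF b dA[of "t x"]]] B(1)
      linear_compose[of _ B] by (simp add: o_def)
  then have bt': "bounded_linear t'" by (simp add: linear_conv_bounded_linear)
  have At': "A x (t' w) = b' w - deriv_at (\<lambda>y. A y (t x)) x w" for w
    by (simp add: t'_def B(2))
  define r where "r = (\<lambda>y. b y - A y (t x) - A y (t' (y - x)))"
  have "((\<lambda>y. t' (y - x)) has_derivative (\<lambda>w. t' (w - 0))) (at x)"
    by (intro bounded_linear.has_derivative[OF bt'] has_derivative_diff has_derivative_ident has_derivative_const)
  then have 1: "((\<lambda>y. A y (t' (y - x))) has_derivative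
      (\<lambda>w. deriv_at (\<lambda>y. A y (t' (x - x))) x w + A x (t' (w - 0)))) (at x)"
    by (intro has_derivative_linear_apply[OF S lin] Derivative.differentiableI[OF dA])
  have z: "deriv_at (\<lambda>y. A y (t' (x - x))) x = (\<lambda>_. 0)"
    by (rule deriv_at_eqI, rule has_derivative_transform_within_open[OF has_derivative_const[of 0] S])
      (simp add: linear_0[OF lt'] linear_0[OF lin])
  have "(r has_derivative (\<lambda>w. b' w - deriv_at (\<lambda>y. A y (t x)) x w
      - (deriv_at (\<lambda>y. A y (t' (x - x))) x w + A x (t' (w - 0))))) (at x)"
    unfolding r_def by (intro has_derivative_diff b dA 1)
  then have r': "(r has_derivative (\<lambda>_. 0)) (at x)" by (simp add: z[unfolded diff_self] At')
  have "((\<lambda>y. t y - t x - t' (y - x)) has_derivative (\<lambda>_. 0)) (at x)"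
  proof (rule has_derivative_zero_dominated[OF r' _ dC(1,2)])
    show "r x = 0" by (simp add: r_def t[OF S(2)] linear_0[OF lt'] linear_0[OF lin[OF S(2)]])
    show "norm (t y - t x - t' (y - x)) \<le> C * norm (r y)" if "norm (y - x) < d" for y
    proof -
      have "r y = A y (t y - t x - t' (y - x))"
        using dC(3)[OF that] by (simp add: r_def t linear_diff[OF lin])
      then show ?thesis using dC(3)[OF that] by simp
    qed
  qed
  from has_derivative_add[OF this has_derivative_add[OF has_derivative_const[of "t x"]
        bounded_linear.has_derivative[OF bt' has_derivative_diff[OF has_derivative_ident has_derivative_const[of x]]]]]
  have "(t has_derivative t') (at x)" by simp
  with At' show ?thesis by blast
qed

text \<open>Differentiating \<open>A t = b\<close> shows that the directional derivatives of \<open>t\<close> solve systems with the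
  same matrix \<open>A\<close>, which drives the induction on the order of differentiability.\<close>

lemma Ck_on_linear_solution:
  fixes A :: "'e::euclidean_space \<Rightarrow> 'f::euclidean_space \<Rightarrow> 'f"
  assumes S: "open S" and lin: "\<And>y. y \<in> S \<Longrightarrow> linear (A y)"
    and inj: "\<And>y v. y \<in> S \<Longrightarrow> A y v = 0 \<Longrightarrow> v = 0" and A: "\<And>v. smooth_on S (\<lambda>y. A y v)"
    and b: "Ck_on k S b" and t: "\<And>y. y \<in> S \<Longrightarrow> A y (t y) = b y"
  shows "Ck_on k S t"
  using b t
proof (induction k arbitrary: b t)
  case 0
  have cA: "continuous_on S (\<lambda>y. A y v)" for v
    using A[of v] unfolding smooth_on_def by (metis Ck_on.simps(1))
  \<comment> \<open>The lower bound is applied to \<open>A y (t y - t x) = b y - A y (t x)\<close>,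
    whose right side tends to zero.\<close>
  have "continuous (at x) t" if x: "x \<in> S" for x
  proof -
    obtain d C where dC: "d > 0" "C > 0"
      "\<And>y. norm (y - x) < d \<Longrightarrow> y \<in> S \<and> (\<forall>v. norm v \<le> C * norm (A y v))"
      using injective_family_bounded_below[OF S x lin inj[OF x] cA] by blast
    have "continuous_on S (\<lambda>y. C * norm (b y - A y (t x)))"
      using 0(1) by (intro continuous_intros cA) simp
    then have "((\<lambda>y. C * norm (b y - A y (t x))) \<longlongrightarrow> C * norm (b x - A x (t x))) (at x)"
      using S x by (simp add: continuous_on_eq_continuous_at isCont_def)
    then have lim: "((\<lambda>y. C * norm (b y - A y (t x))) \<longlongrightarrow> 0) (at x)" using 0(2)[OF x] by simp
    have "\<forall>\<^sub>F y in at x. norm (t y - t x) \<le> C * norm (b y - A y (t x))"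
      unfolding eventually_at
    proof (intro exI[of _ d] conjI ballI impI)
      fix y assume "y \<noteq> x \<and> dist y x < d"
      then have y: "norm (y - x) < d" by (simp add: dist_norm)
      have "b y - A y (t x) = A y (t y - t x)" using dC(3)[OF y] 0(2) by (simp add: linear_diff[OF lin])
      then show "norm (t y - t x) \<le> C * norm (b y - A y (t x))" using dC(3)[OF y] by simp
    qed (rule dC(1))
    from Lim_null_comparison[OF this lim] show ?thesis
      by (simp add: isCont_def LIM_zero_iff)
  qed
  then show ?case by (simp add: continuous_at_imp_continuous_on)
next
  case (Suc k)
  have "\<exists>t'. (t has_derivative t') (at x) \<and>
    (\<forall>w. A x (t' w) = deriv_at b x w - deriv_at (\<lambda>y. A y (t x)) x w)" if x: "x \<in> S" for x
    using linear_solution_has_derivative[OF S x lin inj[OF x] A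
        has_derivative_deriv_at[OF Ck_on_Suc_differentiable[OF S Suc.prems(1) x]] Suc.prems(2)] .
  then obtain t' where t': "\<And>x. x \<in> S \<Longrightarrow> (t has_derivative t' x) (at x)"
    "\<And>x w. x \<in> S \<Longrightarrow> A x (t' x w) = deriv_at b x w - deriv_at (\<lambda>y. A y (t x)) x w" by metis
  \<comment> \<open>The right side of the differentiated system contains \<open>t\<close> itself, so
    its regularity of order \<open>k\<close> has to be known before the derivative is
    treated.\<close>
  have tk: "Ck_on k S t" by (rule Suc.IH[OF Ck_on_SucD[OF Suc.prems(1)] Suc.prems(2)])
  show ?case
  proof (rule Ck_on_SucI[OF S t'(1)])
    fix w
    have "Ck_on k S (\<lambda>x. - deriv_at (\<lambda>y. A y (t x)) x w)"
    proof (rule Ck_on_linear_apply[where \<Lambda> = "\<lambda>x v. - deriv_at (\<lambda>y. A y v) x w" and f = t, OF S _ _ tk])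
      show "linear (\<lambda>v. - deriv_at (\<lambda>y. A y v) x w)" if x: "x \<in> S" for x
      proof (rule linearI)
        have d: "((\<lambda>y. A y v) has_derivative deriv_at (\<lambda>y. A y v) x) (at x)" for v
          using smooth_on_has_derivative[OF A S x] .
        fix u v and c :: real
        have "((\<lambda>y. A y (u + v)) has_derivative (\<lambda>w. deriv_at (\<lambda>y. A y u) x w + deriv_at (\<lambda>y. A y v) x w)) (at x)"
          by (rule has_derivative_transform_within_open[OF has_derivative_add[OF d d] S x])
            (simp add: linear_add[OF lin])
        from deriv_at_eqI[OF this]
        show "- deriv_at (\<lambda>y. A y (u + v)) x w = - deriv_at (\<lambda>y. A y u) x w + - deriv_at (\<lambda>y. A y v) x w"
          by simp
        have "((\<lambda>y. A y (c *\<^sub>R v)) has_derivative (\<lambda>w. c *\<^sub>R deriv_at (\<lambda>y. A y v) x w)) (at x)"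
          by (rule has_derivative_transform_within_open[OF has_derivative_scaleR_right[OF d] S x])
            (simp add: linear_cmul[OF lin])
        from deriv_at_eqI[OF this]
        show "- deriv_at (\<lambda>y. A y (c *\<^sub>R v)) x w = c *\<^sub>R (- deriv_at (\<lambda>y. A y v) x w)"
          by simp
      qed
      show "Ck_on k S (\<lambda>x. - deriv_at (\<lambda>y. A y v) x w)" for v
        using smooth_on_linear_comp[OF S module_hom_uminus smooth_on_deriv[OF A]]
        unfolding smooth_on_def by blast
    qed
    then have "Ck_on k S (\<lambda>x. deriv_at b x w + - deriv_at (\<lambda>y. A y (t x)) x w)"
      using Suc.prems(1) by (intro Ck_on_add S) simp_all
    then show "Ck_on k S (\<lambda>x. t' x w)"
      by (rule Suc.IH) (simp add: t'(2))
  qed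
qed

lemma smooth_on_linear_solution:
  fixes A :: "'e::euclidean_space \<Rightarrow> 'f::euclidean_space \<Rightarrow> 'f"
  assumes "open S" "\<And>y. y \<in> S \<Longrightarrow> linear (A y)" "\<And>y v. y \<in> S \<Longrightarrow> A y v = 0 \<Longrightarrow> v = 0"
    and "\<And>v. smooth_on S (\<lambda>y. A y v)" "smooth_on S b" "\<And>y. y \<in> S \<Longrightarrow> A y (t y) = b y"
  shows "smooth_on S t"
  unfolding smooth_on_def
  by (intro allI Ck_on_linear_solution[OF assms(1-4) _ assms(6)]) (use assms(5) in \<open>auto simp: smooth_on_def\<close>)


section \<open>Orthogonal projections for an arbitrary inner product\<close>

text \<open>Covers both a metric at a point and its expression in a chart, so that projections are
  treated once for both.\<close>

definition inner_product :: "('e::real_vector \<Rightarrow> 'e \<Rightarrow> real) \<Rightarrow> bool" where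
  "inner_product b \<longleftrightarrow> bilinear b \<and> (\<forall>u v. b u v = b v u) \<and> (\<forall>u. u \<noteq> 0 \<longrightarrow> b u u > 0)"

lemma inner_product_simps:
  assumes "inner_product b"
  shows "b (u + v) w = b u w + b v w" "b w (u + v) = b w u + b w v"
    "b (u - v) w = b u w - b v w" "b w (u - v) = b w u - b w v"
    "b (c *\<^sub>R u) w = c * b u w" "b w (c *\<^sub>R u) = c * b w u" "b 0 w = 0" "b w 0 = 0"
    "b (- u) w = - b u w" "b w (- u) = - b w u"
proof -
  have b: "bilinear b" using assms by (simp add: inner_product_def)
  show "b (u + v) w = b u w + b v w" "b w (u + v) = b w u + b w v"
    "b (u - v) w = b u w - b v w" "b w (u - v) = b w u - b w v"
    "b (c *\<^sub>R u) w = c * b u w" "b w (c *\<^sub>R u) = c * b w u" "b 0 w = 0" "b w 0 = 0"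
    "b (- u) w = - b u w" "b w (- u) = - b w u"
    using b by (simp_all add: bilinear_ladd bilinear_radd bilinear_lsub bilinear_rsub bilinear_lmul
        bilinear_rmul bilinear_lzero bilinear_rzero bilinear_lneg bilinear_rneg)
qed

lemma inner_product_commute: "inner_product b \<Longrightarrow> b u v = b v u"
  by (simp add: inner_product_def)

lemma inner_product_eq_0: "inner_product b \<Longrightarrow> b u u = 0 \<longleftrightarrow> u = 0"
  by (metis inner_product_def inner_product_simps(7) less_irrefl)

lemma inner_product_nonneg: "inner_product b \<Longrightarrow> b u u \<ge> 0"
  by (metis inner_product_def inner_product_simps(7) less_eq_real_def)

text \<open>Two candidates differ by a vector of \<open>S\<close> that is orthogonal to itself,
  which resolves the definite description.\<close>

lemma orth_proj_eqI:
  assumes "inner_product b" "subspace S" "s \<in> S" "\<And>u. u \<in> S \<Longrightarrow> b (w - s) u = 0"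
  shows "orth_proj b S w = s"
  unfolding orth_proj_def
proof (rule the_equality)
  show "s \<in> S \<and> (\<forall>u\<in>S. b (w - s) u = 0)" using assms by blast
  fix r
  assume r: "r \<in> S \<and> (\<forall>u\<in>S. b (w - r) u = 0)"
  have "r - s \<in> S" using r assms(2,3) by (simp add: subspace_diff)
  then have "b (w - s) (r - s) - b (w - r) (r - s) = 0" using r assms(4) by simp
  moreover have "b (w - s) (r - s) - b (w - r) (r - s) = b (r - s) (r - s)"
    by (simp only: inner_product_simps(3)[OF assms(1), symmetric]) (simp add: algebra_simps)
  ultimately show "r = s" by (simp add: inner_product_eq_0[OF assms(1)])
qed

text \<open>The adjoint of \<open>L\<close> with respect to \<open>b\<close> and the Euclidean
  product; composed with \<open>L\<close> it is the Gram matrix of the frame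
  \<open>L i\<close>.\<close>

definition gram :: "('e::real_vector \<Rightarrow> 'e \<Rightarrow> real) \<Rightarrow> ('m::euclidean_space \<Rightarrow> 'e) \<Rightarrow> 'e \<Rightarrow> 'm" where
  "gram b L w = (\<Sum>i\<in>Basis. b w (L i) *\<^sub>R i)"

lemma gram_inner:
  assumes "inner_product b" "linear L"
  shows "gram b L w \<bullet> v = b w (L v)"
proof -
  have l: "linear (b w)" using assms(1) by (auto simp: inner_product_def bilinear_def)
  have "b w (L v) = b w (L (\<Sum>i\<in>Basis. (v \<bullet> i) *\<^sub>R i))" by (simp add: euclidean_representation)
  also have "\<dots> = (\<Sum>i\<in>Basis. (v \<bullet> i) * b w (L i))"
    by (simp add: linear_sum[OF assms(2)] linear_sum[OF l] linear_cmul[OF assms(2)] linear_cmul[OF l])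
  also have "\<dots> = gram b L w \<bullet> v"
    unfolding gram_def inner_sum_left by (intro sum.cong) (simp_all add: inner_commute[of v] mult.commute)
  finally show ?thesis by simp
qed

lemma linear_gram: "inner_product b \<Longrightarrow> linear (gram b L)"
  by (intro linearI) (simp_all add: gram_def inner_product_simps scaleR_add_left sum.distrib scaleR_sum_right)

lemma gram_nondegenerate:
  assumes "inner_product b" "linear L" "inj L" "gram b L (L t) = 0"
  shows "t = 0"
proof -
  have "b (L t) (L t) = 0" using gram_inner[OF assms(1,2), of "L t" t] assms(4) by simp
  then show ?thesis using assms by (simp add: inner_product_eq_0 linear_injective_0)
qed

text \<open>The normal equations: the Gram matrix is an injective endomorphism of a
  finite-dimensional space, hence surjective. No completeness argument for \<open>b\<close> is
  involved.\<close>

lemma ex_orth_proj_range: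
  fixes L :: "'m::euclidean_space \<Rightarrow> 'e::real_vector"
  assumes b: "inner_product b" and L: "linear L" "inj L"
  shows "\<exists>t. \<forall>u. b (w - L t) (L u) = 0"
proof -
  have lg: "linear (\<lambda>t. gram b L (L t))"
    using linear_compose[OF L(1) linear_gram[OF b]] by (simp add: o_def)
  have "inj (\<lambda>t. gram b L (L t))"
    using gram_nondegenerate[OF b L] by (simp add: linear_injective_0[OF lg])
  then have "surj (\<lambda>t. gram b L (L t))"
    using linear_injective_imp_surjective[OF lg] by blast
  then obtain t where "gram b L w = gram b L (L t)" by (metis surjD)
  then have "b w (L u) = b (L t) (L u)" for u using gram_inner[OF b L(1)] by metis
  then show ?thesis by (auto simp: inner_product_simps[OF b])
qed

lemma subspace_range_linear: "linear L \<Longrightarrow> subspace (range L)"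
  by (rule linear_subspace_image) (simp_all add: subspace_UNIV)

lemma orth_proj_range:
  fixes L :: "'m::euclidean_space \<Rightarrow> 'e::real_vector"
  assumes b: "inner_product b" and L: "linear L" "inj L"
  obtains t where "orth_proj b (range L) w = L t" "\<And>u. b (w - L t) (L u) = 0"
proof -
  obtain t where t: "\<And>u. b (w - L t) (L u) = 0" using ex_orth_proj_range[OF b L] by blast
  moreover have "orth_proj b (range L) w = L t"
    by (rule orth_proj_eqI[OF b subspace_range_linear[OF L(1)]]) (use t in auto)
  ultimately show thesis using that by blast
qed


section \<open>Charts and components\<close>

lemma chart_props:
  assumes "smooth_manifold M" "c \<in> atlas M"
  shows "open (chart_dom c)" "open (chart_map c ` chart_dom c)"
    "p \<in> chart_dom c \<Longrightarrow> chart_inv c (chart_map c p) = p"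
    "z \<in> chart_map c ` chart_dom c \<Longrightarrow> chart_map c (chart_inv c z) = z"
    "z \<in> chart_map c ` chart_dom c \<Longrightarrow> chart_inv c z \<in> chart_dom c"
    "homeomorphism (chart_dom c) (chart_map c ` chart_dom c) (chart_map c) (chart_inv c)"
proof -
  show h: "homeomorphism (chart_dom c) (chart_map c ` chart_dom c) (chart_map c) (chart_inv c)"
    and "open (chart_dom c)" "open (chart_map c ` chart_dom c)"
    using assms unfolding smooth_manifold_def by blast+
  show "p \<in> chart_dom c \<Longrightarrow> chart_inv c (chart_map c p) = p"
    "z \<in> chart_map c ` chart_dom c \<Longrightarrow> chart_map c (chart_inv c z) = z"
    "z \<in> chart_map c ` chart_dom c \<Longrightarrow> chart_inv c z \<in> chart_dom c"
    using h unfolding homeomorphism_def by auto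
qed

lemma open_chart_image:
  assumes "smooth_manifold M" "c \<in> atlas M" "open U"
  shows "open (chart_map c ` (chart_dom c \<inter> U))"
proof -
  have "openin (top_of_set (chart_dom c)) (chart_dom c \<inter> U)" using assms(3) by (simp add: openin_open_Int)
  from homeomorphism_imp_open_map[OF chart_props(6)[OF assms(1,2)] this]
  show ?thesis using chart_props(2)[OF assms(1,2)] openin_open_trans by blast
qed

lemma chart_at_props:
  assumes "smooth_manifold M"
  shows "chart_at M p \<in> atlas M" "p \<in> chart_dom (chart_at M p)"
  using assms unfolding smooth_manifold_def by auto

lemma coord_change_has_derivative:
  assumes "smooth_manifold M" "c \<in> atlas M" "d \<in> atlas M" "p \<in> chart_dom c" "p \<in> chart_dom d"
  shows "((\<lambda>z. chart_map d (chart_inv c z)) has_derivative coord_change c d p) (at (chart_map c p))"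
proof -
  have "smooth_on (chart_map c ` (chart_dom c \<inter> chart_dom d)) (chart_map d \<circ> chart_inv c)"
    using assms unfolding smooth_manifold_def by blast
  from smooth_on_has_derivative[OF this open_chart_image[OF assms(1,2) chart_props(1)[OF assms(1,3)]], of "chart_map c p"]
  show ?thesis using assms(4,5) by (simp add: o_def coord_change_def)
qed

lemma linear_coord_change:
  assumes "smooth_manifold M" "c \<in> atlas M" "d \<in> atlas M" "p \<in> chart_dom c" "p \<in> chart_dom d"
  shows "linear (coord_change c d p)"
  using coord_change_has_derivative[OF assms] by (rule has_derivative_linear)

lemma coord_change_refl:
  assumes "smooth_manifold M" "c \<in> atlas M" "p \<in> chart_dom c"
  shows "coord_change c c p v = v"
proof -
  have "((\<lambda>z. z) has_derivative coord_change c c p) (at (chart_map c p))"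
    by (rule has_derivative_transform_within_open[OF coord_change_has_derivative[OF assms(1,2,2,3,3)]
          chart_props(2)[OF assms(1,2)]]) (use assms(3) chart_props(4)[OF assms(1,2)] in auto)
  from has_derivative_unique[OF this has_derivative_ident] show ?thesis by simp
qed

text \<open>Cocycle rule, from the chain rule for transition maps.\<close>

lemma coord_change_trans:
  assumes "smooth_manifold M" "c \<in> atlas M" "d \<in> atlas M" "e \<in> atlas M"
    and "p \<in> chart_dom c" "p \<in> chart_dom d" "p \<in> chart_dom e"
  shows "coord_change d e p (coord_change c d p v) = coord_change c e p v"
proof -
  have "((\<lambda>z. chart_map e (chart_inv d z)) has_derivative coord_change d e p) (at (chart_map d (chart_inv c (chart_map c p))))"
    using coord_change_has_derivative[OF assms(1,3,4,6,7)] chart_props(3)[OF assms(1,2,5)] by simp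
  from diff_chain_at[OF coord_change_has_derivative[OF assms(1,2,3,5,6)] this]
  have "((\<lambda>z. chart_map e (chart_inv d (chart_map d (chart_inv c z)))) has_derivative
      (\<lambda>v. coord_change d e p (coord_change c d p v))) (at (chart_map c p))"
    by (simp add: o_def)
  then have "((\<lambda>z. chart_map e (chart_inv c z)) has_derivative
      (\<lambda>v. coord_change d e p (coord_change c d p v))) (at (chart_map c p))"
    by (rule has_derivative_transform_within_open[OF _ open_chart_image[OF assms(1,2) chart_props(1)[OF assms(1,3)]]])
      (use assms chart_props(3)[OF assms(1,2)] chart_props(3)[OF assms(1,3)] in auto)
  from has_derivative_unique[OF this coord_change_has_derivative[OF assms(1,2,4,5,7)]]
  show ?thesis by metis
qed

lemma components_coord_field:
  assumes "smooth_manifold M" "c \<in> atlas M" "p \<in> chart_dom c"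
  shows "components M c p (coord_field M c v p) = v" "coord_field M c (components M c p v) p = v"
  using assms chart_at_props[OF assms(1), of p]
  by (simp_all add: components_def coord_field_def coord_change_trans[OF assms(1)] coord_change_refl[OF assms(1)])

lemma linear_components:
  assumes "smooth_manifold M" "c \<in> atlas M" "p \<in> chart_dom c"
  shows "linear (components M c p)"
  using assms chart_at_props[OF assms(1), of p]
    linear_coord_change[OF assms(1), of "chart_at M p" c p] by (simp add: components_def[abs_def])

lemma linear_coord_field:
  assumes "smooth_manifold M" "c \<in> atlas M" "p \<in> chart_dom c"
  shows "linear (\<lambda>v. coord_field M c v p)"
  using assms chart_at_props[OF assms(1), of p]
    linear_coord_change[OF assms(1), of c "chart_at M p" p] by (simp add: coord_field_def[abs_def])

lemma components_chart_at: "smooth_manifold M \<Longrightarrow> components M (chart_at M p) p v = v"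
  by (simp add: components_def coord_change_refl chart_at_props)

lemma coord_field_chart_at: "smooth_manifold M \<Longrightarrow> coord_field M (chart_at M p) v p = v"
  by (simp add: coord_field_def coord_change_refl chart_at_props)

lemma components_change:
  assumes "smooth_manifold M" "c \<in> atlas M" "d \<in> atlas M" "p \<in> chart_dom c" "p \<in> chart_dom d"
  shows "components M d p v = coord_change c d p (components M c p v)"
  using assms chart_at_props[OF assms(1), of p]
  by (simp add: components_def coord_change_trans[OF assms(1)])

lemma smooth_field_on_subset: "smooth_field_on M U X \<Longrightarrow> V \<subseteq> U \<Longrightarrow> smooth_field_on M V X"
  unfolding smooth_field_on_def by (meson Int_mono image_mono order_refl smooth_on_subset)

text \<open>One chart covering \<open>U\<close> decides smoothness, since components in any other
  chart arise through the Jacobian of the transition map, which is smooth.\<close>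

lemma smooth_field_on_chartI:
  assumes M: "smooth_manifold M" and c: "c \<in> atlas M" and U: "open U" "U \<subseteq> chart_dom c"
    and X: "smooth_on (chart_map c ` U) (\<lambda>z. components M c (chart_inv c z) (X (chart_inv c z)))"
  shows "smooth_field_on M U X"
  unfolding smooth_field_on_def
proof
  fix d
  assume d: "d \<in> atlas M"
  let ?S = "chart_map d ` (chart_dom d \<inter> U)" and ?T = "chart_map c ` (chart_dom c \<inter> U \<inter> chart_dom d)"
  define \<tau> where "\<tau> = (\<lambda>z. chart_map c (chart_inv d z))"
  define \<sigma> where "\<sigma> = (\<lambda>z. chart_map d (chart_inv c z))"
  have S: "open ?S" and T: "open ?T"
    using open_chart_image[OF M d U(1)] open_chart_image[OF M c open_Int[OF U(1) chart_props(1)[OF M d]]]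
    by (simp_all add: Int_assoc)
  have \<tau>: "smooth_on ?S \<tau>"
    using M c d U(2) smooth_on_subset[of "chart_map d ` (chart_dom d \<inter> chart_dom c)" \<tau> ?S]
    unfolding smooth_manifold_def \<tau>_def by (fastforce simp: o_def)
  have \<sigma>: "smooth_on ?T \<sigma>"
    using M c d U(2) smooth_on_subset[of "chart_map c ` (chart_dom c \<inter> chart_dom d)" \<sigma> ?T]
    unfolding smooth_manifold_def \<sigma>_def by (fastforce simp: o_def)
  have im: "\<tau> ` ?S \<subseteq> ?T" using U(2) chart_props(3)[OF M d] by (auto simp: \<tau>_def)
  have X': "smooth_on ?T (\<lambda>z. components M c (chart_inv c z) (X (chart_inv c z)))"
    by (rule smooth_on_subset[OF X]) auto
  have "smooth_on ?S (\<lambda>z. deriv_at \<sigma> (\<tau> z) (components M c (chart_inv c (\<tau> z)) (X (chart_inv c (\<tau> z)))))"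
  proof (rule smooth_on_linear_apply[where \<Lambda> = "\<lambda>z. deriv_at \<sigma> (\<tau> z)"
        and f = "\<lambda>z. components M c (chart_inv c (\<tau> z)) (X (chart_inv c (\<tau> z)))", OF S])
    show "linear (deriv_at \<sigma> (\<tau> z))" if "z \<in> ?S" for z
      using that im by (intro smooth_on_linear_deriv[OF \<sigma> T]) blast
    show "smooth_on ?S (\<lambda>z. deriv_at \<sigma> (\<tau> z) v)" for v
      by (rule smooth_on_compose[OF S T im \<tau> smooth_on_deriv[OF \<sigma>]])
    show "smooth_on ?S (\<lambda>z. components M c (chart_inv c (\<tau> z)) (X (chart_inv c (\<tau> z))))"
      by (rule smooth_on_compose[OF S T im \<tau> X'])
  qed
  then show "smooth_on ?S ((\<lambda>p. components M d p (X p)) \<circ> chart_inv d)"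
  proof (rule smooth_on_cong[OF S, rotated])
    fix z
    assume "z \<in> ?S"
    then obtain p where p: "p \<in> chart_dom d" "p \<in> U" "z = chart_map d p" by blast
    then have pc: "p \<in> chart_dom c" using U(2) by blast
    show "deriv_at \<sigma> (\<tau> z) (components M c (chart_inv c (\<tau> z)) (X (chart_inv c (\<tau> z)))) =
        ((\<lambda>p. components M d p (X p)) \<circ> chart_inv d) z"
      using p pc chart_props(3)[OF M c] chart_props(3)[OF M d] components_change[OF M c d pc p(1)]
      by (simp add: \<tau>_def \<sigma>_def coord_change_def o_def)
  qed
qed

lemma smooth_field_onD:
  "smooth_field_on M U X \<Longrightarrow> c \<in> atlas M \<Longrightarrow>
    smooth_on (chart_map c ` (chart_dom c \<inter> U)) (\<lambda>z. components M c (chart_inv c z) (X (chart_inv c z)))"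
  unfolding smooth_field_on_def o_def by blast

lemma smooth_coord_field:
  assumes M: "smooth_manifold M" and c: "c \<in> atlas M"
  shows "smooth_field_on M (chart_dom c) (coord_field M c v)"
proof (rule smooth_field_on_chartI[OF M c chart_props(1)[OF M c] order_refl])
  show "smooth_on (chart_map c ` chart_dom c)
      (\<lambda>z. components M c (chart_inv c z) (coord_field M c v (chart_inv c z)))"
    by (rule smooth_on_cong[OF chart_props(2)[OF M c] _ smooth_on_const[where c = v]])
      (use chart_props(3)[OF M c] in \<open>auto simp: components_coord_field[OF M c]\<close>)
qed

section \<open>Smooth maps and their differentials in arbitrary charts\<close>

lemma smooth_map_local:
  assumes A: "smooth_manifold A" and B: "smooth_manifold B" and F: "smooth_map A B F"
    and c: "c \<in> atlas A" and d: "d \<in> atlas B"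
  shows "open (chart_map c ` (chart_dom c \<inter> F -` chart_dom d))"
    "smooth_on (chart_map c ` (chart_dom c \<inter> F -` chart_dom d)) (\<lambda>z. chart_map d (F (chart_inv c z)))"
proof -
  have "open (F -` chart_dom d)"
    using F chart_props(1)[OF B d] unfolding smooth_map_def by (simp add: continuous_on_open_vimage)
  then show "open (chart_map c ` (chart_dom c \<inter> F -` chart_dom d))" by (rule open_chart_image[OF A c])
  show "smooth_on (chart_map c ` (chart_dom c \<inter> F -` chart_dom d)) (\<lambda>z. chart_map d (F (chart_inv c z)))"
    using F c d unfolding smooth_map_def by (simp add: o_def)
qed

text \<open>Frees the differential from the preferred charts, so that it can be followed along a
  neighbourhood. Facts \<open>3\<close> and \<open>4\<close> compute the derivative of one mixed
  expression, with source chart \<open>c0\<close> and target chart \<open>d\<close>, through either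
  change of chart.\<close>

lemma tangent_map_components:
  assumes A: "smooth_manifold A" and B: "smooth_manifold B" and F: "smooth_map A B F"
    and c: "c \<in> atlas A" "p \<in> chart_dom c" and d: "d \<in> atlas B" "F p \<in> chart_dom d"
  shows "components B d (F p) (tangent_map A B F p v) =
    deriv_at (\<lambda>z. chart_map d (F (chart_inv c z))) (chart_map c p) (components A c p v)"
proof -
  define c0 where "c0 = chart_at A p"
  define d0 where "d0 = chart_at B (F p)"
  have c0: "c0 \<in> atlas A" "p \<in> chart_dom c0" and d0: "d0 \<in> atlas B" "F p \<in> chart_dom d0"
    unfolding c0_def d0_def by (simp_all add: chart_at_props A B)
  note inv0 = chart_props(3)[OF A c0]
  have dF: "((\<lambda>z. chart_map e (F (chart_inv b z))) has_derivative
      deriv_at (\<lambda>z. chart_map e (F (chart_inv b z))) (chart_map b p)) (at (chart_map b p))"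
    if "b \<in> atlas A" "p \<in> chart_dom b" "e \<in> atlas B" "F p \<in> chart_dom e" for b e
    using smooth_on_has_derivative[OF smooth_map_local(2,1)[OF A B F that(1,3)]] that by blast
  have 1: "((\<lambda>z. chart_map d (chart_inv d0 z)) has_derivative coord_change d0 d (F p))
      (at (chart_map d0 (F (chart_inv c0 (chart_map c0 p)))))"
    using coord_change_has_derivative[OF B d0(1) d(1) d0(2) d(2)] inv0 by simp
  have 2: "((\<lambda>z. chart_map d (F (chart_inv c z))) has_derivative
      deriv_at (\<lambda>z. chart_map d (F (chart_inv c z))) (chart_map c p))
      (at (chart_map c (chart_inv c0 (chart_map c0 p))))"
    using dF[OF c d] inv0 by simp
  have 3: "((\<lambda>z. chart_map d (F (chart_inv c0 z))) has_derivative
      (\<lambda>v. coord_change d0 d (F p) (tangent_map A B F p v))) (at (chart_map c0 p))"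
  proof (rule has_derivative_transform_within_open[OF diff_chain_at[OF dF[OF c0 d0] 1, unfolded o_def,
          folded tangent_map_def] smooth_map_local(1)[OF A B F c0(1) d0(1)], THEN has_derivative_eq_rhs])
    show "chart_map c0 p \<in> chart_map c0 ` (chart_dom c0 \<inter> F -` chart_dom d0)" using c0 d0 by blast
    show "chart_map d (chart_inv d0 (chart_map d0 (F (chart_inv c0 z)))) = chart_map d (F (chart_inv c0 z))"
      if "z \<in> chart_map c0 ` (chart_dom c0 \<inter> F -` chart_dom d0)" for z
      using that chart_props(3)[OF A c0(1)] chart_props(3)[OF B d0(1)] by auto
    show "(\<lambda>x. coord_change d0 d (F p) (deriv_at (\<lambda>z. chart_map d0 (F (chart_inv c0 z))) (chart_map c0 p) x)) =
        (\<lambda>v. coord_change d0 d (F p) (tangent_map A B F p v))"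
      by (simp add: tangent_map_def c0_def d0_def o_def)
  qed
  have 4: "((\<lambda>z. chart_map d (F (chart_inv c0 z))) has_derivative
      (\<lambda>v. deriv_at (\<lambda>z. chart_map d (F (chart_inv c z))) (chart_map c p) (coord_change c0 c p v)))
      (at (chart_map c0 p))"
  proof (rule has_derivative_transform_within_open[OF
        diff_chain_at[OF coord_change_has_derivative[OF A c0(1) c(1) c0(2) c(2)] 2, unfolded o_def]
        open_chart_image[OF A c0(1) chart_props(1)[OF A c(1)]]])
    show "chart_map c0 p \<in> chart_map c0 ` (chart_dom c0 \<inter> chart_dom c)" using c0 c by blast
    show "chart_map d (F (chart_inv c (chart_map c (chart_inv c0 z)))) = chart_map d (F (chart_inv c0 z))"
      if "z \<in> chart_map c0 ` (chart_dom c0 \<inter> chart_dom c)" for z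
      using that chart_props(3)[OF A c0(1)] chart_props(3)[OF A c(1)] by auto
  qed
  from has_derivative_unique[OF 3 4]
  have "coord_change d0 d (F p) (tangent_map A B F p v) =
      deriv_at (\<lambda>z. chart_map d (F (chart_inv c z))) (chart_map c p) (coord_change c0 c p v)"
    by metis
  then show ?thesis by (simp add: components_def c0_def d0_def)
qed

lemma linear_tangent_map:
  assumes A: "smooth_manifold A" and B: "smooth_manifold B" and F: "smooth_map A B F"
  shows "linear (tangent_map A B F p)"
proof -
  have "((\<lambda>z. chart_map (chart_at B (F p)) (F (chart_inv (chart_at A p) z))) has_derivative
      deriv_at (\<lambda>z. chart_map (chart_at B (F p)) (F (chart_inv (chart_at A p) z))) (chart_map (chart_at A p) p))
      (at (chart_map (chart_at A p) p))"
    by (rule smooth_on_has_derivative[OF smooth_map_local(2,1)[OF A B F chart_at_props(1)[OF A]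
          chart_at_props(1)[OF B]]])
      (use chart_at_props(2)[OF A] chart_at_props(2)[OF B] in simp)
  then show ?thesis
    unfolding tangent_map_def o_def by (rule has_derivative_linear)
qed

section \<open>Tensor fields in a chart\<close>

text \<open>Expressions of tensor fields in one fixed chart. They are functions on open subsets of
  the model space, where calculus applies; the raw fields may be discontinuous because the preferred
  chart jumps.\<close>

definition local_metric ::
  "('a, 'e::euclidean_space) manifold \<Rightarrow> ('a, 'e) chart \<Rightarrow> ('a \<Rightarrow> 'e \<Rightarrow> 'e \<Rightarrow> real) \<Rightarrow> 'e \<Rightarrow> 'e \<Rightarrow> 'e \<Rightarrow> real" where
  "local_metric M c g z u v =
     g (chart_inv c z) (coord_field M c u (chart_inv c z)) (coord_field M c v (chart_inv c z))"

definition local_form ::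
  "('a, 'e::euclidean_space) manifold \<Rightarrow> ('a, 'e) chart \<Rightarrow> ('a \<Rightarrow> 'e \<Rightarrow> real) \<Rightarrow> 'e \<Rightarrow> 'e \<Rightarrow> real" where
  "local_form M c \<eta> z v = \<eta> (chart_inv c z) (coord_field M c v (chart_inv c z))"

definition local_endomorphism ::
  "('a, 'e::euclidean_space) manifold \<Rightarrow> ('a, 'e) chart \<Rightarrow> ('a \<Rightarrow> 'e \<Rightarrow> 'e) \<Rightarrow> 'e \<Rightarrow> 'e \<Rightarrow> 'e" where
  "local_endomorphism M c \<phi> z v =
     components M c (chart_inv c z) (\<phi> (chart_inv c z) (coord_field M c v (chart_inv c z)))"

lemma riemannian_metric_inner_product: "riemannian_metric M g \<Longrightarrow> inner_product (g p)"
  unfolding riemannian_metric_def inner_product_def by blast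

lemma smooth_fun_onD:
  "smooth_fun_on M U h \<Longrightarrow> c \<in> atlas M \<Longrightarrow> smooth_on (chart_map c ` (chart_dom c \<inter> U)) (\<lambda>z. h (chart_inv c z))"
  unfolding smooth_fun_on_def o_def by blast

lemma smooth_local_metric:
  "riemannian_metric M g \<Longrightarrow> c \<in> atlas M \<Longrightarrow> smooth_on (chart_map c ` chart_dom c) (\<lambda>z. local_metric M c g z u v)"
  using smooth_fun_onD[of M "chart_dom c" "\<lambda>p. g p (coord_field M c u p) (coord_field M c v p)" c]
  unfolding riemannian_metric_def local_metric_def by simp

lemma smooth_local_form:
  "smooth_one_form M \<eta> \<Longrightarrow> c \<in> atlas M \<Longrightarrow> smooth_on (chart_map c ` chart_dom c) (\<lambda>z. local_form M c \<eta> z v)"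
  using smooth_fun_onD[of M "chart_dom c" "\<lambda>p. \<eta> p (coord_field M c v p)" c]
  unfolding smooth_one_form_def local_form_def by simp

lemma smooth_local_endomorphism:
  "smooth_endomorphism M \<phi> \<Longrightarrow> c \<in> atlas M \<Longrightarrow>
    smooth_on (chart_map c ` chart_dom c) (\<lambda>z. local_endomorphism M c \<phi> z v)"
  using smooth_field_onD[of M "chart_dom c" "\<lambda>p. \<phi> p (coord_field M c v p)" c]
  unfolding smooth_endomorphism_def local_endomorphism_def by simp

lemma bilinear_local_metric:
  assumes "smooth_manifold M" "riemannian_metric M g" "c \<in> atlas M" "z \<in> chart_map c ` chart_dom c"
  shows "bilinear (local_metric M c g z)"
proof -
  note l = linear_coord_field[OF assms(1,3) chart_props(5)[OF assms(1,3,4)]]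
  note g = riemannian_metric_inner_product[OF assms(2)]
  show ?thesis unfolding bilinear_def local_metric_def
    by (auto intro!: linearI simp: linear_add[OF l] linear_cmul[OF l] inner_product_simps[OF g])
qed

lemma linear_local_form:
  assumes "smooth_manifold M" "smooth_one_form M \<eta>" "c \<in> atlas M" "z \<in> chart_map c ` chart_dom c"
  shows "linear (local_form M c \<eta> z)"
  using linear_compose[OF linear_coord_field[OF assms(1,3) chart_props(5)[OF assms(1,3,4)]],
      of "\<eta> (chart_inv c z)"] assms(2)
  unfolding smooth_one_form_def local_form_def[abs_def] o_def by blast

lemma linear_local_endomorphism:
  assumes "smooth_manifold M" "smooth_endomorphism M \<phi>" "c \<in> atlas M" "z \<in> chart_map c ` chart_dom c"
  shows "linear (local_endomorphism M c \<phi> z)"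
proof -
  note p = chart_props(5)[OF assms(1,3,4)]
  have "linear (\<phi> (chart_inv c z))" using assms(2) by (simp add: smooth_endomorphism_def)
  from linear_compose[OF linear_compose[OF linear_coord_field[OF assms(1,3) p] this]
      linear_components[OF assms(1,3) p]]
  show ?thesis by (simp add: o_def local_endomorphism_def[abs_def])
qed

lemma metric_eq_local:
  assumes "smooth_manifold M" "c \<in> atlas M" "p \<in> chart_dom c"
  shows "g p u v = local_metric M c g (chart_map c p) (components M c p u) (components M c p v)"
    "\<eta> p u = local_form M c \<eta> (chart_map c p) (components M c p u)"
    "components M c p (\<phi> p u) = local_endomorphism M c \<phi> (chart_map c p) (components M c p u)"
  by (simp_all add: local_metric_def local_form_def local_endomorphism_def
      chart_props(3)[OF assms] components_coord_field[OF assms])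

lemma local_metric_chart_at:
  assumes "smooth_manifold M"
  shows "local_metric M (chart_at M p) g (chart_map (chart_at M p) p) = g p"
    "local_form M (chart_at M p) \<eta> (chart_map (chart_at M p) p) = \<eta> p"
  using chart_props(3)[OF assms chart_at_props(1,2)[OF assms, of p]]
  by (simp_all add: local_metric_def[abs_def] local_form_def[abs_def] coord_field_chart_at[OF assms])


section \<open>The Levi-Civita connection on coordinate fields\<close>

text \<open>The components are constant near \<open>p\<close>. Hence coordinate fields commute, and
  torsion-freeness becomes a symmetry.\<close>

lemma component_deriv_coord_field:
  assumes "smooth_manifold M"
  shows "component_deriv M X (coord_field M (chart_at M p) v) p = 0"
proof -
  define c where "c = chart_at M p"
  have c: "c \<in> atlas M" "p \<in> chart_dom c" using chart_at_props[OF assms] by (simp_all add: c_def)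
  have "((\<lambda>z. components M c (chart_inv c z) (coord_field M c v (chart_inv c z))) has_derivative (\<lambda>_. 0))
      (at (chart_map c p))"
    by (rule has_derivative_transform_within_open[OF has_derivative_const[of v]
          chart_props(2)[OF assms c(1)]])
      (use c chart_props(3)[OF assms c(1)] in \<open>auto simp: components_coord_field[OF assms c(1)]\<close>)
  from deriv_at_eqI[OF this] show ?thesis
    by (simp add: component_deriv_def o_def c_def)
qed

lemma levi_civitaD:
  assumes "levi_civita M g nab" "open U" "smooth_field_on M U X" "smooth_field_on M U Y" "p \<in> U"
  shows "nab X Y p - nab Y X p = lie_bracket M X Y p"
    "smooth_field_on M U Z \<Longrightarrow>
      dir_deriv M X (\<lambda>r. g r (Y r) (Z r)) p = g p (nab X Y p) (Z p) + g p (Y p) (nab X Z p)"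
  using assms unfolding levi_civita_def by blast+

text \<open>The classical coordinate formulas: symmetry of the Christoffel symbols, and the partial
  derivatives of the metric in terms of them.\<close>

lemma levi_civita_coord_fields:
  fixes p
  assumes M: "smooth_manifold M" and lc: "levi_civita M g nab"
  defines "c \<equiv> chart_at M p"
  shows "nab (coord_field M c u) (coord_field M c v) p = nab (coord_field M c v) (coord_field M c u) p"
    "deriv_at (\<lambda>z. local_metric M c g z u v) (chart_map c p) w =
      g p (nab (coord_field M c w) (coord_field M c u) p) v + g p u (nab (coord_field M c w) (coord_field M c v) p)"
proof -
  have c: "c \<in> atlas M" "p \<in> chart_dom c" using chart_at_props[OF M] by (simp_all add: c_def)
  note sm = smooth_coord_field[OF M c(1)]
  note lcD = levi_civitaD[OF lc chart_props(1)[OF M c(1)] sm sm c(2)]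
  show "nab (coord_field M c u) (coord_field M c v) p = nab (coord_field M c v) (coord_field M c u) p"
    using lcD(1)[of u v] by (simp add: lie_bracket_def component_deriv_coord_field[OF M] c_def)
  show "deriv_at (\<lambda>z. local_metric M c g z u v) (chart_map c p) w =
      g p (nab (coord_field M c w) (coord_field M c u) p) v + g p u (nab (coord_field M c w) (coord_field M c v) p)"
    using lcD(2)[OF sm, of w u v]
    by (simp add: dir_deriv_def o_def local_metric_def[abs_def] c_def coord_field_chart_at[OF M])
qed

text \<open>Metric compatibility for a field along \<iota>, which need not extend to an ambient
  field. Differentiating the chart metric along \<iota> yields the Christoffel terms of
  \<open>connection_along\<close>, and the product rule yields the derivatives of the
  components.\<close>

lemma connection_along_metric:
  fixes x
  assumes S: "smooth_manifold S" and M: "smooth_manifold M" and \<iota>: "smooth_map S M \<iota>"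
    and g: "riemannian_metric M g" and lc: "levi_civita M g nab"
  defines "k \<equiv> chart_at S x" and "c \<equiv> chart_at M (\<iota> x)"
  assumes V: "(\<lambda>z. components M c (\<iota> (chart_inv k z)) (V (chart_inv k z))) differentiable at (chart_map k x)"
  shows "deriv_at (\<lambda>z. g (\<iota> (chart_inv k z)) (V (chart_inv k z)) (V (chart_inv k z))) (chart_map k x) (X x) =
    2 * g (\<iota> x) (connection_along S M \<iota> nab X V x) (V x)"
proof -
  have k: "k \<in> atlas S" "x \<in> chart_dom k" and c: "c \<in> atlas M" "\<iota> x \<in> chart_dom c"
    unfolding k_def c_def using chart_at_props S M by blast+
  define O' where "O' = chart_map k ` (chart_dom k \<inter> \<iota> -` chart_dom c)"
  define F where "F = (\<lambda>z. chart_map c (\<iota> (chart_inv k z)))"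
  define W where "W = (\<lambda>z. components M c (\<iota> (chart_inv k z)) (V (chart_inv k z)))"
  have O': "open O'" "smooth_on O' F" unfolding O'_def F_def
    using smooth_map_local[OF S M \<iota> k(1) c(1)] by blast+
  have x: "chart_map k x \<in> O'" unfolding O'_def using k c by blast
  have inv: "chart_inv k (chart_map k x) = x" using chart_props(3)[OF S k] .
  have Fx: "F (chart_map k x) = chart_map c (\<iota> x)" by (simp add: F_def inv)
  have im: "F ` O' \<subseteq> chart_map c ` chart_dom c"
    unfolding O'_def F_def using chart_props(3)[OF S k(1)] by auto
  have Wx: "W (chart_map k x) = V x" by (simp add: W_def inv c_def components_chart_at[OF M])
  have dF: "(F has_derivative deriv_at F (chart_map k x)) (at (chart_map k x))"
    by (rule smooth_on_has_derivative[OF O'(2,1) x])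
  have tan: "deriv_at F (chart_map k x) = tangent_map S M \<iota> x"
    by (simp add: F_def tangent_map_def o_def k_def c_def)
  \<comment> \<open>Chain rule through \<open>F\<close>, whose derivative at the point is the
    tangent map; the ambient formula is thus read in the direction of the image of
    \<open>w\<close>.\<close>
  have dG: "((\<lambda>z. local_metric M c g (F z) u v) has_derivative
      (\<lambda>w. g (\<iota> x) (nab (coord_field M c (tangent_map S M \<iota> x w)) (coord_field M c u) (\<iota> x)) v
         + g (\<iota> x) u (nab (coord_field M c (tangent_map S M \<iota> x w)) (coord_field M c v) (\<iota> x)))) (at (chart_map k x))" for u v
  proof -
    have "((\<lambda>z. local_metric M c g z u v) has_derivative
        deriv_at (\<lambda>z. local_metric M c g z u v) (chart_map c (\<iota> x))) (at (F (chart_map k x)))"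
      unfolding Fx using c by (intro smooth_on_has_derivative[OF smooth_local_metric[OF g c(1)] chart_props(2)[OF M c(1)]]) blast
    from diff_chain_at[OF dF this] show ?thesis
      unfolding o_def tan c_def levi_civita_coord_fields(2)[OF M lc] .
  qed
  have "((\<lambda>z. local_metric M c g (F z) (W z) (W z)) has_derivative
    (\<lambda>w. deriv_at (\<lambda>z. local_metric M c g (F z) (W (chart_map k x)) (W (chart_map k x))) (chart_map k x) w
      + local_metric M c g (F (chart_map k x)) (deriv_at W (chart_map k x) w) (W (chart_map k x))
      + local_metric M c g (F (chart_map k x)) (W (chart_map k x)) (deriv_at W (chart_map k x) w))) (at (chart_map k x))"
  proof (rule has_derivative_bilinear_apply[OF O'(1) x])
    show "bilinear (local_metric M c g (F y))" if "y \<in> O'" for y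
      using that im by (intro bilinear_local_metric[OF M g c(1)]) blast
    show "(W has_derivative deriv_at W (chart_map k x)) (at (chart_map k x))"
      using V unfolding W_def by (rule has_derivative_deriv_at)
    then show "(W has_derivative deriv_at W (chart_map k x)) (at (chart_map k x))" .
  qed (rule Derivative.differentiableI[OF dG])
  then have "((\<lambda>z. g (\<iota> (chart_inv k z)) (V (chart_inv k z)) (V (chart_inv k z))) has_derivative
    (\<lambda>w. deriv_at (\<lambda>z. local_metric M c g (F z) (W (chart_map k x)) (W (chart_map k x))) (chart_map k x) w
      + local_metric M c g (F (chart_map k x)) (deriv_at W (chart_map k x) w) (W (chart_map k x))
      + local_metric M c g (F (chart_map k x)) (W (chart_map k x)) (deriv_at W (chart_map k x) w))) (at (chart_map k x))"
  proof (rule has_derivative_transform_within_open[OF _ O'(1) x])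
    fix z
    assume "z \<in> O'"
    then have "\<iota> (chart_inv k z) \<in> chart_dom c" unfolding O'_def using chart_props(3)[OF S k(1)] by auto
    from metric_eq_local(1)[OF M c(1) this, of g "V (chart_inv k z)" "V (chart_inv k z)"]
    show "local_metric M c g (F z) (W z) (W z) = g (\<iota> (chart_inv k z)) (V (chart_inv k z)) (V (chart_inv k z))"
      by (simp add: F_def W_def)
  qed
  from deriv_at_eqI[OF this]
  have "deriv_at (\<lambda>z. g (\<iota> (chart_inv k z)) (V (chart_inv k z)) (V (chart_inv k z))) (chart_map k x) (X x) =
      2 * g (\<iota> x) (nab (coord_field M c (tangent_map S M \<iota> x (X x))) (coord_field M c (V x)) (\<iota> x)) (V x)
      + 2 * g (\<iota> x) (deriv_at W (chart_map k x) (X x)) (V x)"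
    unfolding Wx Fx unfolding deriv_at_eqI[OF dG] unfolding c_def local_metric_chart_at[OF M]
    by (simp add: inner_product_commute[OF riemannian_metric_inner_product[OF g]])
  moreover have "connection_along S M \<iota> nab X V x = deriv_at W (chart_map k x) (X x)
     + nab (coord_field M c (tangent_map S M \<iota> x (X x))) (coord_field M c (V x)) (\<iota> x)"
    by (simp add: connection_along_def W_def o_def k_def c_def Let_def)
  ultimately show ?thesis
    by (simp add: inner_product_simps[OF riemannian_metric_inner_product[OF g]])
qed


section \<open>The contact form of a Kenmotsu manifold is closed\<close>

lemma almost_contact_metricD:
  assumes "almost_contact_metric M \<phi> \<xi> \<eta> g"
  shows "smooth_manifold M" "smooth_endomorphism M \<phi>" "smooth_field_on M UNIV \<xi>" "smooth_one_form M \<eta>"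
    "riemannian_metric M g" "\<eta> p (\<xi> p) = 1" "\<phi> p (\<xi> p) = 0"
    "\<phi> p (\<phi> p u) = - u + \<eta> p u *\<^sub>R \<xi> p" "\<eta> p (\<phi> p u) = 0" "g p u (\<xi> p) = \<eta> p u"
    "g p u v = g p (\<phi> p u) (\<phi> p v) + \<eta> p u * \<eta> p v" "g p u (\<phi> p v) = - g p (\<phi> p u) v"
  using assms unfolding almost_contact_metric_def by blast+

lemma kenmotsuD:
  assumes "kenmotsu M \<phi> \<xi> \<eta> g nab"
  shows "almost_contact_metric M \<phi> \<xi> \<eta> g" "levi_civita M g nab"
    "open U \<Longrightarrow> smooth_field_on M U X \<Longrightarrow> smooth_field_on M U Y \<Longrightarrow> p \<in> U \<Longrightarrow>
      nab X (\<lambda>r. \<phi> r (Y r)) p - \<phi> p (nab X Y p) =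
      g p (\<phi> p (X p)) (Y p) *\<^sub>R \<xi> p - \<eta> p (Y p) *\<^sub>R \<phi> p (X p)"
  using assms unfolding kenmotsu_def by blast+

lemma smooth_field_on_zero: "smooth_manifold M \<Longrightarrow> open U \<Longrightarrow> smooth_field_on M U (\<lambda>_. 0)"
  unfolding smooth_field_on_def
proof
  fix c
  assume M: "smooth_manifold M" and U: "open U" and c: "c \<in> atlas M"
  show "smooth_on (chart_map c ` (chart_dom c \<inter> U)) ((\<lambda>p. components M c p 0) \<circ> chart_inv c)"
    by (rule smooth_on_cong[OF open_chart_image[OF M c U] _ smooth_on_const[where c = 0]])
      (use chart_props(3)[OF M c] in \<open>auto simp: linear_0[OF linear_components[OF M c]]\<close>)
qed

text \<open>The Kenmotsu identity at \<open>Y = \<xi>\<close> gives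
  \<open>\<phi> (nab X \<xi>) = \<phi> X\<close>, because \<open>\<phi> \<xi> = 0\<close>. Applying
  \<phi> once more recovers \<open>nab X \<xi>\<close> up to its \<xi>-component, and that component
  vanishes since \<xi> has constant length.\<close>

lemma kenmotsu_nab_xi:
  assumes K: "kenmotsu M \<phi> \<xi> \<eta> g nab" and U: "open U" "p \<in> U" and X: "smooth_field_on M U X"
  shows "nab X \<xi> p = X p - \<eta> p (X p) *\<^sub>R \<xi> p"
proof -
  note ac = almost_contact_metricD[OF kenmotsuD(1)[OF K]]
  note lc = kenmotsuD(2)[OF K]
  note ip = riemannian_metric_inner_product[OF ac(5)]
  have \<xi>: "smooth_field_on M U \<xi>" using ac(3) by (rule smooth_field_on_subset) simp
  have z: "smooth_field_on M U (\<lambda>_. 0)" by (rule smooth_field_on_zero[OF ac(1) U(1)])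
  have "affine_connection M nab" using lc by (simp add: levi_civita_def)
  \<comment> \<open>Additivity on \<open>0 + 0\<close> shows that the connection sends the zero
    field to zero; the field \<open>\<phi> \<xi>\<close> is of this kind.\<close>
  then have "nab X (\<lambda>r. (\<lambda>_. 0) r + (\<lambda>_. 0) r) p = nab X (\<lambda>_. 0) p + nab X (\<lambda>_. 0) p"
    using U X z unfolding affine_connection_def by blast
  then have n0: "nab X (\<lambda>_. 0) p = 0" by simp
  have "\<phi> p (nab X \<xi> p) = \<phi> p (X p)"
    using kenmotsuD(3)[OF K U(1) X \<xi> U(2)] by (simp add: ac(6,7,9,10) n0)
  then have "\<phi> p (\<phi> p (nab X \<xi> p)) = \<phi> p (\<phi> p (X p))" by simp
  moreover have "\<eta> p (nab X \<xi> p) = 0"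
  proof -
    have "g p (nab X \<xi> p) (\<xi> p) + g p (\<xi> p) (nab X \<xi> p) = 0"
      using levi_civitaD(2)[OF lc U(1) X \<xi> U(2) \<xi>] by (simp add: ac(6,10) dir_deriv_def o_def)
    then show ?thesis by (simp add: ac(10) inner_product_commute[OF ip, of p "\<xi> p"])
  qed
  ultimately show ?thesis by (simp add: ac(8) algebra_simps)
qed

text \<open>Differentiating \<open>\<eta> E = g(E, \<xi>)\<close> for a coordinate field
  \<open>E\<close> and inserting \<open>nab X \<xi>\<close> leaves a covariant derivative of
  coordinate fields and the terms \<open>g u v - \<eta> u * \<eta> v\<close>, all symmetric in the
  two directions.\<close>

lemma kenmotsu_form_closed:
  fixes p
  assumes K: "kenmotsu M \<phi> \<xi> \<eta> g nab"
  defines "c \<equiv> chart_at M p"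
  shows "deriv_at (\<lambda>z. local_form M c \<eta> z v) (chart_map c p) u = deriv_at (\<lambda>z. local_form M c \<eta> z u) (chart_map c p) v"
proof -
  note ac = almost_contact_metricD[OF kenmotsuD(1)[OF K]]
  note lc = kenmotsuD(2)[OF K]
  note ip = riemannian_metric_inner_product[OF ac(5)]
  have c: "c \<in> atlas M" "p \<in> chart_dom c" using chart_at_props[OF ac(1)] by (simp_all add: c_def)
  note sm = smooth_coord_field[OF ac(1) c(1)]
  note o = chart_props(1)[OF ac(1) c(1)]
  have \<xi>: "smooth_field_on M (chart_dom c) \<xi>" using ac(3) by (rule smooth_field_on_subset) simp
  have "deriv_at (\<lambda>z. local_form M c \<eta> z v) (chart_map c p) u =
      \<eta> p (nab (coord_field M c u) (coord_field M c v) p) + g p u v - \<eta> p u * \<eta> p v" for u v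
    using levi_civitaD(2)[OF lc o sm sm c(2) \<xi>, of u v]
    by (simp add: ac(10) dir_deriv_def o_def local_form_def[abs_def] kenmotsu_nab_xi[OF K o c(2) sm, unfolded c_def]
        c_def coord_field_chart_at[OF ac(1)] inner_product_simps[OF ip] inner_product_commute[OF ip, of p v u])
  then show ?thesis
    using levi_civita_coord_fields(1)[OF ac(1) lc, of p u v] inner_product_commute[OF ip, of p v u]
    by (simp add: c_def)
qed

text \<open>Pullback commutes with the exterior derivative because second derivatives are symmetric.\<close>

lemma kenmotsu_pullback_form_closed:
  fixes x
  assumes K: "kenmotsu M \<phi> \<xi> \<eta> g nab" and S: "smooth_manifold S" and \<iota>: "smooth_map S M \<iota>"
  defines "k \<equiv> chart_at S x"
  defines "a \<equiv> \<lambda>z u. \<eta> (\<iota> (chart_inv k z)) (tangent_map S M \<iota> (chart_inv k z) (coord_field S k u (chart_inv k z)))"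
  shows "deriv_at (\<lambda>z. a z u) (chart_map k x) v = deriv_at (\<lambda>z. a z v) (chart_map k x) u"
    "(\<lambda>z. a z u) differentiable at (chart_map k x)"
proof -
  note ac = almost_contact_metricD[OF kenmotsuD(1)[OF K]]
  note M = ac(1)
  define c where "c = chart_at M (\<iota> x)"
  have k: "k \<in> atlas S" "x \<in> chart_dom k" and c: "c \<in> atlas M" "\<iota> x \<in> chart_dom c"
    unfolding k_def c_def using chart_at_props S M by blast+
  define O' where "O' = chart_map k ` (chart_dom k \<inter> \<iota> -` chart_dom c)"
  define F where "F = (\<lambda>z. chart_map c (\<iota> (chart_inv k z)))"
  define p where "p = chart_map k x"
  have O': "open O'" "smooth_on O' F" unfolding O'_def F_def
    using smooth_map_local[OF S M \<iota> k(1) c(1)] by blast+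
  have x: "p \<in> O'" unfolding O'_def p_def using k c by blast
  have Fx: "F p = chart_map c (\<iota> x)" by (simp add: F_def p_def chart_props(3)[OF S k])
  have im: "F ` O' \<subseteq> chart_map c ` chart_dom c"
    unfolding O'_def F_def using chart_props(3)[OF S k(1)] by auto
  have dF: "(F has_derivative deriv_at F p) (at p)"
    by (rule smooth_on_has_derivative[OF O'(2,1) x])
  have dE: "((\<lambda>z. local_form M c \<eta> (F z) u) has_derivative
      (\<lambda>w. deriv_at (\<lambda>z. local_form M c \<eta> z u) (F p) (deriv_at F p w))) (at p)" for u
  proof -
    have "((\<lambda>z. local_form M c \<eta> z u) has_derivative
        deriv_at (\<lambda>z. local_form M c \<eta> z u) (F p)) (at (F p))"
      unfolding Fx using c by (intro smooth_on_has_derivative[OF smooth_local_form[OF ac(4) c(1)] chart_props(2)[OF M c(1)]]) blast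
    from diff_chain_at[OF dF this] show ?thesis unfolding o_def .
  qed
  have a: "a z u = local_form M c \<eta> (F z) (deriv_at F z u)" if z: "z \<in> O'" for z u
  proof -
    have i: "chart_inv k z \<in> chart_dom k" "\<iota> (chart_inv k z) \<in> chart_dom c" "chart_map k (chart_inv k z) = z"
      using z unfolding O'_def using chart_props(3)[OF S k(1)] by auto
    show ?thesis
      unfolding a_def metric_eq_local(2)[OF M c(1) i(2)] tangent_map_components[OF S M \<iota> k(1) i(1) c(1) i(2)]
      by (simp add: components_coord_field[OF S k(1) i(1)] i(3) F_def)
  qed
  have da: "((\<lambda>z. a z u) has_derivative (\<lambda>w. deriv_at (\<lambda>z. local_form M c \<eta> z (deriv_at F p u)) (F p) (deriv_at F p w)
      + local_form M c \<eta> (F p) (deriv_at (\<lambda>z. deriv_at F z u) p w))) (at p)" for u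
  proof -
    have "((\<lambda>z. local_form M c \<eta> (F z) (deriv_at F z u)) has_derivative
      (\<lambda>w. deriv_at (\<lambda>z. local_form M c \<eta> (F z) (deriv_at F p u)) p w
        + local_form M c \<eta> (F p) (deriv_at (\<lambda>z. deriv_at F z u) p w))) (at p)"
    proof (rule has_derivative_linear_apply[OF O'(1) x])
      show "linear (local_form M c \<eta> (F z))" if "z \<in> O'" for z
        using that im by (intro linear_local_form[OF M ac(4) c(1)]) blast
      show "((\<lambda>z. deriv_at F z u) has_derivative deriv_at (\<lambda>z. deriv_at F z u) p) (at p)"
        by (rule smooth_on_has_derivative[OF smooth_on_deriv[OF O'(2)] O'(1) x])
    qed (rule Derivative.differentiableI[OF dE])
    then show ?thesis
      unfolding deriv_at_eqI[OF dE]
      by (rule has_derivative_transform_within_open[OF _ O'(1) x]) (simp add: a)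
  qed
  then show "(\<lambda>z. a z u) differentiable at (chart_map k x)"
    unfolding p_def by (rule Derivative.differentiableI)
  have "Ck_on 2 O' F" using O'(2) by (simp add: smooth_on_def)
  \<comment> \<open>Of the two summands in \<open>da\<close>, the first is symmetric by closedness
    at \<open>\<iota> x\<close>, the second by Schwarz's theorem.\<close>
  from second_derivative_symmetric[OF O'(1) x this, of u v]
  show "deriv_at (\<lambda>z. a z u) (chart_map k x) v = deriv_at (\<lambda>z. a z v) (chart_map k x) u"
    using kenmotsu_form_closed[OF K, of "\<iota> x" "deriv_at F p u" "deriv_at F p v"]
    unfolding p_def[symmetric] deriv_at_eqI[OF da] Fx c_def by simp
qed

section \<open>Product manifolds and warped metrics\<close>

lemma prod_chart_simps:
  "chart_dom (prod_chart c d) = chart_dom c \<times> chart_dom d"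
  "chart_map (prod_chart c d) (p, q) = (chart_map c p, chart_map d q)"
  by (simp_all add: prod_chart_def)

lemma prod_manifold_atlas: "c \<in> atlas A \<Longrightarrow> d \<in> atlas B \<Longrightarrow> prod_chart c d \<in> atlas (prod_manifold A B)"
  by (auto simp: prod_manifold_def)

lemma prod_manifold_chart_at:
  "chart_at (prod_manifold A B) (p, q) = prod_chart (chart_at A p) (chart_at B q)"
  by (simp add: prod_manifold_def)

context
  fixes A :: "('a::{t2_space,second_countable_topology}, 'e::euclidean_space) manifold"
    and B :: "('b::{t2_space,second_countable_topology}, 'f::euclidean_space) manifold"
  assumes A: "smooth_manifold A" and B: "smooth_manifold B"
    and AB: "smooth_manifold (prod_manifold A B)"
begin

text \<open>The Jacobian between product charts is block diagonal, so horizontal and vertical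
  vectors keep their meaning in every product chart.\<close>

lemma coord_change_prod:
  assumes c: "c \<in> atlas A" "c' \<in> atlas A" "p \<in> chart_dom c" "p \<in> chart_dom c'"
    and d: "d \<in> atlas B" "d' \<in> atlas B" "q \<in> chart_dom d" "q \<in> chart_dom d'"
  shows "coord_change (prod_chart c d) (prod_chart c' d') (p, q) (u, v) =
    (coord_change c c' p u, coord_change d d' q v)"
proof -
  define k where "k = prod_chart c d"
  define k' where "k' = prod_chart c' d'"
  have k: "k \<in> atlas (prod_manifold A B)" "(p, q) \<in> chart_dom k"
    and k': "k' \<in> atlas (prod_manifold A B)" "(p, q) \<in> chart_dom k'"
    using c d by (simp_all add: k_def k'_def prod_manifold_atlas prod_chart_simps)
  have fst': "(fst has_derivative fst) (at z)" and snd': "(snd has_derivative snd) (at z)" for z :: "'e \<times> 'f"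
    by (intro bounded_linear_imp_has_derivative bounded_linear_fst bounded_linear_snd)+
  have 1: "((\<lambda>z. chart_map c' (chart_inv c z)) has_derivative coord_change c c' p) (at (fst (chart_map k (p, q))))"
    and 2: "((\<lambda>z. chart_map d' (chart_inv d z)) has_derivative coord_change d d' q) (at (snd (chart_map k (p, q))))"
    using coord_change_has_derivative[OF A c] coord_change_has_derivative[OF B d]
    by (simp_all add: k_def prod_chart_simps)
  from has_derivative_Pair[OF diff_chain_at[OF fst' 1] diff_chain_at[OF snd' 2]]
  have "((\<lambda>z. (chart_map c' (chart_inv c (fst z)), chart_map d' (chart_inv d (snd z)))) has_derivative
      (\<lambda>w. (coord_change c c' p (fst w), coord_change d d' q (snd w)))) (at (chart_map k (p, q)))"
    by (simp add: o_def)
  then have "((\<lambda>z. chart_map k' (chart_inv k z)) has_derivative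
      (\<lambda>w. (coord_change c c' p (fst w), coord_change d d' q (snd w)))) (at (chart_map k (p, q)))"
  proof (rule has_derivative_transform_within_open[OF _ chart_props(2)[OF AB k(1)]])
    show "chart_map k (p, q) \<in> chart_map k ` chart_dom k" using k by blast
    fix z
    assume "z \<in> chart_map k ` chart_dom k"
    then obtain r s where rs: "r \<in> chart_dom c" "s \<in> chart_dom d" "z = chart_map k (r, s)"
      by (auto simp: k_def prod_chart_simps)
    then have "chart_inv k z = (r, s)"
      using chart_props(3)[OF AB k(1), of "(r, s)"] by (simp add: k_def prod_chart_simps)
    then show "(chart_map c' (chart_inv c (fst z)), chart_map d' (chart_inv d (snd z))) = chart_map k' (chart_inv k z)"
      using rs chart_props(3)[OF A c(1)] chart_props(3)[OF B d(1)]
      by (simp add: k_def k'_def prod_chart_simps)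
  qed
  from has_derivative_unique[OF coord_change_has_derivative[OF AB k(1) k'(1) k(2) k'(2)] this]
  show ?thesis unfolding k_def k'_def by simp
qed

lemma coord_field_prod:
  assumes "c \<in> atlas A" "p \<in> chart_dom c" "d \<in> atlas B" "q \<in> chart_dom d"
  shows "coord_field (prod_manifold A B) (prod_chart c d) (u, v) (p, q) = (coord_field A c u p, coord_field B d v q)"
  using assms by (simp add: coord_field_def prod_manifold_chart_at coord_change_prod chart_at_props A B)

lemma components_prod:
  assumes "c \<in> atlas A" "p \<in> chart_dom c" "d \<in> atlas B" "q \<in> chart_dom d"
  shows "components (prod_manifold A B) (prod_chart c d) (p, q) v = (components A c p (fst v), components B d q (snd v))"
  using assms
  by (cases v) (simp add: components_def prod_manifold_chart_at coord_change_prod chart_at_props A B)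

text \<open>\<open>component_deriv\<close> sees only the value of its direction field at the point,
  so with constant direction fields it packages the whole Frechet derivative of the
  components.\<close>

lemma components_deriv:
  assumes U: "open U" "x \<in> U" and Z: "smooth_field_on (prod_manifold A B) U Z"
  defines "k \<equiv> chart_at (prod_manifold A B) x"
  shows "((\<lambda>z. components (prod_manifold A B) k (chart_inv k z) (Z (chart_inv k z))) has_derivative
      (\<lambda>w. component_deriv (prod_manifold A B) (\<lambda>_. w) Z x)) (at (chart_map k x))"
proof -
  have k: "k \<in> atlas (prod_manifold A B)" "x \<in> chart_dom k" using chart_at_props[OF AB] by (simp_all add: k_def)
  have "((\<lambda>z. components (prod_manifold A B) k (chart_inv k z) (Z (chart_inv k z))) has_derivative
      deriv_at (\<lambda>z. components (prod_manifold A B) k (chart_inv k z) (Z (chart_inv k z))) (chart_map k x)) (at (chart_map k x))"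
    using k U by (intro smooth_on_has_derivative[OF smooth_field_onD[OF Z k(1)] open_chart_image[OF AB k(1) U(1)]]) blast
  moreover have "deriv_at (\<lambda>z. components (prod_manifold A B) k (chart_inv k z) (Z (chart_inv k z))) (chart_map k x) =
     (\<lambda>w. component_deriv (prod_manifold A B) (\<lambda>_. w) Z x)"
    by (simp add: component_deriv_def o_def k_def)
  ultimately show ?thesis by simp
qed

lemma component_deriv_pointwise:
  "component_deriv (prod_manifold A B) X Z x = component_deriv (prod_manifold A B) (\<lambda>_. X x) Z x"
  by (simp add: component_deriv_def)

lemma component_deriv_horizontal:
  assumes U: "open U" "x \<in> U" and Z: "smooth_field_on (prod_manifold A B) U Z"
  shows "(\<And>y. y \<in> U \<Longrightarrow> snd (Z y) = 0) \<Longrightarrow> snd (component_deriv (prod_manifold A B) X Z x) = 0"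
    "(\<And>y. y \<in> U \<Longrightarrow> fst (Z y) = 0) \<Longrightarrow> fst (component_deriv (prod_manifold A B) X Z x) = 0"
proof -
  obtain p q where pq: "x = (p, q)" by (cases x)
  define c where "c = chart_at A p"
  define d where "d = chart_at B q"
  define k where "k = chart_at (prod_manifold A B) x"
  have kk: "k = prod_chart c d" by (simp add: k_def pq prod_manifold_chart_at c_def d_def)
  have k: "k \<in> atlas (prod_manifold A B)" "x \<in> chart_dom k" using chart_at_props[OF AB] by (simp_all add: k_def)
  have c: "c \<in> atlas A" and d: "d \<in> atlas B" using chart_at_props A B by (simp_all add: c_def d_def)
  note o = open_chart_image[OF AB k(1) U(1)]
  have x: "chart_map k x \<in> chart_map k ` (chart_dom k \<inter> U)" using k U by blast
  have comp: "\<exists>r s. r \<in> chart_dom c \<and> s \<in> chart_dom d \<and> (r, s) \<in> U \<and> chart_inv k z = (r, s)"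
    if "z \<in> chart_map k ` (chart_dom k \<inter> U)" for z
    using that chart_props(3)[OF AB k(1)] by (auto simp: kk prod_chart_simps)
  define w where "w = X x"
  note D = components_deriv[OF U Z, folded k_def]
  show "snd (component_deriv (prod_manifold A B) X Z x) = 0" if h: "\<And>y. y \<in> U \<Longrightarrow> snd (Z y) = 0"
  proof -
    have "((\<lambda>z. 0) has_derivative (\<lambda>w. snd (component_deriv (prod_manifold A B) (\<lambda>_. w) Z x))) (at (chart_map k x))"
    proof (rule has_derivative_transform_within_open[OF has_derivative_snd[OF D] o x])
      fix z
      assume "z \<in> chart_map k ` (chart_dom k \<inter> U)"
      from comp[OF this] obtain r s where rs: "r \<in> chart_dom c" "s \<in> chart_dom d" "(r, s) \<in> U" "chart_inv k z = (r, s)"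
        by blast
      show "snd (components (prod_manifold A B) k (chart_inv k z) (Z (chart_inv k z))) = 0"
        by (simp add: components_prod[OF c rs(1) d rs(2)] h[OF rs(3)] rs(4)[unfolded kk] kk linear_0[OF linear_components[OF B d rs(2)]])
    qed
    from has_derivative_unique[OF this has_derivative_const] show ?thesis
      by (subst component_deriv_pointwise) metis
  qed
  show "fst (component_deriv (prod_manifold A B) X Z x) = 0" if h: "\<And>y. y \<in> U \<Longrightarrow> fst (Z y) = 0"
  proof -
    have "((\<lambda>z. 0) has_derivative (\<lambda>w. fst (component_deriv (prod_manifold A B) (\<lambda>_. w) Z x))) (at (chart_map k x))"
    proof (rule has_derivative_transform_within_open[OF has_derivative_fst[OF D] o x])
      fix z
      assume "z \<in> chart_map k ` (chart_dom k \<inter> U)"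
      from comp[OF this] obtain r s where rs: "r \<in> chart_dom c" "s \<in> chart_dom d" "(r, s) \<in> U" "chart_inv k z = (r, s)"
        by blast
      show "fst (components (prod_manifold A B) k (chart_inv k z) (Z (chart_inv k z))) = 0"
        by (simp add: components_prod[OF c rs(1) d rs(2)] h[OF rs(3)] rs(4)[unfolded kk] kk linear_0[OF linear_components[OF A c rs(1)]])
    qed
    from has_derivative_unique[OF this has_derivative_const] show ?thesis
      by (subst component_deriv_pointwise) metis
  qed
qed

text \<open>The warping function and the first factor's metric do not vary along the second factor.\<close>

lemma warped_metric_vertical_deriv:
  assumes g1: "riemannian_metric A g1" and g2: "riemannian_metric B g2"
    and U: "open U" "x \<in> U"
    and Z: "smooth_field_on (prod_manifold A B) U Z" "\<And>y. y \<in> U \<Longrightarrow> snd (Z y) = 0"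
    and W: "smooth_field_on (prod_manifold A B) U W" "\<And>y. y \<in> U \<Longrightarrow> snd (W y) = 0"
    and X: "fst (X x) = 0"
  shows "dir_deriv (prod_manifold A B) X (\<lambda>r. warped_metric g1 f g2 r (Z r) (W r)) x =
    warped_metric g1 f g2 x (component_deriv (prod_manifold A B) X Z x) (W x) +
    warped_metric g1 f g2 x (Z x) (component_deriv (prod_manifold A B) X W x)"
    "(\<lambda>z. warped_metric g1 f g2 (chart_inv (chart_at (prod_manifold A B) x) z)
        (Z (chart_inv (chart_at (prod_manifold A B) x) z)) (W (chart_inv (chart_at (prod_manifold A B) x) z)))
      differentiable at (chart_map (chart_at (prod_manifold A B) x) x)"
proof -
  obtain p q where pq: "x = (p, q)" by (cases x)
  define c where "c = chart_at A p"
  define d where "d = chart_at B q"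
  define k where "k = chart_at (prod_manifold A B) x"
  have kk: "k = prod_chart c d" by (simp add: k_def pq prod_manifold_chart_at c_def d_def)
  have k: "k \<in> atlas (prod_manifold A B)" "x \<in> chart_dom k" using chart_at_props[OF AB] by (simp_all add: k_def)
  have c: "c \<in> atlas A" "p \<in> chart_dom c" and d: "d \<in> atlas B" using chart_at_props A B by (simp_all add: c_def d_def)
  define T where "T = chart_map k ` (chart_dom k \<inter> U)"
  have T: "open T" unfolding T_def by (rule open_chart_image[OF AB k(1) U(1)])
  have x: "chart_map k x \<in> T" unfolding T_def using k U by blast
  have cx: "chart_map k x = (chart_map c p, chart_map d q)" by (simp add: kk pq prod_chart_simps)
  have TT: "fst z \<in> chart_map c ` chart_dom c" if "z \<in> T" for z
    using that by (auto simp: T_def kk prod_chart_simps)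
  note ip1 = riemannian_metric_inner_product[OF g1] and ip2 = riemannian_metric_inner_product[OF g2]
  define \<zeta> where "\<zeta> = (\<lambda>z. components (prod_manifold A B) k (chart_inv k z) (Z (chart_inv k z)))"
  define \<omega> where "\<omega> = (\<lambda>z. components (prod_manifold A B) k (chart_inv k z) (W (chart_inv k z)))"
  have \<zeta>x: "\<zeta> (chart_map k x) = Z x" and \<omega>x: "\<omega> (chart_map k x) = W x"
    by (simp_all add: \<zeta>_def \<omega>_def chart_props(3)[OF AB k] components_chart_at[OF AB, of x, folded k_def])
  have fst': "(fst has_derivative fst) (at z)" for z :: "'e \<times> 'f"
    by (intro bounded_linear_imp_has_derivative bounded_linear_fst)
  have dL: "((\<lambda>z. local_metric A c g1 (fst z) u v) has_derivative
      (\<lambda>w. deriv_at (\<lambda>z. local_metric A c g1 z u v) (chart_map c p) (fst w))) (at (chart_map k x))" for u v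
  proof -
    have "((\<lambda>z. local_metric A c g1 z u v) has_derivative
        deriv_at (\<lambda>z. local_metric A c g1 z u v) (chart_map c p)) (at (fst (chart_map k x)))"
      unfolding cx fst_conv
      by (rule smooth_on_has_derivative[OF smooth_local_metric[OF g1 c(1)] chart_props(2)[OF A c(1)]]) (use c in blast)
    from diff_chain_at[OF fst' this] show ?thesis by (simp add: o_def)
  qed
  have "((\<lambda>z. local_metric A c g1 (fst z) (fst (\<zeta> z)) (fst (\<omega> z))) has_derivative
    (\<lambda>w. deriv_at (\<lambda>z. local_metric A c g1 (fst z) (fst (\<zeta> (chart_map k x))) (fst (\<omega> (chart_map k x)))) (chart_map k x) w
      + local_metric A c g1 (fst (chart_map k x)) (fst (component_deriv (prod_manifold A B) (\<lambda>_. w) Z x)) (fst (\<omega> (chart_map k x)))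
      + local_metric A c g1 (fst (chart_map k x)) (fst (\<zeta> (chart_map k x))) (fst (component_deriv (prod_manifold A B) (\<lambda>_. w) W x))))
    (at (chart_map k x))"
  proof (rule has_derivative_bilinear_apply[OF T x])
    show "bilinear (local_metric A c g1 (fst z))" if "z \<in> T" for z
      by (rule bilinear_local_metric[OF A g1 c(1) TT[OF that]])
    show "((\<lambda>z. fst (\<zeta> z)) has_derivative (\<lambda>w. fst (component_deriv (prod_manifold A B) (\<lambda>_. w) Z x))) (at (chart_map k x))"
      "((\<lambda>z. fst (\<omega> z)) has_derivative (\<lambda>w. fst (component_deriv (prod_manifold A B) (\<lambda>_. w) W x))) (at (chart_map k x))"
      unfolding \<zeta>_def \<omega>_def k_def
      by (intro has_derivative_fst components_deriv[OF U Z(1)] components_deriv[OF U W(1)])+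
  qed (rule Derivative.differentiableI[OF dL])
  \<comment> \<open>On horizontal vectors the warped term vanishes, so the metric reduces to
    \<open>g1\<close>, evaluated on first components and depending on the first coordinate
    only.\<close>
  then have H: "((\<lambda>z. warped_metric g1 f g2 (chart_inv k z) (Z (chart_inv k z)) (W (chart_inv k z))) has_derivative
    (\<lambda>w. deriv_at (\<lambda>z. local_metric A c g1 z (fst (Z x)) (fst (W x))) (chart_map c p) (fst w)
      + g1 p (fst (component_deriv (prod_manifold A B) (\<lambda>_. w) Z x)) (fst (W x))
      + g1 p (fst (Z x)) (fst (component_deriv (prod_manifold A B) (\<lambda>_. w) W x)))) (at (chart_map k x))"
    unfolding \<zeta>x \<omega>x deriv_at_eqI[OF dL] unfolding cx fst_conv unfolding c_def local_metric_chart_at[OF A]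
    unfolding c_def[symmetric] cx[symmetric]
  proof (rule has_derivative_transform_within_open[OF _ T x])
    fix z
    assume "z \<in> T"
    then obtain r s where rs: "r \<in> chart_dom c" "s \<in> chart_dom d" "(r, s) \<in> U" "chart_inv k z = (r, s)" "z = (chart_map c r, chart_map d s)"
      unfolding T_def using chart_props(3)[OF AB k(1)] by (auto simp: kk prod_chart_simps)
    have "fst (\<zeta> z) = components A c r (fst (Z (r, s)))" "fst (\<omega> z) = components A c r (fst (W (r, s)))"
      by (simp_all add: components_prod[OF c(1) rs(1) d rs(2)] \<zeta>_def \<omega>_def rs(4)[unfolded kk] kk)
    then show "local_metric A c g1 (fst z) (fst (\<zeta> z)) (fst (\<omega> z)) =
        warped_metric g1 f g2 (chart_inv k z) (Z (chart_inv k z)) (W (chart_inv k z))"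
      by (simp add: rs(5) rs(4)[unfolded rs(5)] warped_metric_def Z(2)[OF rs(3)] W(2)[OF rs(3)] inner_product_simps[OF ip2]
          metric_eq_local(1)[OF A c(1) rs(1), of g1])
  qed
  from Derivative.differentiableI[OF H]
  show "(\<lambda>z. warped_metric g1 f g2 (chart_inv (chart_at (prod_manifold A B) x) z)
        (Z (chart_inv (chart_at (prod_manifold A B) x) z)) (W (chart_inv (chart_at (prod_manifold A B) x) z)))
      differentiable at (chart_map (chart_at (prod_manifold A B) x) x)"
    unfolding k_def .
  from deriv_at_eqI[OF H]
  have "dir_deriv (prod_manifold A B) X (\<lambda>r. warped_metric g1 f g2 r (Z r) (W r)) x =
      deriv_at (\<lambda>z. local_metric A c g1 z (fst (Z x)) (fst (W x))) (chart_map c p) (fst (X x))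
      + g1 p (fst (component_deriv (prod_manifold A B) (\<lambda>_. X x) Z x)) (fst (W x))
      + g1 p (fst (Z x)) (fst (component_deriv (prod_manifold A B) (\<lambda>_. X x) W x))"
    by (simp add: dir_deriv_def o_def k_def[symmetric])
  \<comment> \<open>The first summand is evaluated at \<open>fst (X x) = 0\<close> and drops out by
    linearity.\<close>
  moreover have "linear (deriv_at (\<lambda>z. local_metric A c g1 z (fst (Z x)) (fst (W x))) (chart_map c p))"
    by (rule smooth_on_linear_deriv[OF smooth_local_metric[OF g1 c(1)] chart_props(2)[OF A c(1)]]) (use c in blast)
  ultimately show "dir_deriv (prod_manifold A B) X (\<lambda>r. warped_metric g1 f g2 r (Z r) (W r)) x =
    warped_metric g1 f g2 x (component_deriv (prod_manifold A B) X Z x) (W x) +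
    warped_metric g1 f g2 x (Z x) (component_deriv (prod_manifold A B) X W x)"
    by (simp add: X[unfolded pq] linear_0 warped_metric_def pq inner_product_simps[OF ip2] Z(2)[OF U(2), unfolded pq]
        W(2)[OF U(2), unfolded pq] component_deriv_pointwise[of X])
qed

text \<open>Koszul's formula for \<open>g(nab X Z, W)\<close> with \<open>W\<close> a horizontal coordinate field.\<close>

lemma warped_connection_horizontal:
  assumes g1: "riemannian_metric A g1" and g2: "riemannian_metric B g2"
    and lc: "levi_civita (prod_manifold A B) (warped_metric g1 f g2) nab"
    and U: "open U" "x \<in> U"
    and X: "smooth_field_on (prod_manifold A B) U X" "\<And>y. y \<in> U \<Longrightarrow> fst (X y) = 0"
    and Z: "smooth_field_on (prod_manifold A B) U Z" "\<And>y. y \<in> U \<Longrightarrow> snd (Z y) = 0"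
  shows "fst (nab X Z x) = fst (component_deriv (prod_manifold A B) X Z x)"
proof -
  define S where "S = prod_manifold A B"
  define h where "h = warped_metric g1 f g2"
  obtain p q where pq: "x = (p, q)" by (cases x)
  define c where "c = chart_at A p"
  define d where "d = chart_at B q"
  define k where "k = chart_at S x"
  have kk: "k = prod_chart c d" by (simp add: k_def S_def pq prod_manifold_chart_at c_def d_def)
  have k: "k \<in> atlas S" "x \<in> chart_dom k" using chart_at_props[OF AB] by (simp_all add: k_def S_def)
  have c: "c \<in> atlas A" and d: "d \<in> atlas B" using chart_at_props A B by (simp_all add: c_def d_def)
  \<comment> \<open>The test vector is the discrepancy itself, so the final identity states that its
    \<open>g1\<close>-norm is zero. Taking the coordinate field through it makes every coordinate
    derivative of \<open>W\<close> vanish at \<open>x\<close>.\<close>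
  define w where "w = fst (nab X Z x) - fst (component_deriv S X Z x)"
  define W where "W = coord_field S k (w, 0)"
  define V where "V = U \<inter> chart_dom k"
  have V: "open V" "x \<in> V" "V \<subseteq> U" "V \<subseteq> chart_dom k"
    unfolding V_def using U k chart_props(1)[OF AB k(1)[unfolded S_def]] by auto
  have sX: "smooth_field_on S V X" and sZ: "smooth_field_on S V Z"
    using X(1) Z(1) V(3) smooth_field_on_subset unfolding S_def by blast+
  have sW: "smooth_field_on S V W" unfolding W_def
    using smooth_field_on_subset[OF smooth_coord_field[OF AB k(1)[unfolded S_def]] V(4)] unfolding S_def .
  have hX: "fst (X y) = 0" and hZ: "snd (Z y) = 0" and hW: "snd (W y) = 0" if "y \<in> V" for y
  proof -
    show "fst (X y) = 0" "snd (Z y) = 0" using that V(3) X(2) Z(2) by blast+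
    obtain r s where rs: "y = (r, s)" by (cases y)
    have "r \<in> chart_dom c" "s \<in> chart_dom d" using that V(4) by (auto simp: rs kk prod_chart_simps)
    then show "snd (W y) = 0"
      using coord_field_prod[OF c _ d, of r s w 0] linear_0[OF linear_coord_field[OF B d, of s]]
      by (simp add: W_def S_def rs kk)
  qed
  have Wx: "W x = (w, 0)" unfolding W_def k_def S_def by (rule coord_field_chart_at[OF AB])
  note ip1 = riemannian_metric_inner_product[OF g1] and ip2 = riemannian_metric_inner_product[OF g2]
  have h_add: "h y (u + v) z = h y u z + h y v z" "h y z (u + v) = h y z u + h y z v"
    "h y (u - v) z = h y u z - h y v z" "h y z (u - v) = h y z u - h y z v" "h y (- u) z = - h y u z" "h y u v = h y v u"
    for y u v z
    by (simp_all add: h_def warped_metric_def inner_product_simps[OF ip1] inner_product_simps[OF ip2] algebra_simps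
        inner_product_commute[OF ip1, of _ "fst u" "fst v"] inner_product_commute[OF ip2, of _ "snd u" "snd v"])
  have h_orth: "h y u v = 0" if "fst u = 0" "snd v = 0" for y u v
    using that by (simp add: h_def warped_metric_def inner_product_simps[OF ip1] inner_product_simps[OF ip2])
  note lc' = lc[folded S_def h_def]
  \<comment> \<open>A vertical and a horizontal field are orthogonal on all of \<open>V\<close>, so
    their inner product is locally constant.\<close>
  have dzero: "dir_deriv S Y (\<lambda>r. h r (X r) (Y' r)) x = 0" if "\<And>y. y \<in> V \<Longrightarrow> snd (Y' y) = 0" for Y Y'
  proof -
    have "((\<lambda>z. h (chart_inv k z) (X (chart_inv k z)) (Y' (chart_inv k z))) has_derivative (\<lambda>_. 0)) (at (chart_map k x))"
    proof (rule has_derivative_transform_within_open[OF has_derivative_const[of 0]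
          open_chart_image[OF AB k(1)[unfolded S_def] V(1)]])
      show "chart_map k x \<in> chart_map k ` (chart_dom k \<inter> V)" using V k by blast
      show "0 = h (chart_inv k z) (X (chart_inv k z)) (Y' (chart_inv k z))"
        if z: "z \<in> chart_map k ` (chart_dom k \<inter> V)" for z
      proof -
        obtain y where "y \<in> chart_dom k" "y \<in> V" "z = chart_map k y" using z by blast
        then show ?thesis
          using h_orth[OF hX \<open>\<And>y. y \<in> V \<Longrightarrow> snd (Y' y) = 0\<close>]
          by (simp add: chart_props(3)[OF AB k(1)[unfolded S_def]])
      qed
    qed
    from deriv_at_eqI[OF this] show ?thesis by (simp add: dir_deriv_def o_def k_def)
  qed
  have sym: "dir_deriv S Y (\<lambda>r. h r (X r) (Y' r)) x = h x (nab Y X x) (Y' x) + h x (X x) (nab Y Y' x)"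
    if "smooth_field_on S V Y" "smooth_field_on S V Y'" for Y Y'
    using levi_civitaD(2)[OF lc' V(1) that(1) sX V(2) that(2)] .
  have 1: "dir_deriv S X (\<lambda>r. h r (Z r) (W r)) x = h x (nab X Z x) (W x) + h x (Z x) (nab X W x)"
    by (rule levi_civitaD(2)[OF lc' V(1) sX sZ V(2) sW])
  have 2: "h x (nab Z X x) (W x) + h x (X x) (nab Z W x) = 0"
    using sym[OF sZ sW] dzero[of W Z] hW by simp
  have 3: "h x (nab W X x) (Z x) + h x (X x) (nab W Z x) = 0"
    using sym[OF sW sZ] dzero[of Z W] hZ by simp
  have t1: "nab X Z x = nab Z X x + lie_bracket S X Z x"
    using levi_civitaD(1)[OF lc' V(1) sX sZ V(2)] by (simp add: algebra_simps)
  have t2: "nab X W x = nab W X x + lie_bracket S X W x"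
    using levi_civitaD(1)[OF lc' V(1) sX sW V(2)] by (simp add: algebra_simps)
  have t3: "nab Z W x = nab W Z x + lie_bracket S Z W x"
    using levi_civitaD(1)[OF lc' V(1) sZ sW V(2)] by (simp add: algebra_simps)
  have CW: "component_deriv S Y W x = 0" for Y
    unfolding W_def k_def S_def by (rule component_deriv_coord_field[OF AB])
  have CX: "fst (component_deriv S Y X x) = 0" for Y
    using component_deriv_horizontal(2)[OF V(1,2) sX[unfolded S_def] hX] by (simp add: S_def)
  have CZ: "snd (component_deriv S Y Z x) = 0" for Y
    using component_deriv_horizontal(1)[OF V(1,2) sZ[unfolded S_def] hZ] by (simp add: S_def)
  have b1: "h x (lie_bracket S X Z x) (W x) = h x (component_deriv S X Z x) (W x)"
    by (simp add: lie_bracket_def h_add(3) h_orth[OF CX] Wx)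
  have b2: "h x (lie_bracket S X W x) (Z x) = 0"
    by (rule h_orth) (simp_all add: lie_bracket_def CW CX hZ[OF V(2)])
  have b3: "h x (X x) (lie_bracket S Z W x) = 0"
    by (rule h_orth) (simp_all add: lie_bracket_def CW CZ hX[OF V(2)])
  have 4: "dir_deriv S X (\<lambda>r. h r (Z r) (W r)) x = h x (component_deriv S X Z x) (W x)"
    using warped_metric_vertical_deriv(1)[OF g1 g2 V(1,2) sZ[unfolded S_def] hZ sW[unfolded S_def] hW, of X f]
      hX[OF V(2)] CW[of X] h_add(3)[of x "0" "0" "Z x"] h_add(6)[of x "Z x" 0]
    by (simp add: S_def h_def)
  \<comment> \<open>Put \<open>s = h(nab Z X, W)\<close> and
    \<open>C = component_deriv S X Z x\<close>. Facts \<open>2\<close>, \<open>3\<close>,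
    \<open>t3\<close>, \<open>b3\<close> give \<open>h(nab W X, Z) = s\<close> as well. Torsion
    (\<open>t1\<close>, \<open>b1\<close>) gives \<open>h(nab X Z, W) = h(C, W) + s\<close>, while
    compatibility (\<open>1\<close>, \<open>4\<close>, \<open>t2\<close>, \<open>b2\<close>) gives
    \<open>h(C, W) = h(nab X Z, W) + s\<close>; hence \<open>s = 0\<close>.\<close>
  have "h x (nab X Z x) (W x) = h x (component_deriv S X Z x) (W x)"
    using 1 2 3 4 b1 b2 b3 t1 t2 t3 by (simp add: h_add(1,2) h_add(6)[of x "Z x"])
  then have "h x (nab X Z x - component_deriv S X Z x) (w, 0) = 0" by (simp add: h_add(3) Wx)
  then have "g1 p w w = 0"
    by (simp add: h_def warped_metric_def pq w_def inner_product_simps(8)[OF ip2])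
  then show ?thesis by (simp add: inner_product_eq_0[OF ip1] w_def S_def)
qed

end

section \<open>The tangential and normal parts of \<open>\<phi>\<close>\<close>

text \<open>Two nested descriptions are resolved: orthogonality fixes the projection, injectivity of
  the differential fixes its preimage.\<close>

lemma T_part_eqI:
  assumes b: "inner_product (g (\<iota> x))" and L: "linear (tangent_map S M \<iota> x)" "inj (tangent_map S M \<iota> x)"
    and t: "\<And>u. g (\<iota> x) (\<phi> (\<iota> x) (tangent_map S M \<iota> x v) - tangent_map S M \<iota> x t) (tangent_map S M \<iota> x u) = 0"
  shows "T_part S M \<iota> g \<phi> x v = t"
proof -
  have "orth_proj (g (\<iota> x)) (tangent_image S M \<iota> x) (\<phi> (\<iota> x) (tangent_map S M \<iota> x v)) = tangent_map S M \<iota> x t"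
    unfolding tangent_image_def by (rule orth_proj_eqI[OF b subspace_range_linear[OF L(1)]]) (use t in auto)
  then show ?thesis unfolding T_part_def using L(2) by (auto simp: inj_eq)
qed

lemma T_part_N_part:
  assumes b: "inner_product (g (\<iota> x))" and L: "linear (tangent_map S M \<iota> x)" "inj (tangent_map S M \<iota> x)"
  shows "g (\<iota> x) (\<phi> (\<iota> x) (tangent_map S M \<iota> x v) - tangent_map S M \<iota> x (T_part S M \<iota> g \<phi> x v)) (tangent_map S M \<iota> x u) = 0"
    "N_part S M \<iota> g \<phi> x v = \<phi> (\<iota> x) (tangent_map S M \<iota> x v) - tangent_map S M \<iota> x (T_part S M \<iota> g \<phi> x v)"
proof -
  obtain t where t: "orth_proj (g (\<iota> x)) (range (tangent_map S M \<iota> x)) (\<phi> (\<iota> x) (tangent_map S M \<iota> x v)) = tangent_map S M \<iota> x t"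
    "\<And>u. g (\<iota> x) (\<phi> (\<iota> x) (tangent_map S M \<iota> x v) - tangent_map S M \<iota> x t) (tangent_map S M \<iota> x u) = 0"
    using orth_proj_range[OF b L] by blast
  have "T_part S M \<iota> g \<phi> x v = t" by (rule T_part_eqI[of g \<iota> x S M \<phi> v t, OF b L t(2)])
  then show "g (\<iota> x) (\<phi> (\<iota> x) (tangent_map S M \<iota> x v) - tangent_map S M \<iota> x (T_part S M \<iota> g \<phi> x v)) (tangent_map S M \<iota> x u) = 0"
    "N_part S M \<iota> g \<phi> x v = \<phi> (\<iota> x) (tangent_map S M \<iota> x v) - tangent_map S M \<iota> x (T_part S M \<iota> g \<phi> x v)"
    using t by (simp_all add: N_part_def normal_part_def tangent_image_def)
qed

text \<open>The sum of the tangential parts satisfies the orthogonality that characterises the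
  tangential part of the sum. Used to polarise the norm formula and to split
  \<open>nabS X Z\<close>.\<close>

lemma N_part_add:
  assumes b: "inner_product (g (\<iota> x))" and L: "linear (tangent_map S M \<iota> x)" "inj (tangent_map S M \<iota> x)"
    and \<phi>: "linear (\<phi> (\<iota> x))"
  shows "N_part S M \<iota> g \<phi> x (u + v) = N_part S M \<iota> g \<phi> x u + N_part S M \<iota> g \<phi> x v"
proof -
  note TN = T_part_N_part[of g, OF b L]
  have "T_part S M \<iota> g \<phi> x (u + v) = T_part S M \<iota> g \<phi> x u + T_part S M \<iota> g \<phi> x v"
  proof (rule T_part_eqI[of g, OF b L])
    fix w
    show "g (\<iota> x) (\<phi> (\<iota> x) (tangent_map S M \<iota> x (u + v)) -
        tangent_map S M \<iota> x (T_part S M \<iota> g \<phi> x u + T_part S M \<iota> g \<phi> x v)) (tangent_map S M \<iota> x w) = 0"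
      using TN(1)[of \<phi> u w] TN(1)[of \<phi> v w]
      by (simp add: linear_add[OF L(1)] linear_add[OF \<phi>] inner_product_simps[OF b])
  qed
  then show ?thesis by (simp add: TN(2) linear_add[OF L(1)] linear_add[OF \<phi>])
qed

text \<open>The discarded projection is tangent while \<open>n\<close> is normal; so, paired with
  \<open>N Z\<close>, the normal connection may be replaced by the full ambient one.\<close>

lemma normal_part_inner:
  assumes b: "inner_product (g (\<iota> x))" and L: "linear (tangent_map S M \<iota> x)" "inj (tangent_map S M \<iota> x)"
    and n: "\<And>u. g (\<iota> x) n (tangent_map S M \<iota> x u) = 0"
  shows "g (\<iota> x) (normal_part S M \<iota> g x w) n = g (\<iota> x) w n"
proof -
  obtain t where "orth_proj (g (\<iota> x)) (range (tangent_map S M \<iota> x)) w = tangent_map S M \<iota> x t"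
    using orth_proj_range[OF b L] by blast
  then show ?thesis
    using n[of t] by (simp add: normal_part_def tangent_image_def inner_product_simps[OF b]
        inner_product_commute[OF b, of _ n])
qed

lemma inner_product_local_metric:
  assumes M: "smooth_manifold M" and g: "riemannian_metric M g" and c: "c \<in> atlas M" and z: "z \<in> chart_map c ` chart_dom c"
  shows "inner_product (local_metric M c g z)"
proof -
  note p = chart_props(5)[OF M c z]
  note ip = riemannian_metric_inner_product[OF g]
  have "coord_field M c u (chart_inv c z) \<noteq> 0" if "u \<noteq> 0" for u
    using components_coord_field(1)[OF M c p, of u] that linear_0[OF linear_components[OF M c p]] by metis
  then show ?thesis
    using bilinear_local_metric[OF M g c z] ip unfolding inner_product_def local_metric_def by blast
qed

text \<open>In coordinates the tangential part solves the linear system with the Gram matrix of the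
  coordinate frame of the submanifold, so it is smooth.\<close>

lemma T_part_smooth:
  assumes SM: "submanifold S M \<iota>" and g: "riemannian_metric M g" and \<phi>: "smooth_endomorphism M \<phi>"
    and k: "k \<in> atlas S" and c: "c \<in> atlas M"
    and V: "open V" "V \<subseteq> chart_dom k" "\<iota> ` V \<subseteq> chart_dom c" and Z: "smooth_field_on S V Z"
  shows "smooth_field_on S V (\<lambda>y. T_part S M \<iota> g \<phi> y (Z y))"
    "smooth_on (chart_map k ` V) (\<lambda>z. components M c (\<iota> (chart_inv k z)) (N_part S M \<iota> g \<phi> (chart_inv k z) (Z (chart_inv k z))))"
proof -
  have S: "smooth_manifold S" and M: "smooth_manifold M" and \<iota>: "smooth_map S M \<iota>"
    and inj: "\<And>y. inj (tangent_map S M \<iota> y)"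
    using SM unfolding submanifold_def by auto
  define D where "D = chart_map k ` V"
  have "chart_map k ` V = chart_map k ` (chart_dom k \<inter> V)" using V(2) by (simp add: Int_absorb1)
  then have D: "open D" using open_chart_image[OF S k V(1)] by (simp add: D_def)
  define F where "F = (\<lambda>z. chart_map c (\<iota> (chart_inv k z)))"
  have sF: "smooth_on D F" unfolding F_def D_def
    by (rule smooth_on_subset[OF smooth_map_local(2)[OF S M \<iota> k c]]) (use V in blast)
  have im: "F ` D \<subseteq> chart_map c ` chart_dom c"
  proof (rule image_subsetI)
    fix z
    assume "z \<in> D"
    then obtain y where y: "y \<in> V" "z = chart_map k y" by (auto simp: D_def)
    have "y \<in> chart_dom k" "\<iota> y \<in> chart_dom c" using V(2,3) y(1) by blast+
    then show "F z \<in> chart_map c ` chart_dom c" by (simp add: F_def y(2) chart_props(3)[OF S k])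
  qed
  define G where "G = (\<lambda>z. local_metric M c g (F z))"
  define \<Phi> where "\<Phi> = (\<lambda>z. local_endomorphism M c \<phi> (F z))"
  define \<zeta> where "\<zeta> = (\<lambda>z. components S k (chart_inv k z) (Z (chart_inv k z)))"
  define \<tau> where "\<tau> = (\<lambda>z. components S k (chart_inv k z) (T_part S M \<iota> g \<phi> (chart_inv k z) (Z (chart_inv k z))))"
  define L where "L = deriv_at F"
  note o = chart_props(2)[OF M c]
  have sG: "smooth_on D (\<lambda>z. G z u v)" for u v
    unfolding G_def by (rule smooth_on_compose[OF D o im sF smooth_local_metric[OF g c]])
  have s\<Phi>: "smooth_on D (\<lambda>z. \<Phi> z u)" for u
    unfolding \<Phi>_def by (rule smooth_on_compose[OF D o im sF smooth_local_endomorphism[OF \<phi> c]])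
  have sL: "smooth_on D (\<lambda>z. L z u)" for u unfolding L_def by (rule smooth_on_deriv[OF sF])
  have s\<zeta>: "smooth_on D \<zeta>"
    using smooth_field_onD[OF Z k] V(2) by (simp add: \<zeta>_def D_def Int_absorb1)
  have lL: "linear (L z)" and l\<Phi>: "linear (\<Phi> z)" and ipG: "inner_product (G z)" if "z \<in> D" for z
  proof -
    have Fz: "F z \<in> chart_map c ` chart_dom c" using that im by blast
    show "linear (L z)" unfolding L_def by (rule smooth_on_linear_deriv[OF sF D that])
    show "linear (\<Phi> z)" unfolding \<Phi>_def by (rule linear_local_endomorphism[OF M \<phi> c Fz])
    show "inner_product (G z)" unfolding G_def by (rule inner_product_local_metric[OF M g c Fz])
  qed
  have pt: "chart_inv k z \<in> V" "chart_inv k z \<in> chart_dom k" "\<iota> (chart_inv k z) \<in> chart_dom c" "chart_map k (chart_inv k z) = z"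
    if z: "z \<in> D" for z
  proof -
    obtain y where y: "y \<in> V" "z = chart_map k y" using z by (auto simp: D_def)
    have "y \<in> chart_dom k" "\<iota> y \<in> chart_dom c" using V(2,3) y(1) by blast+
    then show "chart_inv k z \<in> V" "chart_inv k z \<in> chart_dom k" "\<iota> (chart_inv k z) \<in> chart_dom c" "chart_map k (chart_inv k z) = z"
      using y chart_props(3)[OF S k] by simp_all
  qed
  have tan: "components M c (\<iota> (chart_inv k z)) (tangent_map S M \<iota> (chart_inv k z) v) = L z (components S k (chart_inv k z) v)"
    if "z \<in> D" for z v
    using tangent_map_components[OF S M \<iota> k pt(2)[OF that] c pt(3)[OF that]]
    by (simp add: L_def F_def pt(4)[OF that])
  have gG: "g (\<iota> (chart_inv k z)) u v = G z (components M c (\<iota> (chart_inv k z)) u) (components M c (\<iota> (chart_inv k z)) v)"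
    and phi: "components M c (\<iota> (chart_inv k z)) (\<phi> (\<iota> (chart_inv k z)) u) = \<Phi> z (components M c (\<iota> (chart_inv k z)) u)"
    if "z \<in> D" for z u v
    using metric_eq_local(1,3)[OF M c pt(3)[OF that]] by (simp_all add: G_def \<Phi>_def F_def)
  \<comment> \<open>The immersion property read in charts; it makes the Gram matrix invertible at
    every point of \<open>D\<close>.\<close>
  have injL: "inj (L z)" if "z \<in> D" for z
    unfolding linear_injective_0[OF lL[OF that]]
  proof (intro allI impI)
    fix u
    assume "L z u = 0"
    then have "components M c (\<iota> (chart_inv k z)) (tangent_map S M \<iota> (chart_inv k z) (coord_field S k u (chart_inv k z))) = 0"
      by (simp add: tan[OF that] components_coord_field[OF S k pt(2)[OF that]])
    then have "tangent_map S M \<iota> (chart_inv k z) (coord_field S k u (chart_inv k z)) = 0"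
      by (metis components_coord_field(2)[OF M c pt(3)[OF that]] linear_0[OF linear_coord_field[OF M c pt(3)[OF that]]])
    then have "coord_field S k u (chart_inv k z) = 0"
      using inj linear_tangent_map[OF S M \<iota>] by (simp add: linear_injective_0)
    then show "u = 0"
      by (metis components_coord_field(1)[OF S k pt(2)[OF that]] linear_0[OF linear_components[OF S k pt(2)[OF that]]])
  qed
  have sLf: "smooth_on D (\<lambda>z. L z (u z))" if "smooth_on D u" for u
    by (rule smooth_on_linear_apply[OF D lL sL that])
  have sgram: "smooth_on D (\<lambda>z. gram (G z) (L z) (w z))" if "smooth_on D w" for w
    unfolding gram_def
  proof (intro smooth_on_sum smooth_on_scaleR D finite_Basis smooth_on_const)
    show "smooth_on D (\<lambda>z. G z (w z) (L z i))" for i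
      by (rule smooth_on_bilinear_apply[OF D _ sG that sL]) (use ipG in \<open>simp add: inner_product_def\<close>)
  qed
  have s\<tau>: "smooth_on D \<tau>"
  proof (rule smooth_on_linear_solution[where A = "\<lambda>z t. gram (G z) (L z) (L z t)" and b = "\<lambda>z. gram (G z) (L z) (\<Phi> z (L z (\<zeta> z)))", OF D])
    show "linear (\<lambda>t. gram (G z) (L z) (L z t))" if "z \<in> D" for z
      using linear_compose[OF lL[OF that] linear_gram[OF ipG[OF that]]] by (simp add: o_def)
    show "v = 0" if "z \<in> D" "gram (G z) (L z) (L z v) = 0" for z v
      using gram_nondegenerate[OF ipG lL injL] that by blast
    show "smooth_on D (\<lambda>z. gram (G z) (L z) (L z v))" for v by (rule sgram[OF sL])
    show "smooth_on D (\<lambda>z. gram (G z) (L z) (\<Phi> z (L z (\<zeta> z))))"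
      by (rule sgram[OF smooth_on_linear_apply[OF D l\<Phi> s\<Phi> sLf[OF s\<zeta>]]])
    fix z
    assume z: "z \<in> D"
    show "gram (G z) (L z) (L z (\<tau> z)) = gram (G z) (L z) (\<Phi> z (L z (\<zeta> z)))"
    proof (rule vector_eq_rdot[THEN iffD1], intro allI)
      fix u
      have "G z (\<Phi> z (L z (\<zeta> z)) - L z (\<tau> z)) (L z u) = 0"
        using T_part_N_part(1)[of g, OF riemannian_metric_inner_product[OF g] linear_tangent_map[OF S M \<iota>] inj,
            of "chart_inv k z" \<phi> "Z (chart_inv k z)" "coord_field S k u (chart_inv k z)"]
        unfolding gG[OF z] linear_diff[OF linear_components[OF M c pt(3)[OF z]]] phi[OF z] tan[OF z]
          components_coord_field(1)[OF S k pt(2)[OF z]]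
        by (simp add: \<zeta>_def \<tau>_def)
      then show "gram (G z) (L z) (L z (\<tau> z)) \<bullet> u = gram (G z) (L z) (\<Phi> z (L z (\<zeta> z))) \<bullet> u"
        by (simp add: gram_inner[OF ipG[OF z] lL[OF z]] inner_product_simps[OF ipG[OF z]])
    qed
  qed
  show "smooth_field_on S V (\<lambda>y. T_part S M \<iota> g \<phi> y (Z y))"
    by (rule smooth_field_on_chartI[OF S k V(1,2)]) (use s\<tau> in \<open>simp add: \<tau>_def D_def\<close>)
  \<comment> \<open>The normal part as \<phi> minus the tangential part, in ambient components; the
    difference is written so that closure under sums and scalar products applies.\<close>
  have "smooth_on D (\<lambda>z. \<Phi> z (L z (\<zeta> z)) + - 1 *\<^sub>R L z (\<tau> z))"
    by (intro smooth_on_add[OF D] smooth_on_scaleR[OF D] smooth_on_const sLf[OF s\<tau>]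
        smooth_on_linear_apply[OF D l\<Phi> s\<Phi> sLf[OF s\<zeta>]])
  then show "smooth_on (chart_map k ` V) (\<lambda>z. components M c (\<iota> (chart_inv k z)) (N_part S M \<iota> g \<phi> (chart_inv k z) (Z (chart_inv k z))))"
    unfolding D_def[symmetric]
  proof (rule smooth_on_cong[OF D, rotated])
    fix z
    assume z: "z \<in> D"
    show "\<Phi> z (L z (\<zeta> z)) + - 1 *\<^sub>R L z (\<tau> z) =
        components M c (\<iota> (chart_inv k z)) (N_part S M \<iota> g \<phi> (chart_inv k z) (Z (chart_inv k z)))"
      unfolding T_part_N_part(2)[of g, OF riemannian_metric_inner_product[OF g] linear_tangent_map[OF S M \<iota>] inj]
        linear_diff[OF linear_components[OF M c pt(3)[OF z]]] phi[OF z] tan[OF z]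
      by (simp add: \<zeta>_def \<tau>_def)
  qed
qed


section \<open>Slant distributions\<close>

text \<open>Here \<open>t\<close> is the projection of \<open>\<phi> v\<close> to the whole tangent
  space \<open>R\<close>, whereas the slant angle refers to \<open>D2\<close>. The two projections
  agree for \<open>v = w + a *\<^sub>R \<xi>\<close> with \<open>w\<close> in \<open>D2\<close>:
  then \<open>\<phi> v = \<phi> w\<close>, which is orthogonal to \<open>D1\<close> and to \<xi>.
  The angle now gives the tangential length, and Pythagoras the normal one.\<close>

lemma semi_slant_pointwise:
  fixes b :: "'e::euclidean_space \<Rightarrow> 'e \<Rightarrow> real"
  assumes b: "inner_product b" and \<phi>: "linear \<phi>" "\<And>u. \<eta> (\<phi> u) = 0" "\<And>u. b u \<xi> = \<eta> u" "\<phi> \<xi> = 0" "\<eta> \<xi> = 1"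
    and met: "\<And>u v. b u v = b (\<phi> u) (\<phi> v) + \<eta> u * \<eta> v"
    and D: "subspace D1" "subspace D2" "R = span (D1 \<union> D2 \<union> {\<xi>})"
    and orth: "\<And>u v. u \<in> D1 \<Longrightarrow> v \<in> D2 \<Longrightarrow> b u v = 0" "\<And>u. u \<in> D1 \<union> D2 \<Longrightarrow> b u \<xi> = 0"
    and inv: "\<phi> ` D1 = D1" and slant: "\<And>w. w \<in> D2 \<Longrightarrow> w \<noteq> 0 \<Longrightarrow> subspace_angle b (\<phi> w) D2 = \<theta>"
    and t: "t \<in> R" "\<And>u. u \<in> R \<Longrightarrow> b (\<phi> v - t) u = 0"
  shows "v \<in> D1 \<Longrightarrow> t = \<phi> v"
    "v \<in> span (D2 \<union> {\<xi>}) \<Longrightarrow> t \<in> D2"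
    "v \<in> span (D2 \<union> {\<xi>}) \<Longrightarrow> b (\<phi> v - t) (\<phi> v - t) = (sin \<theta>)\<^sup>2 * (b v v - (\<eta> v)\<^sup>2)"
proof -
  note ip = inner_product_simps[OF b]
  note com = inner_product_commute[OF b]
  have subR: "D1 \<subseteq> R" "D2 \<subseteq> R" "\<xi> \<in> R" unfolding D(3) by (auto intro: span_base)
  have sR: "subspace R" unfolding D(3) by simp
  show "t = \<phi> v" if "v \<in> D1"
  proof -
    have "\<phi> v - t \<in> R" using that inv subR(1) t(1) sR by (auto intro: subspace_diff)
    from t(2)[OF this] show ?thesis by (simp add: inner_product_eq_0[OF b])
  qed
  assume v: "v \<in> span (D2 \<union> {\<xi>})"
  obtain w a where w: "w \<in> D2" "v = w + a *\<^sub>R \<xi>"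
    using v D(2) unfolding span_Un by (auto simp: span_singleton span_eq_iff[THEN iffD2])
  have \<eta>w: "\<eta> w = 0" using orth(2)[of w] w(1) \<phi>(3) by simp
  have \<phi>v: "\<phi> v = \<phi> w" by (simp add: w(2) linear_add[OF \<phi>(1)] linear_cmul[OF \<phi>(1)] \<phi>(4))
  obtain d1 d2 e where d: "d1 \<in> D1" "d2 \<in> D2" "t = d1 + d2 + e *\<^sub>R \<xi>"
    using t(1) D(1,2) unfolding D(3) span_Un by (auto simp: span_singleton span_eq_iff[THEN iffD2])
  \<comment> \<open>Every vector of \<open>D1\<close> has the form \<open>\<phi> d'\<close>, and
    since \<open>\<eta> w = 0\<close> the metric identity reduces the claim to orthogonality of
    \<open>D1\<close> and \<open>D2\<close>.\<close>
  have "b (\<phi> w) d1 = 0"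
  proof -
    obtain d' where d': "d' \<in> D1" "d1 = \<phi> d'" using inv d(1) by blast
    then show ?thesis using met[of w d'] orth(1)[OF d'(1) w(1)] by (simp add: \<eta>w com)
  qed
  moreover have "b (\<phi> w - t) d1 = 0" using t(2)[of d1] subR(1) d(1) by (auto simp: \<phi>v)
  ultimately have "b d1 d1 = 0"
    using orth(1)[OF d(1,2)] orth(2)[of d1] d(1) by (simp add: ip d(3) com[of d2 d1] com[of \<xi> d1])
  then have d1: "d1 = 0" by (simp add: inner_product_eq_0[OF b])
  have "b (\<phi> w - t) \<xi> = 0" using t(2)[OF subR(3)] by (simp add: \<phi>v)
  then have e: "e = 0"
    using orth(2)[of d1] orth(2)[of d2] d \<phi>(2)[of w] \<phi>(3)[of "\<phi> w"] \<phi>(3)[of \<xi>] \<phi>(5) by (simp add: ip d(3))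
  have td: "t = d2" by (simp add: d(3) d1 e)
  then show "t \<in> D2" using d(2) by simp
  have p: "b (\<phi> w - d2) u = 0" if "u \<in> D2" for u
    using t(2)[of u] that subR(2) by (auto simp: \<phi>v td)
  have pyth: "b (\<phi> w - d2) (\<phi> w - d2) = b w w - b d2 d2"
    using p[OF d(2)] met[of w w] by (simp add: ip \<eta>w com[of d2 "\<phi> w"])
  have proj: "orth_proj b D2 (\<phi> w) = d2" by (rule orth_proj_eqI[OF b D(2) d(2) p])
  have bv: "b v v - (\<eta> v)\<^sup>2 = b w w"
  proof -
    have "\<eta> v = a" using \<phi>(3)[of v] orth(2)[of w] w \<phi>(3)[of \<xi>] \<phi>(5) by (simp add: ip)
    moreover have "b v v = b w w + a\<^sup>2"
      using orth(2)[of w] w(1) \<phi>(3)[of \<xi>] \<phi>(5) by (simp add: w(2) ip com[of \<xi> w] power2_eq_square)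
    ultimately show ?thesis by simp
  qed
  have main: "b d2 d2 = (cos \<theta>)\<^sup>2 * b w w"
  proof (cases "w = 0")
    case True
    then have "b (\<phi> w) d2 = 0" by (simp add: linear_0[OF \<phi>(1)] ip)
    then show ?thesis using p[OF d(2)] True by (simp add: ip)
  next
    case False
    have pos: "b w w > 0" using False b by (simp add: inner_product_def)
    have le: "b d2 d2 \<le> b w w" using inner_product_nonneg[OF b, of "\<phi> w - d2"] pyth by simp
    have ge: "b d2 d2 \<ge> 0" by (rule inner_product_nonneg[OF b])
    have ww: "b (\<phi> w) (\<phi> w) = b w w" using met[of w w] by (simp add: \<eta>w)
    define r where "r = sqrt (b d2 d2) / sqrt (b w w)"
    have "arccos r = \<theta>"
      using slant[OF w(1) False] by (simp add: subspace_angle_def proj ww r_def)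
    \<comment> \<open>Inverting \<open>arccos\<close> needs this range; the upper bound says that a
      projection does not increase length, which comes from \<open>pyth\<close>.\<close>
    moreover have "- 1 \<le> r" "r \<le> 1"
      using le ge pos by (auto simp: r_def intro: order_trans[of _ 0])
    ultimately have "cos \<theta> = sqrt (b d2 d2) / sqrt (b w w)" using cos_arccos[of r] by (simp add: r_def)
    then show ?thesis using pos ge by (simp add: power_divide)
  qed
  show "b (\<phi> v - t) (\<phi> v - t) = (sin \<theta>)\<^sup>2 * (b v v - (\<eta> v)\<^sup>2)"
    unfolding bv \<phi>v td pyth main by (simp add: sin_squared_eq algebra_simps)
qed

section \<open>Warped product semi-slant submanifolds\<close>

context
  fixes M :: "('a::{t2_space,second_countable_topology}, 'e::euclidean_space) manifold"
    and N\<theta> :: "('b::{t2_space,second_countable_topology}, 'f::euclidean_space) manifold"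
    and NT :: "('c::{t2_space,second_countable_topology}, 'h::euclidean_space) manifold"
    and S :: "('b \<times> 'c, 'f \<times> 'h) manifold" and \<iota> :: "'b \<times> 'c \<Rightarrow> 'a"
    and g :: "'a \<Rightarrow> 'e \<Rightarrow> 'e \<Rightarrow> real" and \<phi> :: "'a \<Rightarrow> 'e \<Rightarrow> 'e"
    and \<xi> :: "'a \<Rightarrow> 'e" and \<eta> :: "'a \<Rightarrow> 'e \<Rightarrow> real"
    and nab :: "('a \<Rightarrow> 'e) \<Rightarrow> ('a \<Rightarrow> 'e) \<Rightarrow> 'a \<Rightarrow> 'e"
    and nabS :: "('b \<times> 'c \<Rightarrow> 'f \<times> 'h) \<Rightarrow> ('b \<times> 'c \<Rightarrow> 'f \<times> 'h) \<Rightarrow> 'b \<times> 'c \<Rightarrow> 'f \<times> 'h"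
    and g\<theta> :: "'b \<Rightarrow> 'f \<Rightarrow> 'f \<Rightarrow> real" and gT :: "'c \<Rightarrow> 'h \<Rightarrow> 'h \<Rightarrow> real"
    and f :: "'b \<Rightarrow> real" and \<theta> :: real and D1 D2 :: "'b \<times> 'c \<Rightarrow> 'e set"
  assumes S_eq: "S = prod_manifold N\<theta> NT"
    and K: "kenmotsu M \<phi> \<xi> \<eta> g nab"
    and wp: "warped_product_submanifold N\<theta> NT M \<iota> g g\<theta> f gT"
    and lcS: "levi_civita S (induced_metric S M \<iota> g) nabS"
    and ss: "semi_slant_submanifold S M \<iota> \<phi> \<xi> g D1 D2 \<theta>"
    and imT: "\<And>y. tangent_map S M \<iota> y ` ({0} \<times> UNIV) = D1 y"
    and im\<theta>: "\<And>y. tangent_map S M \<iota> y ` (UNIV \<times> {0}) = span (D2 y \<union> {\<xi> (\<iota> y)})"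
begin

lemmas contact = almost_contact_metricD[OF kenmotsuD(1)[OF K]]
lemmas ambient_inner_product = riemannian_metric_inner_product[OF contact(5)]

lemma warped_facts: "smooth_manifold N\<theta>" "smooth_manifold NT" "riemannian_metric N\<theta> g\<theta>" "riemannian_metric NT gT"
    "submanifold S M \<iota>" "smooth_manifold S" "smooth_map S M \<iota>"
    "induced_metric S M \<iota> g = warped_metric g\<theta> f gT"
  using wp unfolding warped_product_submanifold_def S_eq submanifold_def by blast+

lemma linear_tangent: "linear (tangent_map S M \<iota> y)"
  by (rule linear_tangent_map[OF warped_facts(6) contact(1) warped_facts(7)])

lemma inj_tangent: "inj (tangent_map S M \<iota> y)"
  using warped_facts(5) unfolding submanifold_def by blast

lemma linear_\<phi>: "linear (\<phi> p)"
  using contact(2) unfolding smooth_endomorphism_def by blast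

lemma linear_\<eta>: "linear (\<eta> p)"
  using contact(4) unfolding smooth_one_form_def by blast

lemmas tangential_normal = T_part_N_part[of g, OF ambient_inner_product linear_tangent inj_tangent]

text \<open>Translates between the factors of the product and the distributions; the last direction
  rests on injectivity of the differential.\<close>

lemma tangent_splitting:
  "fst v = 0 \<Longrightarrow> tangent_map S M \<iota> y v \<in> D1 y"
  "snd v = 0 \<Longrightarrow> tangent_map S M \<iota> y v \<in> span (D2 y \<union> {\<xi> (\<iota> y)})"
  "tangent_map S M \<iota> y v \<in> span (D2 y \<union> {\<xi> (\<iota> y)}) \<Longrightarrow> snd v = 0"
proof -
  show "fst v = 0 \<Longrightarrow> tangent_map S M \<iota> y v \<in> D1 y"
    unfolding imT[symmetric] by (cases v) auto
  show "snd v = 0 \<Longrightarrow> tangent_map S M \<iota> y v \<in> span (D2 y \<union> {\<xi> (\<iota> y)})"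
    unfolding im\<theta>[symmetric] by (cases v) auto
  assume "tangent_map S M \<iota> y v \<in> span (D2 y \<union> {\<xi> (\<iota> y)})"
  then obtain w where "w \<in> UNIV \<times> {0}" "tangent_map S M \<iota> y v = tangent_map S M \<iota> y w"
    unfolding im\<theta>[symmetric] by blast
  then show "snd v = 0" using inj_tangent[of y] by (auto simp: inj_eq)
qed

lemma slant_pointwise:
  defines "L \<equiv> tangent_map S M \<iota>" and "T \<equiv> T_part S M \<iota> g \<phi>"
  shows "L y v \<in> D1 y \<Longrightarrow> L y (T y v) = \<phi> (\<iota> y) (L y v)"
    "L y v \<in> span (D2 y \<union> {\<xi> (\<iota> y)}) \<Longrightarrow> L y (T y v) \<in> D2 y"
    "L y v \<in> span (D2 y \<union> {\<xi> (\<iota> y)}) \<Longrightarrow> g (\<iota> y) (\<phi> (\<iota> y) (L y v) - L y (T y v)) (\<phi> (\<iota> y) (L y v) - L y (T y v)) =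
      (sin \<theta>)\<^sup>2 * (g (\<iota> y) (L y v) (L y v) - (\<eta> (\<iota> y) (L y v))\<^sup>2)"
proof -
  have s: "subspace (D1 y)" "subspace (D2 y)" "range (L y) = span (D1 y \<union> D2 y \<union> {\<xi> (\<iota> y)})"
    "\<phi> (\<iota> y) ` D1 y = D1 y"
    and o1: "\<And>u v. u \<in> D1 y \<Longrightarrow> v \<in> D2 y \<Longrightarrow> g (\<iota> y) u v = 0"
    and o2: "\<And>u. u \<in> D1 y \<union> D2 y \<Longrightarrow> g (\<iota> y) u (\<xi> (\<iota> y)) = 0"
    and a: "\<And>w. w \<in> D2 y \<Longrightarrow> w \<noteq> 0 \<Longrightarrow> subspace_angle (g (\<iota> y)) (\<phi> (\<iota> y) w) (D2 y) = \<theta>"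
    using ss unfolding semi_slant_submanifold_def tangent_image_def L_def by blast+
  have t: "L y (T y v) \<in> range (L y)"
    "\<And>u. u \<in> range (L y) \<Longrightarrow> g (\<iota> y) (\<phi> (\<iota> y) (L y v) - L y (T y v)) u = 0"
    using tangential_normal(1)[where x = y and v = v and \<phi> = \<phi>] unfolding L_def T_def by auto
  note P = semi_slant_pointwise[of "g (\<iota> y)" "\<phi> (\<iota> y)" "\<eta> (\<iota> y)" "\<xi> (\<iota> y)"
      "D1 y" "D2 y" "range (L y)" \<theta> "L y (T y v)" "L y v",
      OF ambient_inner_product linear_\<phi> contact(9) contact(10) contact(7) contact(6) contact(11) s(1-3) o1 o2 s(4) a t]
  show "L y v \<in> D1 y \<Longrightarrow> L y (T y v) = \<phi> (\<iota> y) (L y v)"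
    "L y v \<in> span (D2 y \<union> {\<xi> (\<iota> y)}) \<Longrightarrow> L y (T y v) \<in> D2 y"
    "L y v \<in> span (D2 y \<union> {\<xi> (\<iota> y)}) \<Longrightarrow> g (\<iota> y) (\<phi> (\<iota> y) (L y v) - L y (T y v)) (\<phi> (\<iota> y) (L y v) - L y (T y v)) =
      (sin \<theta>)\<^sup>2 * (g (\<iota> y) (L y v) (L y v) - (\<eta> (\<iota> y) (L y v))\<^sup>2)"
    using P by blast+
qed

text \<open>The tangential part lands in \<open>D2\<close>, hence in the slant factor again. This is
  what admits \<open>T Z\<close> in place of \<open>Z\<close>.\<close>

lemma T_part_horizontal: "snd v = 0 \<Longrightarrow> snd (T_part S M \<iota> g \<phi> y v) = 0"
  using slant_pointwise(2)[of y v] tangent_splitting(2,3) by (meson Un_upper1 span_superset subsetD subset_trans)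

lemma N_part_vertical: "fst v = 0 \<Longrightarrow> N_part S M \<iota> g \<phi> y v = 0"
  using slant_pointwise(1)[of y v] tangent_splitting(1) by (simp add: tangential_normal(2))

lemma form_vertical:
  assumes "fst v = 0"
  shows "\<eta> (\<iota> y) (tangent_map S M \<iota> y v) = 0"
  using ss tangent_splitting(1)[OF assms, of y] unfolding semi_slant_submanifold_def contact(10)[symmetric] by blast

lemma N_part_norm:
  assumes "snd v = 0"
  shows "g (\<iota> y) (N_part S M \<iota> g \<phi> y v) (N_part S M \<iota> g \<phi> y v) =
    (sin \<theta>)\<^sup>2 * (warped_metric g\<theta> f gT y v v - (\<eta> (\<iota> y) (tangent_map S M \<iota> y v))\<^sup>2)"
  using slant_pointwise(3)[OF tangent_splitting(2)[OF assms], of y]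
  by (simp add: tangential_normal(2) warped_facts(8)[symmetric] induced_metric_def)

text \<open>Polarisation of \<open>N_part_norm\<close>, evaluated at \<open>u + v\<close>.\<close>

lemma N_part_inner:
  assumes "snd u = 0" "snd v = 0"
  shows "g (\<iota> y) (N_part S M \<iota> g \<phi> y u) (N_part S M \<iota> g \<phi> y v) =
    (sin \<theta>)\<^sup>2 * (warped_metric g\<theta> f gT y u v - \<eta> (\<iota> y) (tangent_map S M \<iota> y u) * \<eta> (\<iota> y) (tangent_map S M \<iota> y v))"
proof -
  note add = N_part_add[of g, OF ambient_inner_product linear_tangent inj_tangent linear_\<phi>]
  have "g (\<iota> y) (N_part S M \<iota> g \<phi> y (u + v)) (N_part S M \<iota> g \<phi> y (u + v)) =
      (sin \<theta>)\<^sup>2 * (warped_metric g\<theta> f gT y (u + v) (u + v) - (\<eta> (\<iota> y) (tangent_map S M \<iota> y (u + v)))\<^sup>2)"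
    by (rule N_part_norm) (simp add: assms)
  then show ?thesis
    using N_part_norm[OF assms(1), of y] N_part_norm[OF assms(2), of y]
    unfolding warped_facts(8)[symmetric] induced_metric_def
    by (simp add: add linear_add[OF linear_tangent] linear_add[OF linear_\<eta>] inner_product_simps[OF ambient_inner_product] power2_eq_square
        inner_product_commute[OF ambient_inner_product, of _ "N_part S M \<iota> g \<phi> y v" "N_part S M \<iota> g \<phi> y u"]
        inner_product_commute[OF ambient_inner_product, of _ "tangent_map S M \<iota> y v" "tangent_map S M \<iota> y u"] algebra_simps)
qed

text \<open>A vertical derivative of the contact form on horizontal vectors vanishes: the pulled back form
  is closed and kills vertical vectors.\<close>

lemma form_vertical_deriv:
  assumes U: "open U" "x \<in> U" and X: "fst (X x) = 0"
    and Z: "smooth_field_on S U Z" "\<And>y. y \<in> U \<Longrightarrow> snd (Z y) = 0"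
  defines "k \<equiv> chart_at S x"
  shows "((\<lambda>z. \<eta> (\<iota> (chart_inv k z)) (tangent_map S M \<iota> (chart_inv k z) (Z (chart_inv k z)))) has_derivative
      deriv_at (\<lambda>z. \<eta> (\<iota> (chart_inv k z)) (tangent_map S M \<iota> (chart_inv k z) (Z (chart_inv k z)))) (chart_map k x))
      (at (chart_map k x))"
    "deriv_at (\<lambda>z. \<eta> (\<iota> (chart_inv k z)) (tangent_map S M \<iota> (chart_inv k z) (Z (chart_inv k z)))) (chart_map k x) (X x) =
      \<eta> (\<iota> x) (tangent_map S M \<iota> x (component_deriv S X Z x))"
proof -
  note S = warped_facts(6)
  have k: "k \<in> atlas S" "x \<in> chart_dom k" using chart_at_props[OF S] by (simp_all add: k_def)
  obtain p q where pq: "x = (p, q)" by (cases x)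
  define c where "c = chart_at N\<theta> p"
  define d where "d = chart_at NT q"
  have kk: "k = prod_chart c d" by (simp add: k_def S_eq pq prod_manifold_chart_at c_def d_def)
  have c: "c \<in> atlas N\<theta>" and d: "d \<in> atlas NT" using chart_at_props warped_facts(1,2) by (simp_all add: c_def d_def)
  define \<zeta> where "\<zeta> = (\<lambda>z. components S k (chart_inv k z) (Z (chart_inv k z)))"
  define a where "a = (\<lambda>z u. \<eta> (\<iota> (chart_inv k z)) (tangent_map S M \<iota> (chart_inv k z) (coord_field S k u (chart_inv k z))))"
  have inv: "chart_inv k (chart_map k x) = x" using chart_props(3)[OF S k] .
  define P where "P = chart_map k ` chart_dom k"
  have P: "open P" "chart_map k x \<in> P" unfolding P_def using chart_props(2)[OF S k(1)] k(2) by blast+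
  have cl: "deriv_at (\<lambda>z. a z u) (chart_map k x) v = deriv_at (\<lambda>z. a z v) (chart_map k x) u"
    "(\<lambda>z. a z u) differentiable at (chart_map k x)" for u v
    unfolding a_def k_def by (rule kenmotsu_pullback_form_closed[OF K S warped_facts(7)])+
  have \<zeta>x: "\<zeta> (chart_map k x) = Z x" by (simp add: \<zeta>_def inv components_chart_at[OF S, of x, folded k_def])
  have ax: "a (chart_map k x) u = \<eta> (\<iota> x) (tangent_map S M \<iota> x u)" for u
    by (simp add: a_def inv coord_field_chart_at[OF S, of x, folded k_def])
  have "((\<lambda>z. a z (\<zeta> z)) has_derivative (\<lambda>w. deriv_at (\<lambda>z. a z (\<zeta> (chart_map k x))) (chart_map k x) w
      + a (chart_map k x) (component_deriv S (\<lambda>_. w) Z x))) (at (chart_map k x))"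
  proof (rule has_derivative_linear_apply[OF P])
    show "linear (a z)" if "z \<in> P" for z
      using linear_compose[OF linear_compose[OF linear_coord_field[OF S k(1) chart_props(5)[OF S k(1) that[unfolded P_def]]] linear_tangent] linear_\<eta>]
      unfolding a_def o_def .
    show "(\<lambda>z. a z v) differentiable at (chart_map k x)" for v by (rule cl(2))
    show "(\<zeta> has_derivative (\<lambda>w. component_deriv S (\<lambda>_. w) Z x)) (at (chart_map k x))"
      using components_deriv[OF warped_facts(1,2) S[unfolded S_eq] U Z(1)[unfolded S_eq]] unfolding \<zeta>_def k_def S_eq .
  qed
  then have D: "((\<lambda>z. \<eta> (\<iota> (chart_inv k z)) (tangent_map S M \<iota> (chart_inv k z) (Z (chart_inv k z)))) has_derivative
      (\<lambda>w. deriv_at (\<lambda>z. a z (Z x)) (chart_map k x) w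
      + \<eta> (\<iota> x) (tangent_map S M \<iota> x (component_deriv S (\<lambda>_. w) Z x)))) (at (chart_map k x))"
    unfolding \<zeta>x ax
    by (rule has_derivative_transform_within_open[OF _ P])
      (simp add: a_def \<zeta>_def components_coord_field(2)[OF S k(1) chart_props(5)[OF S k(1)]] P_def)
  then show "((\<lambda>z. \<eta> (\<iota> (chart_inv k z)) (tangent_map S M \<iota> (chart_inv k z) (Z (chart_inv k z)))) has_derivative
      deriv_at (\<lambda>z. \<eta> (\<iota> (chart_inv k z)) (tangent_map S M \<iota> (chart_inv k z) (Z (chart_inv k z)))) (chart_map k x))
      (at (chart_map k x))"
    using deriv_at_eqI[OF D] by simp
  \<comment> \<open>Constant vertical components stay vertical throughout a product chart, so the
    form vanishes on them there. Closedness then exchanges \<open>X x\<close> and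
    \<open>Z x\<close>, which removes the coefficient term of \<open>D\<close> in direction
    \<open>X x\<close>.\<close>
  have "((\<lambda>z. a z (X x)) has_derivative (\<lambda>_. 0)) (at (chart_map k x))"
  proof (rule has_derivative_transform_within_open[OF has_derivative_const[of 0] P])
    fix z
    assume z: "z \<in> P"
    have i: "chart_inv k z \<in> chart_dom k" using chart_props(5)[OF S k(1)] z by (simp add: P_def)
    then obtain r s where rs: "chart_inv k z = (r, s)" "r \<in> chart_dom c" "s \<in> chart_dom d"
      by (auto simp: kk prod_chart_simps)
    have "coord_field S k (X x) (chart_inv k z) = (coord_field N\<theta> c (fst (X x)) r, coord_field NT d (snd (X x)) s)"
      using coord_field_prod[OF warped_facts(1,2) S[unfolded S_eq] c rs(2) d rs(3), of "fst (X x)" "snd (X x)"]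
      unfolding rs(1) unfolding kk S_eq by simp
    then have "fst (coord_field S k (X x) (chart_inv k z)) = 0"
      by (simp add: X linear_0[OF linear_coord_field[OF warped_facts(1) c rs(2)]])
    from form_vertical[OF this] show "0 = a z (X x)" by (simp add: a_def)
  qed
  from deriv_at_eqI[OF this] have "deriv_at (\<lambda>z. a z (Z x)) (chart_map k x) (X x) = 0"
    using cl(1)[of "Z x" "X x"] by simp
  then show "deriv_at (\<lambda>z. \<eta> (\<iota> (chart_inv k z)) (tangent_map S M \<iota> (chart_inv k z) (Z (chart_inv k z)))) (chart_map k x) (X x) =
      \<eta> (\<iota> x) (tangent_map S M \<iota> x (component_deriv S X Z x))"
    unfolding deriv_at_eqI[OF D] by (simp add: component_deriv_def)
qed

text \<open>Both \<open>g(conn_along X (N Z), N Z)\<close> and \<open>g(N (nabS X Z), N Z)\<close> are equal to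
  \<open>(sin \<theta>)\<^sup>2 (g(V, Z) - \<eta> V * \<eta> Z)\<close>, where \<open>V\<close> is the coordinate derivative of \<open>Z\<close> along \<open>X\<close>.\<close>

lemma cov_deriv_N_orthogonal:
  assumes U: "open U" "x \<in> U"
    and X: "smooth_field_on S U X" "\<And>y. y \<in> U \<Longrightarrow> fst (X y) = 0"
    and Z: "smooth_field_on S U Z" "\<And>y. y \<in> U \<Longrightarrow> snd (Z y) = 0"
  shows "g (\<iota> x) (cov_deriv_N S M \<iota> g \<phi> nab nabS X Z x) (N_part S M \<iota> g \<phi> x (Z x)) = 0"
proof -
  note S = warped_facts(6)
  define k where "k = chart_at S x"
  define c where "c = chart_at M (\<iota> x)"
  have k: "k \<in> atlas S" "x \<in> chart_dom k" using chart_at_props[OF S] by (simp_all add: k_def)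
  have c: "c \<in> atlas M" "\<iota> x \<in> chart_dom c" using chart_at_props[OF contact(1)] by (simp_all add: c_def)
  \<comment> \<open>On points sent into a single ambient chart \<open>T_part_smooth\<close> applies;
    it supplies the differentiability of \<open>N Z\<close> that
    \<open>connection_along_metric\<close> demands.\<close>
  define V where "V = U \<inter> chart_dom k \<inter> \<iota> -` chart_dom c"
  have "open (\<iota> -` chart_dom c)"
    using warped_facts(7) chart_props(1)[OF contact(1) c(1)] unfolding smooth_map_def by (simp add: continuous_on_open_vimage)
  then have V: "open V" "x \<in> V" "V \<subseteq> U" "V \<subseteq> chart_dom k" "\<iota> ` V \<subseteq> chart_dom c"
    unfolding V_def using U k c chart_props(1)[OF S k(1)] by auto
  define N where "N = N_part S M \<iota> g \<phi>"
  define W where "W = component_deriv S X Z x"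
  have sZ: "smooth_field_on S V Z" by (rule smooth_field_on_subset[OF Z(1) V(3)])
  have hZ: "snd (Z y) = 0" if "y \<in> V" for y using that V(3) Z(2) by blast
  note Xx = X(2)[OF U(2)] and Zx = Z(2)[OF U(2)]
  define T where "T = chart_map k ` V"
  have "T = chart_map k ` (chart_dom k \<inter> V)" unfolding T_def using V(4) by (simp add: Int_absorb1)
  then have T: "open T" "chart_map k x \<in> T"
    using open_chart_image[OF S k(1) V(1)] V(2) by (auto simp: T_def)
  have W: "snd W = 0"
    using component_deriv_horizontal(1)[OF warped_facts(1,2) S[unfolded S_eq] U Z[unfolded S_eq]] by (simp add: W_def S_eq)
  have "(\<lambda>z. components M c (\<iota> (chart_inv k z)) (N (chart_inv k z) (Z (chart_inv k z)))) differentiable at (chart_map k x)"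
    using smooth_on_differentiable[OF T_part_smooth(2)[OF warped_facts(5) contact(5,2) k(1) c(1) V(1,4,5) sZ, folded T_def] T]
    by (simp add: N_def)
  from connection_along_metric[OF S contact(1) warped_facts(7) contact(5) kenmotsuD(2)[OF K] this[unfolded k_def c_def], of X]
  have 1: "2 * g (\<iota> x) (connection_along S M \<iota> nab X (\<lambda>y. N y (Z y)) x) (N x (Z x)) =
      deriv_at (\<lambda>z. g (\<iota> (chart_inv k z)) (N (chart_inv k z) (Z (chart_inv k z))) (N (chart_inv k z) (Z (chart_inv k z)))) (chart_map k x) (X x)"
    by (simp add: k_def)
  define h where "h = (\<lambda>z. warped_metric g\<theta> f gT (chart_inv k z) (Z (chart_inv k z)) (Z (chart_inv k z)))"
  define e where "e = (\<lambda>z. \<eta> (\<iota> (chart_inv k z)) (tangent_map S M \<iota> (chart_inv k z) (Z (chart_inv k z))))"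
  note wv = warped_metric_vertical_deriv[where X = X and x = x and f = f, OF warped_facts(1,2) S[unfolded S_eq] warped_facts(3,4) U
      Z[unfolded S_eq] Z[unfolded S_eq] Xx, folded S_eq]
  have h: "(h has_derivative deriv_at h (chart_map k x)) (at (chart_map k x))"
    using wv(2) unfolding h_def k_def by (rule has_derivative_deriv_at)
  have hX: "deriv_at h (chart_map k x) (X x) = warped_metric g\<theta> f gT x W (Z x) + warped_metric g\<theta> f gT x (Z x) W"
    using wv(1) by (simp add: h_def k_def W_def dir_deriv_def o_def)
  note e = form_vertical_deriv[where X = X and x = x, OF U Xx Z, folded k_def, folded e_def W_def]
  have ex: "e (chart_map k x) = \<eta> (\<iota> x) (tangent_map S M \<iota> x (Z x))"
    by (simp add: e_def chart_props(3)[OF S k])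
  \<comment> \<open>The bracket is the squared length of the part of \<open>Z\<close> orthogonal to
    \<xi>; by \<open>N_part_norm\<close> the whole function equals the squared norm of
    \<open>N Z\<close> on \<open>T\<close>.\<close>
  have "((\<lambda>z. (sin \<theta>)\<^sup>2 * (h z - e z * e z)) has_derivative (\<lambda>w. (sin \<theta>)\<^sup>2 * (deriv_at h (chart_map k x) w
      - (e (chart_map k x) * deriv_at e (chart_map k x) w + deriv_at e (chart_map k x) w * e (chart_map k x))))) (at (chart_map k x))"
    by (intro has_derivative_mult_right has_derivative_diff has_derivative_mult h e(1))
  then have "((\<lambda>z. g (\<iota> (chart_inv k z)) (N (chart_inv k z) (Z (chart_inv k z))) (N (chart_inv k z) (Z (chart_inv k z)))) has_derivative
      (\<lambda>w. (sin \<theta>)\<^sup>2 * (deriv_at h (chart_map k x) w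
      - (e (chart_map k x) * deriv_at e (chart_map k x) w + deriv_at e (chart_map k x) w * e (chart_map k x))))) (at (chart_map k x))"
  proof (rule has_derivative_transform_within_open[OF _ T])
    fix z
    assume "z \<in> T"
    then obtain y where y: "y \<in> V" "z = chart_map k y" by (auto simp: T_def)
    have "chart_inv k z = y" using chart_props(3)[OF S k(1)] y V(4) by blast
    then show "(sin \<theta>)\<^sup>2 * (h z - e z * e z) =
        g (\<iota> (chart_inv k z)) (N (chart_inv k z) (Z (chart_inv k z))) (N (chart_inv k z) (Z (chart_inv k z)))"
      by (simp add: h_def e_def N_def N_part_norm[OF hZ[OF y(1)]] power2_eq_square)
  qed
  from deriv_at_eqI[OF this] 1
  have "2 * g (\<iota> x) (connection_along S M \<iota> nab X (\<lambda>y. N y (Z y)) x) (N x (Z x)) =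
      (sin \<theta>)\<^sup>2 * (warped_metric g\<theta> f gT x W (Z x) + warped_metric g\<theta> f gT x (Z x) W
        - 2 * (\<eta> (\<iota> x) (tangent_map S M \<iota> x (Z x)) * \<eta> (\<iota> x) (tangent_map S M \<iota> x W)))"
    by (simp add: hX e(2) ex)
  moreover have "warped_metric g\<theta> f gT x (Z x) W = warped_metric g\<theta> f gT x W (Z x)"
    unfolding warped_facts(8)[symmetric] induced_metric_def by (rule inner_product_commute[OF ambient_inner_product])
  \<comment> \<open>The derivative has produced the mixed expression in \<open>W\<close> and
    \<open>Z\<close>, which \<open>N_part_inner\<close> reads back as an inner product of normal
    parts.\<close>
  ultimately have conn: "g (\<iota> x) (connection_along S M \<iota> nab X (\<lambda>y. N y (Z y)) x) (N x (Z x)) = g (\<iota> x) (N x W) (N x (Z x))"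
    unfolding N_def N_part_inner[OF W Zx] by (simp add: algebra_simps)
  have "fst (nabS X Z x) = fst W"
    unfolding W_def S_eq
    by (rule warped_connection_horizontal[OF warped_facts(1,2) S[unfolded S_eq] warped_facts(3,4) lcS[unfolded warped_facts(8), unfolded S_eq] U
          X[unfolded S_eq] Z[unfolded S_eq]])
  then have "nabS X Z x = W + (0, snd (nabS X Z x))" using W by (simp add: prod_eq_iff)
  from arg_cong[of _ _ "N x", OF this] have "N x (nabS X Z x) = N x W + N x (0, snd (nabS X Z x))"
    unfolding N_def by (simp only: N_part_add[of g, OF ambient_inner_product linear_tangent inj_tangent linear_\<phi>])
  then have nS: "N x (nabS X Z x) = N x W" by (simp add: N_def N_part_vertical)
  have normal: "g (\<iota> x) (N x (Z x)) (tangent_map S M \<iota> x u) = 0" for u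
    unfolding N_def tangential_normal(2) by (rule tangential_normal(1))
  have "g (\<iota> x) (normal_part S M \<iota> g x w) (N x (Z x)) = g (\<iota> x) w (N x (Z x))" for w
    by (rule normal_part_inner[of g, OF ambient_inner_product linear_tangent inj_tangent normal])
  then show ?thesis
    using conn nS unfolding cov_deriv_N_def normal_connection_def N_def by (simp add: inner_product_simps[OF ambient_inner_product])
qed

text \<open>Smoothness is obtained on a neighbourhood that \<iota> maps into one chart, which is
  enough because the orthogonality statement concerns a single point.\<close>

lemma T_part_smooth_near:
  assumes U: "open U" "x \<in> U" and Z: "smooth_field_on S U Z"
  shows "\<exists>V. open V \<and> x \<in> V \<and> V \<subseteq> U \<and> smooth_field_on S V (\<lambda>y. T_part S M \<iota> g \<phi> y (Z y))"
proof -
  note S = warped_facts(6)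
  define k where "k = chart_at S x"
  define c where "c = chart_at M (\<iota> x)"
  have k: "k \<in> atlas S" "x \<in> chart_dom k" using chart_at_props[OF S] by (simp_all add: k_def)
  have c: "c \<in> atlas M" "\<iota> x \<in> chart_dom c" using chart_at_props[OF contact(1)] by (simp_all add: c_def)
  define V where "V = U \<inter> chart_dom k \<inter> \<iota> -` chart_dom c"
  have "open (\<iota> -` chart_dom c)"
    using warped_facts(7) chart_props(1)[OF contact(1) c(1)] unfolding smooth_map_def by (simp add: continuous_on_open_vimage)
  then have V: "open V" "x \<in> V" "V \<subseteq> U" "V \<subseteq> chart_dom k" "\<iota> ` V \<subseteq> chart_dom c"
    unfolding V_def using U k c chart_props(1)[OF S k(1)] by auto
  then show ?thesis
    using T_part_smooth(1)[OF warped_facts(5) contact(5,2) k(1) c(1) V(1,4,5) smooth_field_on_subset[OF Z V(3)]] by blast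
qed

text \<open>The second claim is the first one for the field \<open>T Z\<close>, on a neighbourhood
  where that field is smooth.\<close>

lemma cov_deriv_N_eq_0:
  assumes U: "open U" "x \<in> U"
    and X: "smooth_field_on S U X" "\<And>y. y \<in> U \<Longrightarrow> X y \<in> {0} \<times> UNIV"
    and Z: "smooth_field_on S U Z" "\<And>y. y \<in> U \<Longrightarrow> Z y \<in> UNIV \<times> {0}"
  shows "g (\<iota> x) (cov_deriv_N S M \<iota> g \<phi> nab nabS X Z x) (N_part S M \<iota> g \<phi> x (Z x)) = 0"
    "g (\<iota> x) (cov_deriv_N S M \<iota> g \<phi> nab nabS X (\<lambda>y. T_part S M \<iota> g \<phi> y (Z y)) x)
      (N_part S M \<iota> g \<phi> x (T_part S M \<iota> g \<phi> x (Z x))) = 0"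
proof -
  have hX: "fst (X y) = 0" and hZ: "snd (Z y) = 0" if "y \<in> U" for y
    using X(2)[OF that] Z(2)[OF that] by (auto simp: mem_Times_iff)
  show "g (\<iota> x) (cov_deriv_N S M \<iota> g \<phi> nab nabS X Z x) (N_part S M \<iota> g \<phi> x (Z x)) = 0"
    by (rule cov_deriv_N_orthogonal[OF U X(1) hX Z(1) hZ])
  obtain V where V: "open V" "x \<in> V" "V \<subseteq> U" "smooth_field_on S V (\<lambda>y. T_part S M \<iota> g \<phi> y (Z y))"
    using T_part_smooth_near[OF U Z(1)] by blast
  show "g (\<iota> x) (cov_deriv_N S M \<iota> g \<phi> nab nabS X (\<lambda>y. T_part S M \<iota> g \<phi> y (Z y)) x)
      (N_part S M \<iota> g \<phi> x (T_part S M \<iota> g \<phi> x (Z x))) = 0"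
    using V(3) by (intro cov_deriv_N_orthogonal[OF V(1,2) smooth_field_on_subset[OF X(1) V(3)] _ V(4)]
        T_part_horizontal hX hZ) auto
qed

end

theorem theorem4p3:
  fixes M :: "('a::{t2_space,second_countable_topology}, 'e::euclidean_space) manifold"
    and N\<theta> :: "('b::{t2_space,second_countable_topology}, 'f::euclidean_space) manifold"
    and NT :: "('c::{t2_space,second_countable_topology}, 'h::euclidean_space) manifold"
    and \<iota> :: "'b \<times> 'c \<Rightarrow> 'a"
    and g :: "'a \<Rightarrow> 'e \<Rightarrow> 'e \<Rightarrow> real" and \<phi> :: "'a \<Rightarrow> 'e \<Rightarrow> 'e"
    and \<xi> :: "'a \<Rightarrow> 'e" and \<eta> :: "'a \<Rightarrow> 'e \<Rightarrow> real"
    and nab :: "('a \<Rightarrow> 'e) \<Rightarrow> ('a \<Rightarrow> 'e) \<Rightarrow> 'a \<Rightarrow> 'e"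
    and nabS :: "('b \<times> 'c \<Rightarrow> 'f \<times> 'h) \<Rightarrow> ('b \<times> 'c \<Rightarrow> 'f \<times> 'h) \<Rightarrow> 'b \<times> 'c \<Rightarrow> 'f \<times> 'h"
    and g\<theta> :: "'b \<Rightarrow> 'f \<Rightarrow> 'f \<Rightarrow> real" and gT :: "'c \<Rightarrow> 'h \<Rightarrow> 'h \<Rightarrow> real"
    and f :: "'b \<Rightarrow> real" and \<theta> :: real
    and D1 D2 :: "'b \<times> 'c \<Rightarrow> 'e set"
    and U :: "('b \<times> 'c) set" and X Z :: "'b \<times> 'c \<Rightarrow> 'f \<times> 'h" and x :: "'b \<times> 'c"
  defines "S \<equiv> prod_manifold N\<theta> NT"
  assumes "kenmotsu M \<phi> \<xi> \<eta> g nab"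
    and "warped_product_submanifold N\<theta> NT M \<iota> g g\<theta> f gT"
    and "levi_civita S (induced_metric S M \<iota> g) nabS"
    and "semi_slant_submanifold S M \<iota> \<phi> \<xi> g D1 D2 \<theta>"
    and "\<And>y. tangent_map S M \<iota> y ` ({0} \<times> UNIV) = D1 y"
    and "\<And>y. tangent_map S M \<iota> y ` (UNIV \<times> {0}) = span (D2 y \<union> {\<xi> (\<iota> y)})"
    and "\<And>p. invariant_submanifold NT M (\<lambda>q. \<iota> (p, q)) \<phi>"
    and "\<And>q. proper_slant_submanifold N\<theta> M (\<lambda>p. \<iota> (p, q)) \<phi> \<xi> g \<theta>"
    and "open U" and "x \<in> U"
    and "smooth_field_on S U X" and "\<And>y. y \<in> U \<Longrightarrow> X y \<in> {0} \<times> UNIV"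
    and "smooth_field_on S U Z" and "\<And>y. y \<in> U \<Longrightarrow> Z y \<in> UNIV \<times> {0}"
  shows "g (\<iota> x) (cov_deriv_N S M \<iota> g \<phi> nab nabS X Z x) (N_part S M \<iota> g \<phi> x (Z x)) =
    (1 / cos \<theta>)\<^sup>2 *
    g (\<iota> x) (cov_deriv_N S M \<iota> g \<phi> nab nabS X (\<lambda>y. T_part S M \<iota> g \<phi> y (Z y)) x)
      (N_part S M \<iota> g \<phi> x (T_part S M \<iota> g \<phi> x (Z x)))"
proof -
  note zero = cov_deriv_N_eq_0[OF meta_eq_to_obj_eq[OF assms(1)] assms(2-7) assms(10-15)]
  show ?thesis by (simp only: zero mult_zero_right)
qed

end
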